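(* Let $\pi_1,\dots,\pi_k$ be permutations and let $n\ge2$ be an integer such that $(n-1)^2\ge k+2$, the vectors $\nabla h^n_{\pi_1}(\vec0),\dots,\nabla h^n_{\pi_{k-1}}(\vec0)$ are linearly independent, and $\alpha_1\nabla h^n_{\pi_1}(\vec0)+\dots+\alpha_k\nabla h^n_{\pi_k}(\vec0)=\vec0$ for some reals $\alpha_1,\dots,\alpha_k$ not all zero. If there exist vectors $w^+,w^-\in\mathbb R^{(n-1)^2}$, each orthogonal to every $\nabla h^n_{\pi_i}(\vec0)$, $i\in[k-1]$, such that $$(w^+)^T\Big(\sum_{i=1}^k\alpha_iH^n_{\pi_i}(\vec0)\Big)w^+>0\quad\text{and}\quad (w^-)^T\Big(\sum_{i=1}^k\alpha_iH^n_{\pi_i}(\vec0)\Big)w^-<0,$$ then $\{\pi_1,\dots,\pi_k\}$ is not quasirandom-forcing.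
   Context: For $n\ge2$ and $j,j'\in[n-1]$ let $Z^{j,j'}$ be the $n\times n$ matrix with entries $+1$ at positions $(j,j')$ and $(j+1,j'+1)$, $-1$ at positions $(j+1,j')$ and $(j,j'+1)$, and $0$ elsewhere; let $B(x)=J+\sum_{j,j'\in[n-1]}x_{(j-1)(n-1)+j'}Z^{j,j'}$ for $x\in\mathbb R^{(n-1)^2}$, with $J$ the $n\times n$ all-one matrix. For a permutation $\sigma$ of size $s$ define the polynomial $h^n_\sigma:\mathbb R^{(n-1)^2}\to\mathbb R$ by $$h^n_\sigma(x)=-\frac{n^{2s}}{s!}+s!\sum_{f,g:[s]\nearrow[n]}\frac{\prod_{i\in[s]}B(x)_{f(i),g(\sigma(i))}}{\prod_{i\in[n]}|f^{-1}(i)|!\,|g^{-1}(i)|!},$$ the sum over pairs of non-decreasing functions $f,g:[s]\to[n]$. $\nabla h^n_\sigma(\vec0)$ denotes its gradient at $\vec0$ and $H^n_\sigma(\vec0)$ its Hessian matrix at $\vec0$. Pattern density $d(\sigma,\pi)$: probability that a uniformly random $|\sigma|$-subset of positions of $\pi$ induces $\sigma$. A set $S$ of permutations is quasirandom-forcing if every sequence of permutations with sizes tending to infinity and $d(\sigma,\pi_m)\to1/|\sigma|!$ for all $\sigma\in S$ has $d(\sigma,\pi_m)\to1/|\sigma|!$ for all permutations $\sigma$. *)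

theory Defs
  imports "HOL-Analysis.Analysis" "HOL-Combinatorics.Permutations"
begin

text \<open>
  A permutation carries its size explicitly: the pair \<open>(s, \<sigma>)\<close> with \<open>\<sigma> permutes {1..s}\<close>.
  (The function alone does not determine the size, since it is the identity outside \<open>{1..s}\<close>.)
\<close>

type_synonym sized_perm = "nat \<times> (nat \<Rightarrow> nat)"

definition is_perm :: "sized_perm \<Rightarrow> bool" where
  "is_perm \<sigma> \<longleftrightarrow> snd \<sigma> permutes {1..fst \<sigma>}"

definition induces :: "sized_perm \<Rightarrow> nat set \<Rightarrow> sized_perm \<Rightarrow> bool" where
  "induces \<pi> A \<sigma> \<longleftrightarrow>
     (\<exists>a. strict_mono_on {1..fst \<sigma>} a \<and> a ` {1..fst \<sigma>} = A \<and>
        (\<forall>i\<in>{1..fst \<sigma>}. \<forall>j\<in>{1..fst \<sigma>}.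
           snd \<pi> (a i) < snd \<pi> (a j) \<longleftrightarrow> snd \<sigma> i < snd \<sigma> j))"

text \<open>The density is \<open>0\<close> (as \<open>0 / 0\<close>) if \<open>\<sigma>\<close> is larger than \<open>\<pi>\<close>.\<close>

definition pattern_density :: "sized_perm \<Rightarrow> sized_perm \<Rightarrow> real" where
  "pattern_density \<sigma> \<pi> =
     real (card {A. A \<subseteq> {1..fst \<pi>} \<and> card A = fst \<sigma> \<and> induces \<pi> A \<sigma>}) /
     real (card {A. A \<subseteq> {1..fst \<pi>} \<and> card A = fst \<sigma>})"

definition quasirandom_forcing :: "sized_perm set \<Rightarrow> bool" where
  "quasirandom_forcing S \<longleftrightarrow>
     (\<forall>p :: nat \<Rightarrow> sized_perm.
        (\<forall>m. is_perm (p m)) \<longrightarrow>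
        filterlim (\<lambda>m. fst (p m)) at_top sequentially \<longrightarrow>
        (\<forall>\<sigma>\<in>S. (\<lambda>m. pattern_density \<sigma> (p m)) \<longlonglongrightarrow> 1 / fact (fst \<sigma>)) \<longrightarrow>
        (\<forall>\<sigma>. is_perm \<sigma> \<longrightarrow> (\<lambda>m. pattern_density \<sigma> (p m)) \<longlonglongrightarrow> 1 / fact (fst \<sigma>)))"

text \<open>
  Vectors of \<open>\<real>\<^sup>N\<close> are functions \<open>nat \<Rightarrow> real\<close> and \<open>n \<times> n\<close> matrices are functions
  \<open>nat \<Rightarrow> nat \<Rightarrow> real\<close>, of which only the values at indices in \<open>{1..N}\<close> and \<open>{1..n}\<close> matter.
\<close>

definition Z_mat :: "nat \<Rightarrow> nat \<Rightarrow> nat \<Rightarrow> nat \<Rightarrow> real" where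
  "Z_mat j j' a b =
     (if (a = j \<and> b = j') \<or> (a = j + 1 \<and> b = j' + 1) then 1
      else if (a = j + 1 \<and> b = j') \<or> (a = j \<and> b = j' + 1) then - 1
      else 0)"

definition B_mat :: "nat \<Rightarrow> (nat \<Rightarrow> real) \<Rightarrow> nat \<Rightarrow> nat \<Rightarrow> real" where
  "B_mat n x a b =
     1 + (\<Sum>j = 1..n - 1. \<Sum>j' = 1..n - 1. x ((j - 1) * (n - 1) + j') * Z_mat j j' a b)"

definition nondec_funs :: "nat \<Rightarrow> nat \<Rightarrow> (nat \<Rightarrow> nat) set" where
  "nondec_funs s n = {f \<in> {1..s} \<rightarrow>\<^sub>E {1..n}. mono_on {1..s} f}"

definition h_poly :: "nat \<Rightarrow> sized_perm \<Rightarrow> (nat \<Rightarrow> real) \<Rightarrow> real" where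
  "h_poly n \<sigma> x =
     (let s = fst \<sigma> in
      - (real n ^ (2 * s) / fact s) +
      fact s * (\<Sum>f \<in> nondec_funs s n. \<Sum>g \<in> nondec_funs s n.
        (\<Prod>i = 1..s. B_mat n x (f i) (g (snd \<sigma> i))) /
        (\<Prod>i = 1..n. fact (card {j \<in> {1..s}. f j = i}) * fact (card {j \<in> {1..s}. g j = i}))))"

definition partial_deriv :: "nat \<Rightarrow> ((nat \<Rightarrow> real) \<Rightarrow> real) \<Rightarrow> (nat \<Rightarrow> real) \<Rightarrow> real" where
  "partial_deriv i f x = deriv (\<lambda>t. f (x(i := t))) (x i)"

definition gradient :: "((nat \<Rightarrow> real) \<Rightarrow> real) \<Rightarrow> (nat \<Rightarrow> real) \<Rightarrow> nat \<Rightarrow> real" where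
  "gradient f x i = partial_deriv i f x"

definition hessian :: "((nat \<Rightarrow> real) \<Rightarrow> real) \<Rightarrow> (nat \<Rightarrow> real) \<Rightarrow> nat \<Rightarrow> nat \<Rightarrow> real" where
  "hessian f x i j = partial_deriv i (partial_deriv j f) x"

definition lin_indep_family :: "nat \<Rightarrow> nat \<Rightarrow> (nat \<Rightarrow> nat \<Rightarrow> real) \<Rightarrow> bool" where
  "lin_indep_family N m v \<longleftrightarrow>
     (\<forall>c :: nat \<Rightarrow> real.
        (\<forall>j\<in>{1..N}. (\<Sum>i = 1..m. c i * v i j) = 0) \<longrightarrow> (\<forall>i\<in>{1..m}. c i = 0))"

definition inner_prod :: "nat \<Rightarrow> (nat \<Rightarrow> real) \<Rightarrow> (nat \<Rightarrow> real) \<Rightarrow> real" where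
  "inner_prod N u v = (\<Sum>j = 1..N. u j * v j)"

definition quad_form :: "nat \<Rightarrow> (nat \<Rightarrow> nat \<Rightarrow> real) \<Rightarrow> (nat \<Rightarrow> real) \<Rightarrow> real" where
  "quad_form N M w = (\<Sum>a = 1..N. \<Sum>b = 1..N. w a * M a b * w b)"

end

theory Submission
  imports Defs "HOL-Computational_Algebra.Polynomial"
begin

text \<open>
  Let \<open>v\<^sub>1, \<dots>, v\<^sub>k\<^sub>-\<^sub>1\<close> be a dual basis of the first \<open>k - 1\<close> gradients
  and let \<open>u(\<theta>, y)\<close> be the point \<open>(1 - \<theta>) w\<^sup>+ + \<theta> w\<^sup>- + \<Sum> y\<^sub>l v\<^sub>l\<close>. For a fixed small \<open>t\<close>, Taylor
  expansion gives \<open>h\<^sub>l(t u) \<approx> t y\<^sub>l\<close> for \<open>l < k\<close>, while \<open>\<Sum> \<alpha>\<^sub>i h\<^sub>i(t u) \<approx> t\<^sup>2/2\<close> times the Hessian form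
  at \<open>u\<close>, which is positive for \<open>\<theta> = 0\<close> and negative for \<open>\<theta> = 1\<close>. Hence the Poincare-Miranda theorem,
  applied in the \<open>k\<close> variables \<open>(\<theta>, y)\<close>, yields a common zero \<open>x = t u \<noteq> 0\<close> of all \<open>h\<^sub>i\<close>, as close to
  \<open>0\<close> as desired, so that \<open>B(x)\<close> is a nonnegative matrix with all line sums \<open>n\<close> and different from \<open>J\<close>.

  Points sampled independently from the step permuton \<open>B(x)/n\<^sup>2\<close> form large permutations whose density
  of \<open>\<sigma>\<close> tends to \<open>1/s! + h\<^sub>\<sigma>(x)/n\<^sup>2\<^sup>s\<close> (second moment method), which is \<open>1/s!\<close> for every \<open>\<pi>\<^sub>i\<close>.
  If every pattern had density \<open>1/s!\<close>, then the moments \<open>\<integral> x\<^sup>p y\<^sup>r d\<mu>\<close> of the permuton would be those of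
  the uniform one: \<open>x\<^sup>p y\<^sup>r\<close> is the probability that a point at \<open>(x, y)\<close> is to the right of \<open>p\<close> and above
  \<open>r\<close> further sample points, all \<open>p + r\<close> of them distinct, and this depends on pattern probabilities only.
  The moments determine the matrix, so \<open>B(x) = J\<close>, a contradiction.
\<close>

section \<open>The Poincare-Miranda theorem\<close>

text \<open>The gradients at the origin are dependent, so the implicit function theorem gives no
  common zeros there. Independence of the first k - 1 gradients forces \<open>\<alpha> k\<close> to
  be nonzero, hence the last equation may be traded for the vanishing of the combination, which has
  no linear term. Of its quadratic part only a positive and a negative value are known, which calls
  for a topological intermediate value argument. Two scales are involved: the displacement along the
  dual vectors is shrunk by a factor \<epsilon> that preserves the sign of the quadratic form at
  both ends of the segment, and only then t is chosen, so small that linear terms of size t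
  \<epsilon> beat remainders of order t^2.

  The probabilistic part consists of finite sums over cells and tie-breaking permutations, without
  measures. Forcing is refuted on a finite set of patterns, the given ones and one of deviating
  density, so a single good outcome for each sample size suffices.\<close>

lemma tendsto_fun_coordinatewise:
  fixes X :: "nat \<Rightarrow> nat \<Rightarrow> real"
  assumes "\<And>j. (\<lambda>m. X m j) \<longlonglongrightarrow> z j"
  shows "X \<longlonglongrightarrow> z"
proof -
  have "limitin (product_topology (\<lambda>_. euclidean) UNIV) X z sequentially"
    using assms by (subst limitin_componentwise) (auto simp: limitin_canonical_iff)
  then show ?thesis
    by (simp add: euclidean_product_topology limitin_canonical_iff)
qed

text \<open>Tychonoff: \<open>nat \<Rightarrow> real\<close> carries the product topology, so
  convergent subsequences can be extracted with no reference to the number of relevant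
  coordinates.\<close>

lemma compact_unit_cube: "compact {x :: nat \<Rightarrow> real. \<forall>j. x j \<in> {0..1}}"
proof -
  have "compactin (product_topology (\<lambda>_. euclidean) UNIV) (PiE UNIV (\<lambda>_::nat. {0..1::real}))"
    by (subst compactin_PiE) auto
  moreover have "PiE UNIV (\<lambda>_::nat. {0..1::real}) = {x. \<forall>j. x j \<in> {0..1}}"
    by (auto simp: PiE_def)
  ultimately show ?thesis
    by (simp add: euclidean_product_topology)
qed

text \<open>Kuhn's combinatorial lemma, the discrete core of Brouwer's theorem, supplies on each
  grid of mesh 1/(m + 1) a small cube such that every \<open>F i\<close> is \<ge> 0 at one of its
  vertices and \<le> 0 at another. A limit point of these cubes is a common zero.\<close>

theorem poincare_miranda:
  fixes F :: "nat \<Rightarrow> (nat \<Rightarrow> real) \<Rightarrow> real"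
  assumes cont: "\<And>i. i < K \<Longrightarrow> continuous_on UNIV (F i)"
    and lo: "\<And>i x. i < K \<Longrightarrow> (\<And>j. x j \<in> {0..1}) \<Longrightarrow> x i = 0 \<Longrightarrow> F i x \<ge> 0"
    and hi: "\<And>i x. i < K \<Longrightarrow> (\<And>j. x j \<in> {0..1}) \<Longrightarrow> x i = 1 \<Longrightarrow> F i x \<le> 0"
  obtains x where "\<And>j. x j \<in> {0..1}" "\<And>i. i < K \<Longrightarrow> F i x = 0"
proof -
  \<comment> \<open>Scales grid points to the cube. Coordinates from K on get 0, so the result lies
    in the infinite cube whatever x is there.\<close>
  define pt :: "nat \<Rightarrow> (nat \<Rightarrow> nat) \<Rightarrow> nat \<Rightarrow> real"
    where "pt = (\<lambda>p x j. if j < K then real (x j) / real p else 0)"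
  have pt_cube: "pt p x j \<in> {0..1}" if "\<forall>i<K. x i \<le> p" "0 < p" for p x j
    using that by (auto simp: pt_def)
  have "\<exists>q. (\<forall>i<K. q i < Suc m) \<and> (\<forall>i<K. \<exists>r s.
      (\<forall>j<K. q j \<le> r j \<and> r j \<le> q j + 1) \<and> (\<forall>j<K. q j \<le> s j \<and> s j \<le> q j + 1) \<and>
      F i (pt (Suc m) r) \<ge> 0 \<and> F i (pt (Suc m) s) \<le> 0)" for m
  proof -
    define p where "p = Suc m"
    have p: "0 < p" by (simp add: p_def)
    \<comment> \<open>The sign of \<open>F i\<close>, except on the two faces, where the Kuhn lemma
      prescribes the label; \<open>lo\<close> and \<open>hi\<close> make the prescribed labels agree
      with the sign.\<close>
    define label :: "(nat \<Rightarrow> nat) \<Rightarrow> nat \<Rightarrow> nat" where "label = (\<lambda>x i.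
      if x i = 0 then 0 else if x i = p then 1 else if F i (pt p x) \<ge> 0 then 0 else 1)"
    have l0: "F i (pt p x) \<ge> 0" if "i < K" "\<forall>i<K. x i \<le> p" "label x i = 0" for x i
    proof (cases "x i = 0")
      case True
      then show ?thesis using that p by (intro lo pt_cube) (auto simp: pt_def)
    qed (use that in \<open>auto simp: label_def split: if_splits\<close>)
    have l1: "F i (pt p x) \<le> 0" if "i < K" "\<forall>i<K. x i \<le> p" "label x i = 1" for x i
    proof (cases "x i = p")
      case True
      then show ?thesis using that p by (intro hi pt_cube) (auto simp: pt_def)
    qed (use that in \<open>auto simp: label_def split: if_splits\<close>)
    have l01: "label x i = 0 \<or> label x i = 1" for x i by (simp add: label_def)
    obtain q where q: "\<forall>i<K. q i < p" and rs: "\<forall>i<K. \<exists>r s. (\<forall>j<K. q j \<le> r j \<and> r j \<le> q j + 1) \<and>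
        (\<forall>j<K. q j \<le> s j \<and> s j \<le> q j + 1) \<and> label r i \<noteq> label s i"
      by (rule kuhn_lemma[of p K label]) (use p in \<open>auto simp: label_def\<close>)
    have "\<exists>r s. (\<forall>j<K. q j \<le> r j \<and> r j \<le> q j + 1) \<and> (\<forall>j<K. q j \<le> s j \<and> s j \<le> q j + 1) \<and>
      F i (pt p r) \<ge> 0 \<and> F i (pt p s) \<le> 0" if i: "i < K" for i
    proof -
      from rs i obtain r s where *: "\<forall>j<K. q j \<le> r j \<and> r j \<le> q j + 1"
        "\<forall>j<K. q j \<le> s j \<and> s j \<le> q j + 1" "label r i \<noteq> label s i" by blast
      have "x j \<le> p" if "\<forall>j<K. q j \<le> x j \<and> x j \<le> q j + 1" "j < K" for x j
        using that q by (metis Suc_eq_plus1 Suc_leI le_trans)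
      then have b: "\<forall>j<K. r j \<le> p" "\<forall>j<K. s j \<le> p" using * by blast+
      show ?thesis using l01[of r i] l01[of s i] * l0[OF i b(1)] l1[OF i b(1)] l0[OF i b(2)] l1[OF i b(2)]
        by metis
    qed
    with q show ?thesis unfolding p_def by blast
  qed
  then obtain q where q1: "\<And>m i. i < K \<Longrightarrow> q m i < Suc m"
    and q2: "\<And>m i. i < K \<Longrightarrow> \<exists>r s. (\<forall>j<K. q m j \<le> r j \<and> r j \<le> q m j + 1) \<and>
      (\<forall>j<K. q m j \<le> s j \<and> s j \<le> q m j + 1) \<and> F i (pt (Suc m) r) \<ge> 0 \<and> F i (pt (Suc m) s) \<le> 0"
    by metis
  have cube: "\<forall>m. pt (Suc m) (q m) \<in> {x. \<forall>j. x j \<in> {0..1}}"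
    using pt_cube q1 by (auto simp: less_imp_le)
  obtain z \<phi> where z: "z \<in> {x. \<forall>j. x j \<in> {0..1}}" and \<phi>: "strict_mono (\<phi> :: nat \<Rightarrow> nat)"
    and lim: "((\<lambda>m. pt (Suc m) (q m)) \<circ> \<phi>) \<longlonglongrightarrow> z"
    using compact_unit_cube cube
    by (rule seq_compactE[OF compact_imp_seq_compact])
  \<comment> \<open>Vertices of one small cube differ by at most one grid step, so they converge to
    the same z even if different vertices are used for different i and signs.\<close>
  have lim_near: "(\<lambda>m. pt (Suc (\<phi> m)) (R m)) \<longlonglongrightarrow> z"
    if R: "\<And>m j. j < K \<Longrightarrow> q (\<phi> m) j \<le> R m j \<and> R m j \<le> q (\<phi> m) j + 1" for R
  proof (rule tendsto_fun_coordinatewise)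
    fix j
    have c: "(\<lambda>m. pt (Suc (\<phi> m)) (q (\<phi> m)) j) \<longlonglongrightarrow> z j"
      using continuous_on_tendsto_compose[OF continuous_on_product_coordinates[of j] lim] by simp
    have d: "(\<lambda>m. inverse (real (Suc (\<phi> m)))) \<longlonglongrightarrow> 0"
      using LIMSEQ_subseq_LIMSEQ[OF LIMSEQ_inverse_real_of_nat \<phi>] by (simp add: o_def)
    have e: "pt (Suc (\<phi> m)) (q (\<phi> m)) j \<le> pt (Suc (\<phi> m)) (R m) j"
       "pt (Suc (\<phi> m)) (R m) j \<le> pt (Suc (\<phi> m)) (q (\<phi> m)) j + inverse (real (Suc (\<phi> m)))" for m
    proof -
      show "pt (Suc (\<phi> m)) (q (\<phi> m)) j \<le> pt (Suc (\<phi> m)) (R m) j"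
        using R[of j m] by (auto simp: pt_def divide_right_mono)
      have "real (R m j) / real (Suc (\<phi> m)) \<le> (real (q (\<phi> m) j) + 1) / real (Suc (\<phi> m))" if "j < K"
        using R[OF that, of m] by (intro divide_right_mono) auto
      then show "pt (Suc (\<phi> m)) (R m) j \<le> pt (Suc (\<phi> m)) (q (\<phi> m)) j + inverse (real (Suc (\<phi> m)))"
        by (auto simp: pt_def add_divide_distrib inverse_eq_divide)
    qed
    show "(\<lambda>m. pt (Suc (\<phi> m)) (R m) j) \<longlonglongrightarrow> z j"
      by (rule tendsto_sandwich[OF _ _ c]) (use e tendsto_add[OF c d] in auto)
  qed
  have "F i z = 0" if i: "i < K" for i
  proof -
    have "\<forall>m. \<exists>r s. (\<forall>j<K. q (\<phi> m) j \<le> r j \<and> r j \<le> q (\<phi> m) j + 1) \<and>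
      (\<forall>j<K. q (\<phi> m) j \<le> s j \<and> s j \<le> q (\<phi> m) j + 1) \<and>
      F i (pt (Suc (\<phi> m)) r) \<ge> 0 \<and> F i (pt (Suc (\<phi> m)) s) \<le> 0"
      using q2[OF i] by blast
    from choice[OF this] obtain R where "\<forall>m. \<exists>s. (\<forall>j<K. q (\<phi> m) j \<le> R m j \<and> R m j \<le> q (\<phi> m) j + 1) \<and>
      (\<forall>j<K. q (\<phi> m) j \<le> s j \<and> s j \<le> q (\<phi> m) j + 1) \<and>
      F i (pt (Suc (\<phi> m)) (R m)) \<ge> 0 \<and> F i (pt (Suc (\<phi> m)) s) \<le> 0"
      by blast
    from choice[OF this] obtain S where RS: "\<And>m j. j < K \<Longrightarrow> q (\<phi> m) j \<le> R m j \<and> R m j \<le> q (\<phi> m) j + 1"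
      "\<And>m j. j < K \<Longrightarrow> q (\<phi> m) j \<le> S m j \<and> S m j \<le> q (\<phi> m) j + 1"
      "\<And>m. F i (pt (Suc (\<phi> m)) (R m)) \<ge> 0" "\<And>m. F i (pt (Suc (\<phi> m)) (S m)) \<le> 0"
      by blast
    have "(\<lambda>m. F i (pt (Suc (\<phi> m)) (R m))) \<longlonglongrightarrow> F i z" "(\<lambda>m. F i (pt (Suc (\<phi> m)) (S m))) \<longlonglongrightarrow> F i z"
      using continuous_on_tendsto_compose[OF cont[OF i] lim_near] RS by auto
    then have "0 \<le> F i z" "F i z \<le> 0"
      using RS(3,4) by (auto intro: LIMSEQ_le_const LIMSEQ_le_const2)
    then show ?thesis by simp
  qed
  with z show thesis by (intro that[of z]) auto
qed

section \<open>Polynomial functions and their Taylor expansions\<close>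

text \<open>A class closed under partial derivatives. Induction yields differentiability, without
  which \<open>deriv\<close> in \<open>gradient\<close> and \<open>hessian\<close> carries no
  information.\<close>

inductive polyfun :: "nat \<Rightarrow> ((nat \<Rightarrow> real) \<Rightarrow> real) \<Rightarrow> bool" for N where
  polyfun_const: "polyfun N (\<lambda>_. c)"
| polyfun_coord: "j \<in> {1..N} \<Longrightarrow> polyfun N (\<lambda>x. x j)"
| polyfun_add: "polyfun N f \<Longrightarrow> polyfun N g \<Longrightarrow> polyfun N (\<lambda>x. f x + g x)"
| polyfun_mult: "polyfun N f \<Longrightarrow> polyfun N g \<Longrightarrow> polyfun N (\<lambda>x. f x * g x)"

lemma polyfun_sum:
  assumes "\<And>i. i \<in> A \<Longrightarrow> polyfun N (F i)"
  shows "polyfun N (\<lambda>x. \<Sum>i\<in>A. F i x)"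
  using assms by (induction A rule: infinite_finite_induct) (auto intro: polyfun.intros)

lemma polyfun_prod:
  assumes "\<And>i. i \<in> A \<Longrightarrow> polyfun N (F i)"
  shows "polyfun N (\<lambda>x. \<Prod>i\<in>A. F i x)"
  using assms by (induction A rule: infinite_finite_induct) (auto intro: polyfun.intros)

lemma polyfun_divide: "polyfun N f \<Longrightarrow> polyfun N (\<lambda>x. f x / c)"
  unfolding divide_inverse by (intro polyfun.intros)

lemma polyfun_continuous: "polyfun N f \<Longrightarrow> continuous_on UNIV f"
  by (induction rule: polyfun.induct) (auto intro!: continuous_intros)

lemma polyfun_bounded:
  assumes "polyfun N f"
  shows "\<exists>C. \<forall>x. (\<forall>i\<in>{1..N}. \<bar>x i\<bar> \<le> M) \<longrightarrow> \<bar>f x\<bar> \<le> C"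
  using assms
proof (induction rule: polyfun.induct)
  case (polyfun_coord j)
  then show ?case by blast
next
  case (polyfun_add f g)
  then obtain C D where "\<forall>x. (\<forall>i\<in>{1..N}. \<bar>x i\<bar> \<le> M) \<longrightarrow> \<bar>f x\<bar> \<le> C"
    "\<forall>x. (\<forall>i\<in>{1..N}. \<bar>x i\<bar> \<le> M) \<longrightarrow> \<bar>g x\<bar> \<le> D" by blast
  then show ?case by (intro exI[of _ "C + D"]) (smt (verit))
next
  case (polyfun_mult f g)
  then obtain C D where "\<forall>x. (\<forall>i\<in>{1..N}. \<bar>x i\<bar> \<le> M) \<longrightarrow> \<bar>f x\<bar> \<le> C"
    "\<forall>x. (\<forall>i\<in>{1..N}. \<bar>x i\<bar> \<le> M) \<longrightarrow> \<bar>g x\<bar> \<le> D" by blast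
  then show ?case
    by (intro exI[of _ "C * D"]) (metis abs_mult mult_mono' abs_ge_zero)
qed auto

text \<open>The product space \<open>nat \<Rightarrow> real\<close> is not normable, so there is no
  Frechet derivative with a chain rule. The derivative along rays through the origin is instead
  carried through the induction together with the partial derivatives, with one common family
  D.\<close>

lemma polyfun_derivatives:
  assumes "polyfun N f"
  shows "\<exists>D. (\<forall>i. polyfun N (D i)) \<and>
    (\<forall>i x. ((\<lambda>t. f (x(i := t))) has_real_derivative D i x) (at (x i))) \<and>
    (\<forall>u t. ((\<lambda>t. f (\<lambda>i. t * u i)) has_real_derivative (\<Sum>i=1..N. u i * D i (\<lambda>i. t * u i))) (at t))"
  using assms
proof (induction rule: polyfun.induct)
  case (polyfun_const c)
  then show ?case by (intro exI[of _ "\<lambda>_ _. 0"]) (auto intro: polyfun.intros)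
next
  case (polyfun_coord j)
  have "(\<Sum>i=1..N. u i * (if i = j then 1 else 0)) = (u j :: real)" for u
    using polyfun_coord by (simp add: if_distrib[of "\<lambda>z. _ * z"] sum.delta cong: if_cong)
  then show ?case
    by (intro exI[of _ "\<lambda>i _. if i = j then 1 else 0"])
      (auto intro!: polyfun.intros derivative_eq_intros)
next
  case (polyfun_add f g)
  then obtain D E where *: "\<forall>i. polyfun N (D i)" "\<forall>i. polyfun N (E i)"
    "\<forall>i x. ((\<lambda>t. f (x(i := t))) has_real_derivative D i x) (at (x i))"
    "\<forall>i x. ((\<lambda>t. g (x(i := t))) has_real_derivative E i x) (at (x i))"
    "\<forall>u t. ((\<lambda>t. f (\<lambda>i. t * u i)) has_real_derivative (\<Sum>i=1..N. u i * D i (\<lambda>i. t * u i))) (at t)"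
    "\<forall>u t. ((\<lambda>t. g (\<lambda>i. t * u i)) has_real_derivative (\<Sum>i=1..N. u i * E i (\<lambda>i. t * u i))) (at t)"
    by blast
  show ?case
  proof (intro exI[of _ "\<lambda>i x. D i x + E i x"] conjI allI)
    fix u t
    show "((\<lambda>t. f (\<lambda>i. t * u i) + g (\<lambda>i. t * u i)) has_real_derivative
       (\<Sum>i=1..N. u i * (D i (\<lambda>i. t * u i) + E i (\<lambda>i. t * u i)))) (at t)"
      using DERIV_add[OF *(5)[rule_format, of u t] *(6)[rule_format, of u t]]
      by (simp add: distrib_left sum.distrib)
  next
    fix i x
    show "((\<lambda>t. f (x(i := t)) + g (x(i := t))) has_real_derivative D i x + E i x) (at (x i))"
      using DERIV_add[OF *(3)[rule_format, of x i] *(4)[rule_format, of x i]] by simp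
  qed (use * in \<open>auto intro!: polyfun.intros\<close>)
next
  case (polyfun_mult f g)
  then obtain D E where *: "\<forall>i. polyfun N (D i)" "\<forall>i. polyfun N (E i)"
    "\<forall>i x. ((\<lambda>t. f (x(i := t))) has_real_derivative D i x) (at (x i))"
    "\<forall>i x. ((\<lambda>t. g (x(i := t))) has_real_derivative E i x) (at (x i))"
    "\<forall>u t. ((\<lambda>t. f (\<lambda>i. t * u i)) has_real_derivative (\<Sum>i=1..N. u i * D i (\<lambda>i. t * u i))) (at t)"
    "\<forall>u t. ((\<lambda>t. g (\<lambda>i. t * u i)) has_real_derivative (\<Sum>i=1..N. u i * E i (\<lambda>i. t * u i))) (at t)"
    by blast
  show ?case
  proof (intro exI[of _ "\<lambda>i x. D i x * g x + E i x * f x"] conjI allI)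
    fix u t
    show "((\<lambda>t. f (\<lambda>i. t * u i) * g (\<lambda>i. t * u i)) has_real_derivative
       (\<Sum>i=1..N. u i * (D i (\<lambda>i. t * u i) * g (\<lambda>i. t * u i) + E i (\<lambda>i. t * u i) * f (\<lambda>i. t * u i)))) (at t)"
      using DERIV_mult[OF *(5)[rule_format, of u t] *(6)[rule_format, of u t]]
      by (simp add: distrib_left sum.distrib sum_distrib_right mult.assoc)
  next
    fix i x
    show "((\<lambda>t. f (x(i := t)) * g (x(i := t))) has_real_derivative D i x * g x + E i x * f x) (at (x i))"
      using DERIV_mult[OF *(3)[rule_format, of x i] *(4)[rule_format, of x i]] by simp
  qed (use * polyfun_mult in \<open>auto intro!: polyfun.intros\<close>)
qed

lemma
  assumes "polyfun N f"
  shows polyfun_partial_deriv: "polyfun N (partial_deriv i f)"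
    and polyfun_has_partial_deriv:
      "((\<lambda>t. f (x(i := t))) has_real_derivative partial_deriv i f x) (at (x i))"
    and polyfun_line_derivative: "((\<lambda>t. f (\<lambda>i. t * u i)) has_real_derivative
      (\<Sum>i=1..N. u i * partial_deriv i f (\<lambda>i. t * u i))) (at t)"
proof -
  obtain D where D: "\<forall>i. polyfun N (D i)"
    "\<forall>i x. ((\<lambda>t. f (x(i := t))) has_real_derivative D i x) (at (x i))"
    "\<forall>u t. ((\<lambda>t. f (\<lambda>i. t * u i)) has_real_derivative (\<Sum>i=1..N. u i * D i (\<lambda>i. t * u i))) (at t)"
    using polyfun_derivatives[OF assms] by blast
  have eq: "partial_deriv i f = D i" for i
    using D(2) by (auto simp: partial_deriv_def intro!: ext DERIV_imp_deriv)
  show "polyfun N (partial_deriv i f)"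
    "((\<lambda>t. f (x(i := t))) has_real_derivative partial_deriv i f x) (at (x i))"
    "((\<lambda>t. f (\<lambda>i. t * u i)) has_real_derivative
      (\<Sum>i=1..N. u i * partial_deriv i f (\<lambda>i. t * u i))) (at t)"
    using D by (simp_all add: eq)
qed

lemma gradient_sum:
  assumes "\<And>l. l \<in> A \<Longrightarrow> polyfun N (F l)"
  shows "gradient (\<lambda>x. \<Sum>l\<in>A. c l * F l x) x i = (\<Sum>l\<in>A. c l * gradient (F l) x i)"
proof -
  have "((\<lambda>t. \<Sum>l\<in>A. c l * F l (x(i := t))) has_real_derivative (\<Sum>l\<in>A. c l * partial_deriv i (F l) x)) (at (x i))"
    using assms by (intro DERIV_sum DERIV_cmult polyfun_has_partial_deriv)
  then show ?thesis
    by (simp add: gradient_def partial_deriv_def[of i "\<lambda>x. \<Sum>l\<in>A. c l * F l x"] DERIV_imp_deriv)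
qed

lemma hessian_sum:
  assumes "\<And>l. l \<in> A \<Longrightarrow> polyfun N (F l)"
  shows "hessian (\<lambda>x. \<Sum>l\<in>A. c l * F l x) x i j = (\<Sum>l\<in>A. c l * hessian (F l) x i j)"
proof -
  have "partial_deriv j (\<lambda>x. \<Sum>l\<in>A. c l * F l x) = (\<lambda>x. \<Sum>l\<in>A. c l * partial_deriv j (F l) x)"
    using gradient_sum[of A N F c] assms by (auto simp: gradient_def)
  then show ?thesis
    using gradient_sum[of A N "\<lambda>l. partial_deriv j (F l)" c x i] assms
    by (simp add: hessian_def gradient_def polyfun_partial_deriv)
qed

section \<open>Taylor estimates along rays, uniform in the direction\<close>

lemma abs_mult_le_mult: "\<bar>a\<bar> \<le> A \<Longrightarrow> \<bar>b\<bar> \<le> B \<Longrightarrow> \<bar>a * b\<bar> \<le> A * B" for a b A B :: real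
  by (simp add: abs_mult mult_mono')

lemma polyfun_bounded_segment:
  assumes "polyfun N f"
  shows "\<exists>C. \<forall>u t. (\<forall>i\<in>{1..N}. \<bar>u i\<bar> \<le> M) \<longrightarrow> 0 \<le> t \<longrightarrow> t \<le> 1 \<longrightarrow> \<bar>f (\<lambda>i. t * u i)\<bar> \<le> C"
proof -
  obtain C where C: "\<forall>x. (\<forall>i\<in>{1..N}. \<bar>x i\<bar> \<le> M) \<longrightarrow> \<bar>f x\<bar> \<le> C"
    using polyfun_bounded[OF assms] by blast
  have "\<bar>t * u\<bar> \<le> M" if "\<bar>u\<bar> \<le> M" "0 \<le> t" "t \<le> 1" for u t :: real
    using abs_mult_le_mult[of t 1 u M] that by auto
  with C show ?thesis by (intro exI[of _ C]) auto
qed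

text \<open>One-variable Maclaurin formula for t \<mapsto> f (t u). Its second derivative is a
  combination of partial derivatives, each bounded on the box, so C does not depend on the direction
  u.\<close>

lemma polyfun_taylor1:
  assumes f: "polyfun N f"
  shows "\<exists>C\<ge>0. \<forall>u t. (\<forall>i\<in>{1..N}. \<bar>u i\<bar> \<le> M) \<longrightarrow> 0 < t \<longrightarrow> t \<le> 1 \<longrightarrow>
    \<bar>f (\<lambda>i. t * u i) - f (\<lambda>_. 0) - t * inner_prod N u (gradient f (\<lambda>_. 0))\<bar> \<le> C * t\<^sup>2"
proof -
  let ?D = "\<lambda>i j. partial_deriv j (partial_deriv i f)"
  let ?Q = "\<lambda>i j C. \<forall>u t. (\<forall>i\<in>{1..N}. \<bar>u i\<bar> \<le> M) \<longrightarrow> 0 \<le> t \<longrightarrow> t \<le> 1 \<longrightarrow> \<bar>?D i j (\<lambda>i. t * u i)\<bar> \<le> C"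
  define C where "C = (\<lambda>i j. SOME C. ?Q i j C)"
  have "?Q i j (C i j)" for i j
    unfolding C_def by (rule someI_ex) (intro polyfun_bounded_segment polyfun_partial_deriv f)
  then have C: "\<bar>?D i j (\<lambda>i. t * u i)\<bar> \<le> C i j" if "\<forall>i\<in>{1..N}. \<bar>u i\<bar> \<le> M" "0 \<le> t" "t \<le> 1" for i j u t
    using that by blast
  define K where "K = (\<Sum>i=1..N. M * (\<Sum>j=1..N. M * C i j))"
  have "\<bar>f (\<lambda>i. t * u i) - f (\<lambda>_. 0) - t * inner_prod N u (gradient f (\<lambda>_. 0))\<bar> \<le> \<bar>K\<bar> * t\<^sup>2"
    if u: "\<forall>i\<in>{1..N}. \<bar>u i\<bar> \<le> M" and t: "0 < t" "t \<le> 1" for u t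
  proof -
    define diff where "diff = (\<lambda>m::nat. if m = 0 then (\<lambda>t. f (\<lambda>i. t * u i))
      else if m = 1 then (\<lambda>t. \<Sum>i=1..N. u i * partial_deriv i f (\<lambda>i. t * u i))
      else (\<lambda>t. \<Sum>i=1..N. u i * (\<Sum>j=1..N. u j * ?D i j (\<lambda>i. t * u i))))"
    have d: "(diff m has_real_derivative diff (Suc m) r) (at r)" if "m < 2" for m r
    proof -
      have "m = 0 \<or> m = 1" using that by linarith
      then show ?thesis
        by (auto simp: diff_def intro!: DERIV_sum DERIV_cmult polyfun_partial_deriv f
            polyfun_line_derivative[unfolded One_nat_def])
    qed
    obtain r where r: "0 < r" "r < t"
      "f (\<lambda>i. t * u i) = (\<Sum>m<2. diff m 0 / fact m * t ^ m) + diff 2 r / fact 2 * t ^ 2"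
      using Maclaurin[of t 2 diff "\<lambda>t. f (\<lambda>i. t * u i)"] t d by (auto simp: diff_def)
    have "diff 0 0 = f (\<lambda>_. 0)" "diff 1 0 = inner_prod N u (gradient f (\<lambda>_. 0))"
      by (simp_all add: diff_def inner_prod_def gradient_def)
    then have eq: "f (\<lambda>i. t * u i) - f (\<lambda>_. 0) - t * inner_prod N u (gradient f (\<lambda>_. 0)) = diff 2 r / 2 * t\<^sup>2"
      by (simp add: r(3) numeral_2_eq_2)
    have "\<bar>diff 2 r\<bar> \<le> K"
      unfolding diff_def K_def
      using u r t by (auto intro!: order_trans[OF sum_abs] sum_mono abs_mult_le_mult C)
    then show ?thesis unfolding eq abs_mult by (intro mult_mono) auto
  qed
  then show ?thesis
    by (intro exI[of _ "\<bar>K\<bar>"]) auto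
qed

lemma polyfun_taylor2:
  assumes f: "polyfun N f"
  shows "\<exists>C\<ge>0. \<forall>u t. (\<forall>i\<in>{1..N}. \<bar>u i\<bar> \<le> M) \<longrightarrow> 0 < t \<longrightarrow> t \<le> 1 \<longrightarrow>
    \<bar>f (\<lambda>i. t * u i) - f (\<lambda>_. 0) - t * inner_prod N u (gradient f (\<lambda>_. 0))
      - t\<^sup>2 / 2 * quad_form N (hessian f (\<lambda>_. 0)) u\<bar> \<le> C * t ^ 3"
proof -
  let ?D = "\<lambda>i j. partial_deriv j (partial_deriv i f)"
  let ?T = "\<lambda>i j k. partial_deriv k (?D i j)"
  let ?Q = "\<lambda>i j k C. \<forall>u t. (\<forall>i\<in>{1..N}. \<bar>u i\<bar> \<le> M) \<longrightarrow> 0 \<le> t \<longrightarrow> t \<le> 1 \<longrightarrow> \<bar>?T i j k (\<lambda>i. t * u i)\<bar> \<le> C"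
  define C where "C = (\<lambda>i j k. SOME C. ?Q i j k C)"
  have "?Q i j k (C i j k)" for i j k
    unfolding C_def by (rule someI_ex) (intro polyfun_bounded_segment polyfun_partial_deriv f)
  then have C: "\<bar>?T i j k (\<lambda>i. t * u i)\<bar> \<le> C i j k" if "\<forall>i\<in>{1..N}. \<bar>u i\<bar> \<le> M" "0 \<le> t" "t \<le> 1" for i j k u t
    using that by blast
  define K where "K = (\<Sum>i=1..N. M * (\<Sum>j=1..N. M * (\<Sum>k=1..N. M * C i j k)))"
  have "\<bar>f (\<lambda>i. t * u i) - f (\<lambda>_. 0) - t * inner_prod N u (gradient f (\<lambda>_. 0))
      - t\<^sup>2 / 2 * quad_form N (hessian f (\<lambda>_. 0)) u\<bar> \<le> \<bar>K\<bar> * t ^ 3"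
    if u: "\<forall>i\<in>{1..N}. \<bar>u i\<bar> \<le> M" and t: "0 < t" "t \<le> 1" for u t
  proof -
    define diff where "diff = (\<lambda>m::nat. if m = 0 then (\<lambda>t. f (\<lambda>i. t * u i))
      else if m = 1 then (\<lambda>t. \<Sum>i=1..N. u i * partial_deriv i f (\<lambda>i. t * u i))
      else if m = 2 then (\<lambda>t. \<Sum>i=1..N. u i * (\<Sum>j=1..N. u j * ?D i j (\<lambda>i. t * u i)))
      else (\<lambda>t. \<Sum>i=1..N. u i * (\<Sum>j=1..N. u j * (\<Sum>k=1..N. u k * ?T i j k (\<lambda>i. t * u i)))))"
    have d: "(diff m has_real_derivative diff (Suc m) r) (at r)" if "m < 3" for m r
    proof -
      have "m = 0 \<or> m = 1 \<or> m = 2" using that by linarith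
      then show ?thesis
        by (auto simp: diff_def intro!: DERIV_sum DERIV_cmult polyfun_partial_deriv f
            polyfun_line_derivative[unfolded One_nat_def])
    qed
    obtain r where r: "0 < r" "r < t"
      "f (\<lambda>i. t * u i) = (\<Sum>m<3. diff m 0 / fact m * t ^ m) + diff 3 r / fact 3 * t ^ 3"
      using Maclaurin[of t 3 diff "\<lambda>t. f (\<lambda>i. t * u i)"] t d by (auto simp: diff_def)
    have "diff 0 0 = f (\<lambda>_. 0)" "diff 1 0 = inner_prod N u (gradient f (\<lambda>_. 0))"
      by (simp_all add: diff_def inner_prod_def gradient_def)
    \<comment> \<open>\<open>hessian\<close> differentiates in the opposite order to
      \<open>?D\<close>. Exchanging the two sums makes up for this, without symmetry of mixed
      derivatives.\<close>
    moreover have "diff 2 0 = quad_form N (hessian f (\<lambda>_. 0)) u"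
      unfolding quad_form_def
      by (subst sum.swap) (simp add: diff_def hessian_def sum_distrib_left mult_ac)
    ultimately have eq: "f (\<lambda>i. t * u i) - f (\<lambda>_. 0) - t * inner_prod N u (gradient f (\<lambda>_. 0))
       - t\<^sup>2 / 2 * quad_form N (hessian f (\<lambda>_. 0)) u = diff 3 r / 6 * t ^ 3"
      by (simp add: r(3) numeral_2_eq_2 numeral_3_eq_3)
    have "\<bar>diff 3 r\<bar> \<le> K"
      unfolding diff_def K_def
      using u r t by (auto intro!: order_trans[OF sum_abs] sum_mono abs_mult_le_mult C)
    then show ?thesis unfolding eq abs_mult using t by (intro mult_mono) auto
  qed
  then show ?thesis
    by (intro exI[of _ "\<bar>K\<bar>"]) auto
qed

section \<open>Common zeros near a degenerate point\<close>

declare One_nat_def [simp del]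

lemma inner_prod_linear:
  "inner_prod N (\<lambda>i. a * u i + b * v i) g = a * inner_prod N u g + b * inner_prod N v g"
  by (simp add: inner_prod_def distrib_right sum.distrib sum_distrib_left mult.assoc)

lemma inner_prod_add: "inner_prod N (\<lambda>i. u i + v i) g = inner_prod N u g + inner_prod N v g"
  by (simp add: inner_prod_def distrib_right sum.distrib)

lemma inner_prod_sum:
  "inner_prod N (\<lambda>i. \<Sum>l\<in>A. c l * v l i) g = (\<Sum>l\<in>A. c l * inner_prod N (v l) g)"
  unfolding inner_prod_def sum_distrib_left sum_distrib_right
  by (subst sum.swap) (simp add: mult.assoc)

text \<open>Projecting the unit vectors along the dual family already found gives vectors orthogonal
  to the first m members. Were all of them orthogonal to \<open>g (Suc m)\<close> too, that vector
  would be a combination of the others.\<close>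

lemma lin_indep_family_dual:
  assumes "lin_indep_family N m g"
  shows "\<exists>v. \<forall>l\<in>{1..m}. \<forall>j\<in>{1..m}. inner_prod N (v l) (g j) = (if l = j then 1 else 0)"
  using assms
proof (induction m)
  case (Suc m)
  have "lin_indep_family N m g"
    unfolding lin_indep_family_def
  proof (intro allI impI)
    fix c assume c: "\<forall>j\<in>{1..N}. (\<Sum>i=1..m. c i * g i j) = 0"
    have "\<forall>j\<in>{1..N}. (\<Sum>i=1..Suc m. (c(Suc m := 0)) i * g i j) = 0"
      using c by simp
    then have "\<forall>i\<in>{1..Suc m}. (c(Suc m := 0)) i = 0"
      using Suc.prems unfolding lin_indep_family_def by blast
    then show "\<forall>i\<in>{1..m}. c i = 0" by force
  qed
  then obtain v where v: "\<And>l j. l \<in> {1..m} \<Longrightarrow> j \<in> {1..m} \<Longrightarrow> inner_prod N (v l) (g j) = (if l = j then 1 else 0)"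
    using Suc.IH by blast
  define e :: "nat \<Rightarrow> nat \<Rightarrow> real" where "e = (\<lambda>i j. if j = i then 1 else 0)"
  \<comment> \<open>The coefficient \<open>g l i\<close> is the inner product of \<open>e i\<close>
    with \<open>g l\<close>. The factors 1 and - 1 give the two-term form of
    \<open>inner_prod_linear\<close>.\<close>
  define z where "z = (\<lambda>i j. 1 * e i j + (- 1) * (\<Sum>l=1..m. g l i * v l j))"
  have e: "inner_prod N (e i) y = y i" if "i \<in> {1..N}" for i y
    using that by (simp add: inner_prod_def e_def if_distrib[of "\<lambda>z. z * _"] cong: if_cong)
  have z: "inner_prod N (z i) y = y i - (\<Sum>l=1..m. g l i * inner_prod N (v l) y)" if "i \<in> {1..N}" for i y
    unfolding z_def inner_prod_linear inner_prod_sum using e[OF that] by simp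
  have z0: "inner_prod N (z i) (g j) = 0" if "i \<in> {1..N}" "j \<in> {1..m}" for i j
    using that by (simp add: z v if_distrib[of "\<lambda>z. _ * z"] cong: if_cong)
  have "\<exists>i\<in>{1..N}. inner_prod N (z i) (g (Suc m)) \<noteq> 0"
  proof (rule ccontr)
    assume *: "\<not> (\<exists>i\<in>{1..N}. inner_prod N (z i) (g (Suc m)) \<noteq> 0)"
    define c where "c = (\<lambda>l. if l = Suc m then 1 else - inner_prod N (v l) (g (Suc m)))"
    have "\<forall>i\<in>{1..N}. (\<Sum>l=1..Suc m. c l * g l i) = 0"
    proof
      fix i assume i: "i \<in> {1..N}"
      have "(\<Sum>l=1..Suc m. c l * g l i) = (\<Sum>l=1..m. c l * g l i) + g (Suc m) i"
        by (simp add: c_def)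
      also have "(\<Sum>l=1..m. c l * g l i) = - (\<Sum>l=1..m. g l i * inner_prod N (v l) (g (Suc m)))"
        unfolding sum_negf[symmetric] by (intro sum.cong) (auto simp: c_def)
      finally show "(\<Sum>l=1..Suc m. c l * g l i) = 0"
        using * i z[OF i, of "g (Suc m)"] by auto
    qed
    then have "c (Suc m) = 0"
      using Suc.prems unfolding lin_indep_family_def by auto
    then show False by (simp add: c_def)
  qed
  then obtain i where i: "i \<in> {1..N}" and nz: "inner_prod N (z i) (g (Suc m)) \<noteq> 0" by blast
  define w where "w = (\<lambda>j. (1 / inner_prod N (z i) (g (Suc m))) * z i j + 0 * z i j)"
  have w: "inner_prod N w (g j) = (if j = Suc m then 1 else 0)" if "j \<in> {1..Suc m}" for j
  proof (cases "j = Suc m")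
    case False
    then have "j \<in> {1..m}" using that by auto
    then show ?thesis using z0[OF i] False by (simp only: w_def inner_prod_linear) simp
  qed (use nz in \<open>simp only: w_def inner_prod_linear, simp\<close>)
  \<comment> \<open>The old dual vectors are corrected by a multiple of w to annihilate
    \<open>g (Suc m)\<close>; w is orthogonal to the earlier members, so the old relations
    persist.\<close>
  define v' where "v' = (\<lambda>l. if l = Suc m then w else (\<lambda>j. 1 * v l j + (- inner_prod N (v l) (g (Suc m))) * w j))"
  have "inner_prod N (v' l) (g j) = (if l = j then 1 else 0)" if "l \<in> {1..Suc m}" "j \<in> {1..Suc m}" for l j
  proof (cases "l = Suc m")
    case True
    then show ?thesis using w that by (auto simp: v'_def)
  next
    case False
    then have "l \<in> {1..m}" using that by auto
    have "inner_prod N (v' l) (g j) = inner_prod N (v l) (g j) - inner_prod N (v l) (g (Suc m)) * inner_prod N w (g j)"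
      using False by (simp only: v'_def inner_prod_linear if_False)
    then show ?thesis using w[OF that(2)] v[OF \<open>l \<in> {1..m}\<close>, of j] that False by (cases "j = Suc m") auto
  qed
  then show ?case by (intro exI[of _ v']) auto
qed auto

lemma quad_form_scale: "quad_form N A (\<lambda>i. c * w i) = c\<^sup>2 * quad_form N A w"
  by (simp add: quad_form_def sum_distrib_left power2_eq_square mult_ac)

text \<open>Allows \<epsilon> to be fixed before the zero is known: C serves all displacements z in
  the box, and \<epsilon> \<le> 1 turns the quadratic error term into a linear one.\<close>

lemma quad_form_perturb:
  assumes R: "R \<ge> 0"
  shows "\<exists>C\<ge>0. \<forall>z \<epsilon>. (\<forall>i\<in>{1..N}. \<bar>z i\<bar> \<le> R) \<longrightarrow> 0 \<le> \<epsilon> \<longrightarrow> \<epsilon> \<le> 1 \<longrightarrow>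
    \<bar>quad_form N A (\<lambda>i. w i + \<epsilon> * z i) - quad_form N A w\<bar> \<le> C * \<epsilon>"
proof -
  define C where "C = (\<Sum>a=1..N. \<Sum>b=1..N. \<bar>A a b\<bar> * (\<bar>w a\<bar> * R + R * \<bar>w b\<bar> + R * R))"
  have "\<bar>quad_form N A (\<lambda>i. w i + \<epsilon> * z i) - quad_form N A w\<bar> \<le> C * \<epsilon>"
    if z: "\<forall>i\<in>{1..N}. \<bar>z i\<bar> \<le> R" and e: "0 \<le> \<epsilon>" "\<epsilon> \<le> 1" for z \<epsilon>
  proof -
    have "\<bar>(w a + \<epsilon> * z a) * A a b * (w b + \<epsilon> * z b) - w a * A a b * w b\<bar>
        \<le> \<bar>A a b\<bar> * (\<bar>w a\<bar> * R + R * \<bar>w b\<bar> + R * R) * \<epsilon>" if "a \<in> {1..N}" "b \<in> {1..N}" for a b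
    proof -
      have "(w a + \<epsilon> * z a) * A a b * (w b + \<epsilon> * z b) - w a * A a b * w b
          = A a b * ((w a * z b + z a * w b + \<epsilon> * (z a * z b)) * \<epsilon>)"
        by (simp add: algebra_simps)
      also have "\<bar>\<dots>\<bar> = \<bar>A a b\<bar> * (\<bar>w a * z b + z a * w b + \<epsilon> * (z a * z b)\<bar> * \<epsilon>)"
        using e by (simp add: abs_mult)
      also have "\<bar>w a * z b + z a * w b + \<epsilon> * (z a * z b)\<bar> \<le> \<bar>w a * z b\<bar> + \<bar>z a * w b\<bar> + \<bar>\<epsilon> * (z a * z b)\<bar>"
        by linarith
      also have "\<dots> \<le> \<bar>w a\<bar> * R + R * \<bar>w b\<bar> + 1 * (R * R)"
        using z that e by (intro add_mono abs_mult_le_mult) auto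
      finally show ?thesis
        using e by (simp add: mult_left_mono mult_right_mono mult.assoc)
    qed
    then show ?thesis
      unfolding quad_form_def C_def sum_subtractf[symmetric] sum_distrib_right
      by (intro order_trans[OF sum_abs] sum_mono) auto
  qed
  moreover have "C \<ge> 0" using R by (auto simp: C_def intro!: sum_nonneg)
  ultimately show ?thesis by blast
qed

lemma small_scale_exists:
  fixes a b :: "nat \<Rightarrow> real"
  assumes "finite I" "\<And>i. i \<in> I \<Longrightarrow> 0 \<le> a i" "\<And>i. i \<in> I \<Longrightarrow> 0 < b i"
  shows "\<exists>t>0. t \<le> 1 \<and> (\<forall>i\<in>I. a i * t \<le> b i)"
  using assms
proof (induction I rule: finite_induct)
  case empty
  then show ?case by (intro exI[of _ 1]) auto
next
  case (insert i I)
  then obtain t where t: "t > 0" "t \<le> 1" "\<forall>i\<in>I. a i * t \<le> b i" by auto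
  define s where "s = min t (b i / (a i + 1))"
  have ab: "0 \<le> a i" "0 < b i" using insert.prems by auto
  have "a j * s \<le> b j" if "j \<in> I" for j
    using t(3) that insert.prems(1)[of j] mult_left_mono[of s t "a j"] by (force simp: s_def)
  moreover have "a i * s \<le> b i"
  proof -
    have "a i * s \<le> (a i + 1) * (b i / (a i + 1))"
      using ab t by (intro mult_mono) (auto simp: s_def)
    then show ?thesis using ab by simp
  qed
  moreover have "0 < s" "s \<le> 1" using t ab by (auto simp: s_def)
  ultimately show ?case by blast
qed

theorem polyfun_common_zero:
  fixes h :: "nat \<Rightarrow> (nat \<Rightarrow> real) \<Rightarrow> real" and \<alpha> wp wn :: "nat \<Rightarrow> real" and \<delta> :: real and k N :: nat
  defines "g \<equiv> \<lambda>i. gradient (h i) (\<lambda>_. 0)"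
    and "A \<equiv> \<lambda>a b. \<Sum>i=1..k. \<alpha> i * hessian (h i) (\<lambda>_. 0) a b"
  assumes poly: "\<And>i. i \<in> {1..k} \<Longrightarrow> polyfun N (h i)"
    and zero: "\<And>i. i \<in> {1..k} \<Longrightarrow> h i (\<lambda>_. 0) = 0"
    and indep: "lin_indep_family N (k - 1) g"
    and nonzero: "\<exists>i\<in>{1..k}. \<alpha> i \<noteq> 0"
    and dep: "\<forall>j\<in>{1..N}. (\<Sum>i=1..k. \<alpha> i * g i j) = 0"
    and orth_pos: "\<forall>i\<in>{1..k - 1}. inner_prod N wp (g i) = 0"
    and orth_neg: "\<forall>i\<in>{1..k - 1}. inner_prod N wn (g i) = 0"
    and pos: "quad_form N A wp > 0"
    and neg: "quad_form N A wn < 0"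
    and \<delta>: "\<delta> > 0"
  shows "\<exists>x. (\<forall>i\<in>{1..k}. h i x = 0) \<and> (\<exists>j\<in>{1..N}. x j \<noteq> 0) \<and> (\<forall>j\<in>{1..N}. \<bar>x j\<bar> \<le> \<delta>)"
proof -
  have k: "k \<ge> 1" using nonzero by auto
  then have atk: "{1..k} = insert k {1..k - 1}" by auto
  have sumk: "(\<Sum>i=1..k. F i) = F k + (\<Sum>i=1..k - 1. F i)" for F :: "nat \<Rightarrow> real"
    unfolding atk using k by (subst sum.insert) auto
  \<comment> \<open>Makes \<open>h k\<close> recoverable: once the other functions and the
    combination \<open>hs\<close> vanish, so does \<open>\<alpha> k * h k\<close>.\<close>
  have \<alpha>k: "\<alpha> k \<noteq> 0"
  proof
    assume *: "\<alpha> k = 0"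
    then have "\<forall>j\<in>{1..N}. (\<Sum>i=1..k - 1. \<alpha> i * g i j) = 0"
      using dep by (simp add: sumk)
    then have "\<forall>i\<in>{1..k - 1}. \<alpha> i = 0" using indep unfolding lin_indep_family_def by blast
    with * nonzero atk show False by auto
  qed
  obtain v where v: "\<And>l j. l \<in> {1..k - 1} \<Longrightarrow> j \<in> {1..k - 1} \<Longrightarrow> inner_prod N (v l) (g j) = (if l = j then 1 else 0)"
    using lin_indep_family_dual[OF indep] by blast
  define hs where "hs = (\<lambda>x. \<Sum>i=1..k. \<alpha> i * h i x)"
  have poly_hs: "polyfun N hs"
    unfolding hs_def using poly by (intro polyfun_sum polyfun_mult polyfun_const)
  have "gradient hs (\<lambda>_. 0) j = 0" if "j \<in> {1..N}" for j
    using dep that gradient_sum[of "{1..k}" N h \<alpha> "\<lambda>_. 0" j, OF poly]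
    by (simp add: hs_def g_def)
  then have grad_hs: "inner_prod N u (gradient hs (\<lambda>_. 0)) = 0" for u
    unfolding inner_prod_def by (intro sum.neutral) auto
  have hess_hs: "hessian hs (\<lambda>_. 0) = A"
    unfolding hs_def A_def using poly by (intro ext hessian_sum) auto
  have hs0: "hs (\<lambda>_. 0) = 0" using zero by (simp add: hs_def)

  define R where "R = (\<Sum>i=1..N. \<Sum>l=1..k - 1. \<bar>v l i\<bar>)"
  have R0: "R \<ge> 0" by (auto simp: R_def intro!: sum_nonneg)
  have Rbound: "\<bar>\<Sum>l=1..k - 1. (1 - 2 * z l) * v l i\<bar> \<le> R"
    if "i \<in> {1..N}" "\<And>j. z j \<in> {0..1}" for z i
  proof -
    have "\<bar>1 - 2 * z l\<bar> \<le> 1" for l using that(2)[of l] by auto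
    then have "\<bar>(1 - 2 * z l) * v l i\<bar> \<le> 1 * \<bar>v l i\<bar>" for l by (intro abs_mult_le_mult) auto
    then have "\<bar>\<Sum>l=1..k - 1. (1 - 2 * z l) * v l i\<bar> \<le> (\<Sum>l=1..k - 1. \<bar>v l i\<bar>)"
      by (intro order_trans[OF sum_abs] sum_mono) auto
    also have "\<dots> \<le> R" unfolding R_def using that(1) by (intro member_le_sum) (auto intro!: sum_nonneg)
    finally show ?thesis .
  qed
  obtain Cp where Cp: "Cp \<ge> 0" "\<And>z \<epsilon>. (\<forall>i\<in>{1..N}. \<bar>z i\<bar> \<le> R) \<Longrightarrow> 0 \<le> \<epsilon> \<Longrightarrow> \<epsilon> \<le> 1 \<Longrightarrow>
      \<bar>quad_form N A (\<lambda>i. wp i + \<epsilon> * z i) - quad_form N A wp\<bar> \<le> Cp * \<epsilon>"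
    using quad_form_perturb[OF R0] by meson
  obtain Cn where Cn: "Cn \<ge> 0" "\<And>z \<epsilon>. (\<forall>i\<in>{1..N}. \<bar>z i\<bar> \<le> R) \<Longrightarrow> 0 \<le> \<epsilon> \<Longrightarrow> \<epsilon> \<le> 1 \<Longrightarrow>
      \<bar>quad_form N A (\<lambda>i. wn i + \<epsilon> * z i) - quad_form N A wn\<bar> \<le> Cn * \<epsilon>"
    using quad_form_perturb[OF R0] by meson
  \<comment> \<open>At either end of the segment the displacement changes the form by at most half
    its value, so the sign survives. The index set {0, 1} packs both constraints into one
    application.\<close>
  obtain \<epsilon> where \<epsilon>: "0 < \<epsilon>" "\<epsilon> \<le> 1" "Cp * \<epsilon> \<le> quad_form N A wp / 2" "Cn * \<epsilon> \<le> - quad_form N A wn / 2"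
  proof -
    have "\<exists>t>0. t \<le> 1 \<and> (\<forall>i\<in>{0, 1::nat}. (if i = 0 then Cp else Cn) * t
       \<le> (if i = 0 then quad_form N A wp / 2 else - quad_form N A wn / 2))"
      using Cp(1) Cn(1) pos neg by (intro small_scale_exists) auto
    then obtain t where t: "t > 0" "t \<le> 1" "\<forall>i\<in>{0, 1::nat}. (if i = 0 then Cp else Cn) * t
       \<le> (if i = 0 then quad_form N A wp / 2 else - quad_form N A wn / 2)" by blast
    show ?thesis using that[of t] t(1,2) bspec[OF t(3), of 0] bspec[OF t(3), of 1] by auto
  qed

  \<comment> \<open>Coordinate 0 moves from \<open>wp\<close> to \<open>wn\<close>. The slope of 1 -
    2 z l is negative because \<open>poincare_miranda\<close> asks for values \<ge> 0 on the face z
    l = 0 and \<le> 0 on the face z l = 1.\<close>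
  define u where "u = (\<lambda>z i. ((1 - z 0) * wp i + z 0 * wn i) + \<epsilon> * (\<Sum>l=1..k - 1. (1 - 2 * z l) * v l i))"
  define M where "M = (\<Sum>i=1..N. \<bar>wp i\<bar> + \<bar>wn i\<bar>) + R"
  have M: "\<bar>u z i\<bar> \<le> M" if "i \<in> {1..N}" "\<And>j. z j \<in> {0..1}" for z i
  proof -
    have "\<bar>u z i\<bar> \<le> \<bar>(1 - z 0) * wp i\<bar> + \<bar>z 0 * wn i\<bar> + \<bar>\<epsilon> * (\<Sum>l=1..k - 1. (1 - 2 * z l) * v l i)\<bar>"
      unfolding u_def by linarith
    also have "\<dots> \<le> 1 * \<bar>wp i\<bar> + 1 * \<bar>wn i\<bar> + 1 * R"
      using Rbound[OF that] that(2)[of 0] \<epsilon> by (intro add_mono abs_mult_le_mult) auto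
    finally have "\<bar>u z i\<bar> \<le> \<bar>wp i\<bar> + \<bar>wn i\<bar> + R" by simp
    moreover have "\<bar>wp i\<bar> + \<bar>wn i\<bar> \<le> (\<Sum>i=1..N. \<bar>wp i\<bar> + \<bar>wn i\<bar>)"
      using that(1) by (intro member_le_sum) auto
    ultimately show ?thesis by (simp add: M_def)
  qed
  have M0: "M \<ge> 0" using R0 by (auto simp: M_def intro!: add_nonneg_nonneg sum_nonneg)
  have inner_u: "inner_prod N (u z) (g j) = \<epsilon> * (1 - 2 * z j)" if "j \<in> {1..k - 1}" for z j
  proof -
    have "inner_prod N (u z) (g j) = inner_prod N (\<lambda>i. (1 - z 0) * wp i + z 0 * wn i) (g j) +
       inner_prod N (\<lambda>i. \<Sum>l=1..k - 1. (\<epsilon> * (1 - 2 * z l)) * v l i) (g j)"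
      unfolding u_def by (simp add: inner_prod_add sum_distrib_left mult.assoc)
    also have "\<dots> = (\<Sum>l=1..k - 1. (\<epsilon> * (1 - 2 * z l)) * (if l = j then 1 else 0))"
      unfolding inner_prod_linear inner_prod_sum using orth_pos orth_neg v that by simp
    also have "\<dots> = \<epsilon> * (1 - 2 * z j)"
      using that by (simp add: if_distrib[of "\<lambda>z. _ * z"] cong: if_cong)
    finally show ?thesis .
  qed

  obtain C2 where C2: "C2 \<ge> 0" "\<And>u t. (\<forall>i\<in>{1..N}. \<bar>u i\<bar> \<le> M) \<Longrightarrow> 0 < t \<Longrightarrow> t \<le> 1 \<Longrightarrow>
      \<bar>hs (\<lambda>i. t * u i) - t\<^sup>2 / 2 * quad_form N A u\<bar> \<le> C2 * t ^ 3"
    using polyfun_taylor2[OF poly_hs, of M] by (auto simp: grad_hs hess_hs hs0)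
  have "\<exists>C\<ge>0. \<forall>u t. (\<forall>i\<in>{1..N}. \<bar>u i\<bar> \<le> M) \<longrightarrow> 0 < t \<longrightarrow> t \<le> 1 \<longrightarrow>
      \<bar>h l (\<lambda>i. t * u i) - t * inner_prod N u (g l)\<bar> \<le> C * t\<^sup>2" if "l \<in> {1..k}" for l
    using polyfun_taylor1[OF poly[OF that], of M] zero[OF that] by (simp add: g_def)
  then have "\<forall>l\<in>{1..k}. \<exists>C\<ge>0. \<forall>u t. (\<forall>i\<in>{1..N}. \<bar>u i\<bar> \<le> M) \<longrightarrow> 0 < t \<longrightarrow> t \<le> 1 \<longrightarrow>
      \<bar>h l (\<lambda>i. t * u i) - t * inner_prod N u (g l)\<bar> \<le> C * t\<^sup>2" by blast
  from bchoice[OF this] obtain C1 where C1: "\<And>l. l \<in> {1..k} \<Longrightarrow> C1 l \<ge> 0"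
    "\<And>l u t. l \<in> {1..k} \<Longrightarrow> (\<forall>i\<in>{1..N}. \<bar>u i\<bar> \<le> M) \<Longrightarrow> 0 < t \<Longrightarrow> t \<le> 1 \<Longrightarrow>
      \<bar>h l (\<lambda>i. t * u i) - t * inner_prod N u (g l)\<bar> \<le> C1 l * t\<^sup>2" by blast
  \<comment> \<open>A quarter: on an end face the form keeps at least half its value, and the Taylor
    term has a further factor 1/2; the cubic remainder must not exceed what is left.\<close>
  define b where "b = min (quad_form N A wp) (- quad_form N A wn) / 4"
  have b: "b > 0" "b \<le> quad_form N A wp / 4" "b \<le> - quad_form N A wn / 4" using pos neg by (auto simp: b_def)
  \<comment> \<open>Index 0 controls the cubic remainder of \<open>hs\<close>, index k + 1 the size
    of x, and the indices between them the quadratic remainders of \<open>h l\<close>, compared with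
    the linear term t \<epsilon> on the faces.\<close>
  obtain t where t: "0 < t" "t \<le> 1" "C2 * t \<le> b" "M * t \<le> \<delta>" "\<And>l. l \<in> {1..k} \<Longrightarrow> C1 l * t \<le> \<epsilon>"
  proof -
    have "\<exists>t>0. t \<le> 1 \<and> (\<forall>i\<in>{0..k + 1}. (if i = 0 then C2 else if i = k + 1 then M else C1 i) * t
       \<le> (if i = 0 then b else if i = k + 1 then \<delta> else \<epsilon>))"
      using C1(1) C2(1) M0 b(1) \<delta> \<epsilon>(1) by (intro small_scale_exists) auto
    then obtain t where t: "0 < t" "t \<le> 1" "\<forall>i\<in>{0..k + 1}. (if i = 0 then C2 else if i = k + 1 then M else C1 i) * t
       \<le> (if i = 0 then b else if i = k + 1 then \<delta> else \<epsilon>)" by blast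
    have "C1 l * t \<le> \<epsilon>" if "l \<in> {1..k}" for l using bspec[OF t(3), of l] that by auto
    then show ?thesis using that[of t] t(1,2) bspec[OF t(3), of 0] bspec[OF t(3), of "k + 1"] by auto
  qed
  define x where "x = (\<lambda>z i. t * u z i)"
  have h_near: "\<bar>h l (x z) - t * (\<epsilon> * (1 - 2 * z l))\<bar> \<le> t * \<epsilon>"
    if "l \<in> {1..k - 1}" "\<And>j. z j \<in> {0..1}" for l z
  proof -
    have l: "l \<in> {1..k}" using that by auto
    have "\<bar>h l (x z) - t * (\<epsilon> * (1 - 2 * z l))\<bar> \<le> C1 l * t\<^sup>2"
      using C1(2)[OF l, of "u z" t] M[OF _ that(2)] t inner_u[OF that(1)] by (simp add: x_def)
    also have "\<dots> = t * (C1 l * t)" by (simp add: power2_eq_square)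
    also have "\<dots> \<le> t * \<epsilon>" using t(5)[OF l] t(1) by (intro mult_left_mono) auto
    finally show ?thesis .
  qed
  have hs_near: "\<bar>hs (x z) - t\<^sup>2 / 2 * quad_form N A (u z)\<bar> \<le> t\<^sup>2 * b" if "\<And>j. z j \<in> {0..1}" for z
  proof -
    have "\<bar>hs (x z) - t\<^sup>2 / 2 * quad_form N A (u z)\<bar> \<le> C2 * t ^ 3"
      using C2(2)[of "u z" t] M[OF _ that] t by (simp add: x_def)
    also have "\<dots> = t\<^sup>2 * (C2 * t)" by (simp add: power2_eq_square power3_eq_cube)
    also have "\<dots> \<le> t\<^sup>2 * b" using t(3) by (intro mult_left_mono) auto
    finally show ?thesis .
  qed
  \<comment> \<open>Signs on the faces of coordinate 0 are decided at second order by
    \<open>hs\<close>, those on the faces of coordinate l at first order by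
    \<open>h l\<close>.\<close>
  define F where "F = (\<lambda>l z. if l = 0 then hs (x z) else h l (x z))"
  have cont_x: "continuous_on UNIV x"
    unfolding x_def u_def by (intro continuous_intros) auto
  obtain z where z: "\<And>j. z j \<in> {0..1}" and F: "\<And>i. i < k \<Longrightarrow> F i z = 0"
  proof (rule poincare_miranda[of k F])
    fix i assume i: "i < k"
    have "polyfun N (if i = 0 then hs else h i)" using poly_hs poly i by auto
    then have "continuous_on UNIV (\<lambda>z. (if i = 0 then hs else h i) (x z))"
      by (intro continuous_on_compose2[OF polyfun_continuous cont_x]) auto
    then show "continuous_on UNIV (F i)" unfolding F_def by (cases "i = 0") auto
  next
    fix i and z :: "nat \<Rightarrow> real" assume i: "i < k" and z: "\<And>j. z j \<in> {0..1}" and zi: "z i = 0"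
    show "F i z \<ge> 0"
    proof (cases "i = 0")
      case True
      have "quad_form N A (u z) \<ge> quad_form N A wp / 2"
        using Cp(2)[of "\<lambda>i. \<Sum>l=1..k - 1. (1 - 2 * z l) * v l i" \<epsilon>] Rbound[OF _ z] \<epsilon> zi True
        by (auto simp: u_def)
      then have "t\<^sup>2 * (quad_form N A (u z) / 2) \<ge> t\<^sup>2 * b" using b by (intro mult_left_mono) auto
      then show ?thesis using hs_near[of z, OF z] True by (auto simp: F_def)
    next
      case False
      then have "i \<in> {1..k - 1}" using i by auto
      then show ?thesis using h_near[of i z, OF _ z] zi False by (auto simp: F_def)
    qed
  next
    fix i and z :: "nat \<Rightarrow> real" assume i: "i < k" and z: "\<And>j. z j \<in> {0..1}" and zi: "z i = 1"
    show "F i z \<le> 0"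
    proof (cases "i = 0")
      case True
      have "quad_form N A (u z) \<le> quad_form N A wn / 2"
        using Cn(2)[of "\<lambda>i. \<Sum>l=1..k - 1. (1 - 2 * z l) * v l i" \<epsilon>] Rbound[OF _ z] \<epsilon> zi True
        by (auto simp: u_def)
      then have "t\<^sup>2 * (quad_form N A (u z) / 2) \<le> t\<^sup>2 * (- b)" using b by (intro mult_left_mono) auto
      then show ?thesis using hs_near[of z, OF z] True by (auto simp: F_def)
    next
      case False
      then have "i \<in> {1..k - 1}" using i by auto
      then show ?thesis using h_near[of i z, OF _ z] zi False by (auto simp: F_def)
    qed
  next
    fix z :: "nat \<Rightarrow> real"
    assume "\<And>j. z j \<in> {0..1}" "\<And>i. i < k \<Longrightarrow> F i z = 0"
    then show thesis by (rule that)
  qed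
  have h0: "h i (x z) = 0" if "i \<in> {1..k - 1}" for i using F[of i] that by (auto simp: F_def)
  have "hs (x z) = 0" using F[of 0] k by (auto simp: F_def)
  then have "h k (x z) = 0" using h0 \<alpha>k by (simp add: hs_def sumk)
  with h0 atk have "\<forall>i\<in>{1..k}. h i (x z) = 0" by auto
  moreover have "\<bar>x z j\<bar> \<le> \<delta>" if "j \<in> {1..N}" for j
    using abs_mult_le_mult[of t t "u z j" M] M[OF that z] t by (simp add: x_def mult.commute)
  \<comment> \<open>If u vanished, pairing with the gradients would give z l = 1/2 for l \<ge> 1,
    hence (1 - z 0) wp = - z 0 wn. The form is \<ge> 0 on the left and \<le> 0 on the right, hence
    0, so z 0 would be both 1 and 0.\<close>
  moreover have "\<exists>j\<in>{1..N}. x z j \<noteq> 0"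
  proof (rule ccontr)
    assume "\<not> (\<exists>j\<in>{1..N}. x z j \<noteq> 0)"
    then have u0: "u z j = 0" if "j \<in> {1..N}" for j using t that by (auto simp: x_def)
    have "1 - 2 * z l = 0" if "l \<in> {1..k - 1}" for l
      using inner_u[OF that, of z] u0 \<epsilon> by (simp add: inner_prod_def)
    then have "(\<Sum>l=1..k - 1. (1 - 2 * z l) * v l j) = 0" for j by (intro sum.neutral) auto
    then have "(1 - z 0) * wp j = (- z 0) * wn j" if "j \<in> {1..N}" for j
      using u0[OF that] by (simp add: u_def)
    then have "quad_form N A (\<lambda>j. (1 - z 0) * wp j) = quad_form N A (\<lambda>j. (- z 0) * wn j)"
      unfolding quad_form_def by (intro sum.cong) auto
    then have eq: "(1 - z 0)\<^sup>2 * quad_form N A wp = (z 0)\<^sup>2 * quad_form N A wn"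
      unfolding quad_form_scale by simp
    have "(1 - z 0)\<^sup>2 * quad_form N A wp \<ge> 0" "(z 0)\<^sup>2 * quad_form N A wn \<le> 0"
      using pos neg by (auto intro: mult_nonneg_nonpos)
    with eq have "(1 - z 0)\<^sup>2 * quad_form N A wp = 0" "(z 0)\<^sup>2 * quad_form N A wn = 0" by linarith+
    then show False using pos neg by simp
  qed
  ultimately show ?thesis by blast
qed

section \<open>Sorting and random permutations\<close>

text \<open>If \<open>f j\<close> were smaller than \<open>g j\<close>, then g would take this value
  at an earlier index, where f and g already agree, against strictness of f. Provides the uniqueness
  of sorting.\<close>

lemma strict_mono_on_same_image:
  fixes f g :: "nat \<Rightarrow> nat"
  assumes f: "strict_mono_on J f" and g: "strict_mono_on J g" and im: "f ` J = g ` J"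
    and j: "j \<in> J"
  shows "f j = g j"
  using j
proof (induction j rule: less_induct)
  case (less j)
  obtain i where i: "i \<in> J" "f j = g i" using im less.prems by (metis imageE image_eqI)
  obtain i' where i': "i' \<in> J" "g j = f i'" using im less.prems by (metis imageE image_eqI)
  have "\<not> f j < g j"
  proof
    assume "f j < g j"
    then have "i < j" using i less.prems g by (metis strict_mono_on_less)
    then have "f i = f j" using less.IH[of i] i by simp
    with \<open>i < j\<close> i less.prems f show False by (metis nat_neq_iff strict_mono_onD)
  qed
  moreover have "\<not> g j < f j"
  proof
    assume "g j < f j"
    then have "i' < j" using i' less.prems f by (metis strict_mono_on_less)
    then have "g i' = g j" using less.IH[of i'] i' by simp
    with \<open>i' < j\<close> i' less.prems g show False by (metis nat_neq_iff strict_mono_onD)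
  qed
  ultimately show ?case by simp
qed

lemma ex_strict_mono_bij:
  fixes J V :: "nat set"
  assumes "finite J" "finite V" "card J = card V"
  shows "\<exists>e. bij_betw e J V \<and> strict_mono_on J e"
proof -
  obtain h where h: "bij_betw h {..<card J} J" "strict_mono_on {..<card J} h"
    using ex_bij_betw_strict_mono_card[OF assms(1)] by blast
  obtain k where k: "bij_betw k {..<card J} V" "strict_mono_on {..<card J} k"
    using ex_bij_betw_strict_mono_card[OF assms(2)] assms(3) by metis
  let ?i = "inv_into {..<card J} h"
  have i: "bij_betw ?i J {..<card J}" using h(1) by (rule bij_betw_inv_into)
  have "strict_mono_on J (k \<circ> ?i)"
  proof (rule strict_mono_onI)
    fix x y assume xy: "x \<in> J" "y \<in> J" "x < y"
    have m: "?i x \<in> {..<card J}" "?i y \<in> {..<card J}" using i xy by (auto dest: bij_betwE)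
    have "h (?i x) < h (?i y)" using h(1) xy by (simp add: bij_betw_inv_into_right)
    then have "?i x < ?i y" using strict_mono_on_less[OF h(2) m] by simp
    then show "(k \<circ> ?i) x < (k \<circ> ?i) y" using k(2) m by (simp add: strict_mono_onD)
  qed
  then show ?thesis using bij_betw_trans[OF i k(1)] by blast
qed

text \<open>Uniqueness is the source of the factors 1/r! below: among the r! rearrangements of r
  distinct keys along the list \<open>lam\<close> exactly one is sorted.\<close>

lemma ex1_sorting_permutation:
  fixes \<tau> lam :: "nat \<Rightarrow> nat"
  assumes J: "finite J" and lam: "bij_betw lam J A" and \<tau>: "inj_on \<tau> A"
  shows "\<exists>!\<kappa>. \<kappa> permutes A \<and> strict_mono_on J (\<tau> \<circ> \<kappa> \<circ> lam)"
proof -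
  have A: "finite A" using J lam bij_betw_finite by blast
  have t: "bij_betw \<tau> A (\<tau> ` A)" using \<tau> by (simp add: bij_betw_imageI)
  have "card J = card (\<tau> ` A)" using bij_betw_same_card[OF lam] bij_betw_same_card[OF t] by simp
  then obtain e where e: "bij_betw e J (\<tau> ` A)" "strict_mono_on J e"
    using ex_strict_mono_bij[OF J] A by blast
  \<comment> \<open>e lists the keys increasingly along J, so \<open>lam j\<close> has to go to the
    position in A whose key is \<open>e j\<close>.\<close>
  define \<kappa> where "\<kappa> = (\<lambda>x. if x \<in> A then inv_into A \<tau> (e (inv_into J lam x)) else x)"
  have "bij_betw (inv_into A \<tau> \<circ> e \<circ> inv_into J lam) A A"
    using bij_betw_trans[OF bij_betw_trans[OF bij_betw_inv_into[OF lam] e(1)] bij_betw_inv_into[OF t]]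
    by (simp add: o_assoc)
  then have "bij_betw \<kappa> A A" by (rule bij_betw_cong[THEN iffD1, rotated]) (simp add: \<kappa>_def)
  then have \<kappa>: "\<kappa> permutes A" by (rule bij_imp_permutes) (simp add: \<kappa>_def)
  have "(\<tau> \<circ> \<kappa> \<circ> lam) j = e j" if "j \<in> J" for j
  proof -
    have "lam j \<in> A" "e j \<in> \<tau> ` A" using that lam e by (auto dest: bij_betwE)
    then show ?thesis using that lam by (simp add: \<kappa>_def bij_betw_inv_into_left f_inv_into_f)
  qed
  then have s: "strict_mono_on J (\<tau> \<circ> \<kappa> \<circ> lam)"
    using e(2) by (auto simp: strict_mono_on_def)
  have "\<kappa>1 = \<kappa>2" if 1: "\<kappa>1 permutes A" "strict_mono_on J (\<tau> \<circ> \<kappa>1 \<circ> lam)"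
     and 2: "\<kappa>2 permutes A" "strict_mono_on J (\<tau> \<circ> \<kappa>2 \<circ> lam)" for \<kappa>1 \<kappa>2
  proof
    fix x
    have im: "(\<tau> \<circ> \<kappa> \<circ> lam) ` J = \<tau> ` A" if "\<kappa> permutes A" for \<kappa>
      using that lam by (simp only: image_comp[symmetric] bij_betw_imp_surj_on[OF lam] permutes_image)
    show "\<kappa>1 x = \<kappa>2 x"
    proof (cases "x \<in> A")
      case True
      then obtain j where j: "j \<in> J" "x = lam j" using lam by (auto simp: bij_betw_def)
      have "(\<tau> \<circ> \<kappa>1 \<circ> lam) j = (\<tau> \<circ> \<kappa>2 \<circ> lam) j"
        using strict_mono_on_same_image[OF 1(2) 2(2) _ j(1)] im 1 2 by simp
      then show ?thesis
        using \<tau> True j 1(1) 2(1) by (auto simp: inj_on_eq_iff permutes_in_image)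
    qed (use 1(1) 2(1) in \<open>simp add: permutes_not_in\<close>)
  qed
  with \<kappa> s show ?thesis by blast
qed

lemma sum_of_bool_ex1:
  assumes "finite K" "\<exists>!x. x \<in> K \<and> R x"
  shows "(\<Sum>x\<in>K. of_bool (R x)) = (1::real)"
proof -
  obtain x where x: "x \<in> K" "R x" "\<And>y. y \<in> K \<Longrightarrow> R y \<Longrightarrow> y = x" using assms(2) by blast
  have "(\<Sum>x\<in>K. of_bool (R x)) = (\<Sum>y\<in>K. if y = x then 1 else 0 :: real)"
    by (intro sum.cong) (auto simp: x(2) dest: x(3))
  then show ?thesis using x(1) assms(1) by simp
qed

lemma sum_permutations_compose:
  assumes "\<kappa> permutes I"
  shows "(\<Sum>\<tau> | \<tau> permutes I. F (\<tau> \<circ> \<kappa>)) = (\<Sum>\<tau> | \<tau> permutes I. F \<tau> :: real)"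
  by (rule sum.reindex_bij_witness[of _ "\<lambda>\<tau>. \<tau> \<circ> inv \<kappa>" "\<lambda>\<tau>. \<tau> \<circ> \<kappa>"])
    (use assms in \<open>auto simp: permutes_inv_o o_assoc[symmetric] intro: permutes_compose permutes_inv\<close>)

text \<open>Right composition with permutations of A splits the permutations of I into orbits on
  which Y is constant and exactly one member is sorted along \<open>lam\<close>. So sortedness of
  the block has probability 1/(card J)! and is independent of Y.\<close>

lemma sum_sorted_block:
  fixes lam :: "nat \<Rightarrow> nat" and Y :: "(nat \<Rightarrow> nat) \<Rightarrow> real"
  assumes I: "finite I" and J: "finite J" and lam: "bij_betw lam J A" and AI: "A \<subseteq> I"
    and Y: "\<And>\<tau> \<kappa>. \<tau> permutes I \<Longrightarrow> \<kappa> permutes A \<Longrightarrow> Y (\<tau> \<circ> \<kappa>) = Y \<tau>"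
  shows "fact (card J) * (\<Sum>\<tau> | \<tau> permutes I. of_bool (strict_mono_on J (\<tau> \<circ> lam)) * Y \<tau>)
    = (\<Sum>\<tau> | \<tau> permutes I. Y \<tau>)"
proof -
  have A: "finite A" using I AI finite_subset by blast
  have fp: "finite {\<kappa>. \<kappa> permutes A}" using A by (rule finite_permutations)
  have ex1: "\<exists>!\<kappa>. \<kappa> \<in> {\<kappa>. \<kappa> permutes A} \<and> strict_mono_on J (\<tau> \<circ> \<kappa> \<circ> lam)" if "\<tau> permutes I" for \<tau>
    using ex1_sorting_permutation[OF J lam, of \<tau>] permutes_inj_on[OF that] by simp
  have "(\<Sum>\<tau> | \<tau> permutes I. Y \<tau>) = (\<Sum>\<tau> | \<tau> permutes I.
      (\<Sum>\<kappa> | \<kappa> permutes A. of_bool (strict_mono_on J (\<tau> \<circ> \<kappa> \<circ> lam))) * Y \<tau>)"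
    using sum_of_bool_ex1[OF fp ex1] by (intro sum.cong) auto
  also have "\<dots> = (\<Sum>\<kappa> | \<kappa> permutes A. \<Sum>\<tau> | \<tau> permutes I.
      of_bool (strict_mono_on J ((\<tau> \<circ> \<kappa>) \<circ> lam)) * Y (\<tau> \<circ> \<kappa>))"
    unfolding sum_distrib_right by (subst sum.swap) (simp add: Y)
  also have "\<dots> = (\<Sum>\<kappa> | \<kappa> permutes A. \<Sum>\<tau> | \<tau> permutes I.
      of_bool (strict_mono_on J (\<tau> \<circ> lam)) * Y \<tau>)"
    by (intro sum.cong refl
      sum_permutations_compose[of _ I "\<lambda>\<tau>. of_bool (strict_mono_on J (\<tau> \<circ> lam)) * Y \<tau>"])
      (use AI in \<open>auto intro: permutes_subset\<close>)
  also have "\<dots> = fact (card J) * (\<Sum>\<tau> | \<tau> permutes I. of_bool (strict_mono_on J (\<tau> \<circ> lam)) * Y \<tau>)"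
    using card_permutations[OF refl A] bij_betw_same_card[OF lam] by simp
  finally show ?thesis by simp
qed

text \<open>One block at a time: the indicator for the earlier blocks is absorbed into Y, because
  rearranging the new block leaves their positions fixed.\<close>

lemma sum_sorted_blocks:
  fixes lam f :: "nat \<Rightarrow> nat" and n :: nat and Y :: "(nat \<Rightarrow> nat) \<Rightarrow> real"
  assumes I: "finite I" and J: "finite J" and lam: "inj_on lam J" "lam ` J \<subseteq> I"
    and Y: "\<And>\<tau> \<kappa>. \<tau> permutes I \<Longrightarrow> \<kappa> permutes lam ` J \<Longrightarrow> Y (\<tau> \<circ> \<kappa>) = Y \<tau>"
  shows "(\<Prod>b=1..n. fact (card {j \<in> J. f j = b})) *
     (\<Sum>\<tau> | \<tau> permutes I. of_bool (\<forall>b\<in>{1..n}. strict_mono_on {j \<in> J. f j = b} (\<tau> \<circ> lam)) * Y \<tau>)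
    = (\<Sum>\<tau> | \<tau> permutes I. Y \<tau>)"
proof (induction n)
  case (Suc n)
  let ?B = "\<lambda>b. {j \<in> J. f j = b}"
  let ?R = "\<lambda>\<tau>. \<forall>b\<in>{1..n}. strict_mono_on (?B b) (\<tau> \<circ> lam)"
  have inv: "of_bool (?R (\<tau> \<circ> \<kappa>)) * Y (\<tau> \<circ> \<kappa>) = of_bool (?R \<tau>) * Y \<tau>"
    if "\<tau> permutes I" "\<kappa> permutes lam ` ?B (Suc n)" for \<tau> \<kappa>
  proof -
    have "\<kappa> permutes lam ` J" using that(2) by (rule permutes_subset) auto
    then have Y': "Y (\<tau> \<circ> \<kappa>) = Y \<tau>" using Y that by blast
    have fixed: "\<kappa> (lam j) = lam j" if "j \<in> J" "f j \<le> n" for j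
    proof (rule permutes_not_in[OF \<open>\<kappa> permutes lam ` ?B (Suc n)\<close>])
      show "lam j \<notin> lam ` ?B (Suc n)"
        using that by (subst inj_on_image_mem_iff[OF lam(1)]) auto
    qed
    have "strict_mono_on (?B b) (\<tau> \<circ> \<kappa> \<circ> lam) \<longleftrightarrow> strict_mono_on (?B b) (\<tau> \<circ> lam)" if "b \<in> {1..n}" for b
      using that by (simp add: strict_mono_on_def fixed)
    then have "?R (\<tau> \<circ> \<kappa>) = ?R \<tau>" by blast
    then show ?thesis by (simp only: Y')
  qed
  have bij: "bij_betw lam (?B (Suc n)) (lam ` ?B (Suc n))"
    using lam(1) by (auto simp: bij_betw_def intro: inj_on_subset)
  have R: "(\<forall>b\<in>{1..Suc n}. strict_mono_on (?B b) (\<tau> \<circ> lam)) \<longleftrightarrow>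
     strict_mono_on (?B (Suc n)) (\<tau> \<circ> lam) \<and> ?R \<tau>" for \<tau>
    by (auto simp: atLeastAtMostSuc_conv)
  have step: "fact (card (?B (Suc n))) * (\<Sum>\<tau> | \<tau> permutes I.
      of_bool (strict_mono_on (?B (Suc n)) (\<tau> \<circ> lam)) * (of_bool (?R \<tau>) * Y \<tau>))
    = (\<Sum>\<tau> | \<tau> permutes I. of_bool (?R \<tau>) * Y \<tau>)"
    by (rule sum_sorted_block[OF I _ bij]) (use J lam inv in auto)
  have P: "(\<Prod>b=1..Suc n. fact (card (?B b))) = (\<Prod>b=1..n. fact (card (?B b))) * (fact (card (?B (Suc n))) :: real)"
    by simp
  show ?case
    unfolding P R of_bool_conj mult.assoc step by (rule Suc.IH)
qed auto

text \<open>An injective encoding of the lexicographic order of the pairs \<open>(a i, \<tau> i)\<close>, provided that \<open>\<tau> i \<le> N\<close>.\<close>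

definition key :: "nat \<Rightarrow> (nat \<Rightarrow> nat) \<Rightarrow> (nat \<Rightarrow> nat) \<Rightarrow> nat \<Rightarrow> nat" where
  "key N a \<tau> i = a i * Suc N + \<tau> i"

lemma key_less_iff:
  assumes "\<tau> i \<le> N" "\<tau> j \<le> N"
  shows "key N a \<tau> i < key N a \<tau> j \<longleftrightarrow> a i < a j \<or> a i = a j \<and> \<tau> i < \<tau> j"
proof -
  have less: "key N a \<tau> i < key N a \<tau> j" if "a i < a j" "\<tau> i \<le> N" for i j
  proof -
    have "key N a \<tau> i < Suc (a i) * Suc N" using that by (simp add: key_def)
    also have "\<dots> \<le> a j * Suc N" using that by (intro mult_le_mono1) simp
    finally show ?thesis by (simp add: key_def)
  qed
  show ?thesis
    using less[of i j] less[of j i] assms by (cases "a i" "a j" rule: linorder_cases) (auto simp: key_def)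
qed

lemma permutes_le: "\<tau> permutes {1..N} \<Longrightarrow> i \<in> {1..N} \<Longrightarrow> \<tau> i \<le> N" for N :: nat
  by (metis atLeastAtMost_iff permutes_in_image)

lemma inj_on_key:
  assumes "\<tau> permutes {1..N}"
  shows "inj_on (key N a \<tau>) {1..N}"
proof (rule inj_onI)
  fix i j assume "i \<in> {1..N}" "j \<in> {1..N}" "key N a \<tau> i = key N a \<tau> j"
  then have "\<tau> i = \<tau> j"
    using key_less_iff[of \<tau> i N j a] key_less_iff[of \<tau> j N i a] permutes_le[OF assms]
    by (metis nat_neq_iff)
  then show "i = j" using assms by (metis permutes_inverses(2))
qed

text \<open>One half of the denominator in \<open>h_poly\<close>. For f with values in {1..n} its
  reciprocal is the probability that random tie-breaking puts every block of equal values in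
  order.\<close>

definition block_fact :: "nat \<Rightarrow> nat \<Rightarrow> (nat \<Rightarrow> nat) \<Rightarrow> real" where
  "block_fact s n f = (\<Prod>b=1..n. fact (card {j \<in> {1..s}. f j = b}))"

lemma block_fact_pos: "block_fact s n f > 0"
  by (simp add: block_fact_def prod_pos)

lemma block_fact_cong: "(\<And>j. j \<in> {1..s} \<Longrightarrow> f j = g j) \<Longrightarrow> block_fact s n f = block_fact s n g"
  unfolding block_fact_def by (intro prod.cong refl arg_cong[of _ _ "\<lambda>A. fact (card A)"]) auto

text \<open>Separates what the cells decide from what the ranks \<tau> decide, so that the average
  over \<tau> can be taken for fixed cells.\<close>

lemma strict_mono_on_key_iff:
  fixes lam a :: "nat \<Rightarrow> nat"
  assumes \<tau>: "\<tau> permutes {1..N}" and lam: "lam ` {1..s} \<subseteq> {1..N}"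
    and a: "\<And>j. j \<in> {1..s} \<Longrightarrow> a (lam j) \<in> {1..n}"
  shows "strict_mono_on {1..s} (key N a \<tau> \<circ> lam) \<longleftrightarrow>
    mono_on {1..s} (a \<circ> lam) \<and>
    (\<forall>b\<in>{1..n}. strict_mono_on {j \<in> {1..s}. (a \<circ> lam) j = b} (\<tau> \<circ> lam))"
proof -
  have key: "key N a \<tau> (lam i) < key N a \<tau> (lam j) \<longleftrightarrow>
      a (lam i) < a (lam j) \<or> a (lam i) = a (lam j) \<and> \<tau> (lam i) < \<tau> (lam j)"
    if "i \<in> {1..s}" "j \<in> {1..s}" for i j
    using that lam by (intro key_less_iff permutes_le[OF \<tau>]) blast+
  show ?thesis
  proof
    assume L: "strict_mono_on {1..s} (key N a \<tau> \<circ> lam)"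
    have *: "a (lam i) < a (lam j) \<or> a (lam i) = a (lam j) \<and> \<tau> (lam i) < \<tau> (lam j)"
      if "i \<in> {1..s}" "j \<in> {1..s}" "i < j" for i j
      using key[OF that(1,2)] strict_mono_onD[OF L that] by simp
    have "mono_on {1..s} (a \<circ> lam)"
    proof (rule mono_onI)
      fix i j assume ij: "i \<in> {1..s}" "j \<in> {1..s}" "i \<le> j"
      then show "(a \<circ> lam) i \<le> (a \<circ> lam) j"
        using *[OF ij(1,2)] by (cases "i = j") auto
    qed
    moreover have "strict_mono_on {j \<in> {1..s}. (a \<circ> lam) j = b} (\<tau> \<circ> lam)" for b
      using * by (intro strict_mono_onI) fastforce
    ultimately show "mono_on {1..s} (a \<circ> lam) \<and>
      (\<forall>b\<in>{1..n}. strict_mono_on {j \<in> {1..s}. (a \<circ> lam) j = b} (\<tau> \<circ> lam))" by blast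
  next
    assume R: "mono_on {1..s} (a \<circ> lam) \<and>
      (\<forall>b\<in>{1..n}. strict_mono_on {j \<in> {1..s}. (a \<circ> lam) j = b} (\<tau> \<circ> lam))"
    show "strict_mono_on {1..s} (key N a \<tau> \<circ> lam)"
    proof (rule strict_mono_onI)
      fix i j assume ij: "i \<in> {1..s}" "j \<in> {1..s}" "i < j"
      have le: "a (lam i) \<le> a (lam j)" using R ij mono_onD[of "{1..s}" "a \<circ> lam" i j] by auto
      have "\<tau> (lam i) < \<tau> (lam j)" if eq: "a (lam i) = a (lam j)"
      proof -
        have "strict_mono_on {l \<in> {1..s}. (a \<circ> lam) l = a (lam j)} (\<tau> \<circ> lam)" using R a[OF ij(2)] by blast
        from strict_mono_onD[OF this, of i j] show ?thesis using ij eq by simp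
      qed
      then show "(key N a \<tau> \<circ> lam) i < (key N a \<tau> \<circ> lam) j" using key[OF ij(1,2)] le by auto
    qed
  qed
qed

text \<open>Averaging over \<tau> leaves a weight that depends on the cells only. Invariance of Y
  under exchanging ranks among the listed points takes the place of independence.\<close>

lemma sum_key_sorted:
  fixes lam a :: "nat \<Rightarrow> nat" and Y :: "(nat \<Rightarrow> nat) \<Rightarrow> real"
  assumes inj: "inj_on lam {1..s}" and lam: "lam ` {1..s} \<subseteq> {1..N}"
    and a: "\<And>j. j \<in> {1..s} \<Longrightarrow> a (lam j) \<in> {1..n}"
    and Y: "\<And>\<tau> \<kappa>. \<tau> permutes {1..N} \<Longrightarrow> \<kappa> permutes lam ` {1..s} \<Longrightarrow> Y (\<tau> \<circ> \<kappa>) = Y \<tau>"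
  shows "(\<Sum>\<tau> | \<tau> permutes {1..N}. of_bool (strict_mono_on {1..s} (key N a \<tau> \<circ> lam)) * Y \<tau>) =
    of_bool (mono_on {1..s} (a \<circ> lam)) / block_fact s n (a \<circ> lam) * (\<Sum>\<tau> | \<tau> permutes {1..N}. Y \<tau>)"
proof -
  let ?R = "\<lambda>\<tau>. \<forall>b\<in>{1..n}. strict_mono_on {j \<in> {1..s}. (a \<circ> lam) j = b} (\<tau> \<circ> lam)"
  have b: "block_fact s n (a \<circ> lam) * (\<Sum>\<tau> | \<tau> permutes {1..N}. of_bool (?R \<tau>) * Y \<tau>) = (\<Sum>\<tau> | \<tau> permutes {1..N}. Y \<tau>)"
    unfolding block_fact_def by (rule sum_sorted_blocks) (use inj lam Y in auto)
  have "(\<Sum>\<tau> | \<tau> permutes {1..N}. of_bool (strict_mono_on {1..s} (key N a \<tau> \<circ> lam)) * Y \<tau>)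
     = (\<Sum>\<tau> | \<tau> permutes {1..N}. of_bool (mono_on {1..s} (a \<circ> lam)) * (of_bool (?R \<tau>) * Y \<tau>))"
    using strict_mono_on_key_iff[where a = a and lam = lam, OF _ lam a] by (intro sum.cong refl) (simp add: of_bool_conj)
  also have "\<dots> = of_bool (mono_on {1..s} (a \<circ> lam)) * (\<Sum>\<tau> | \<tau> permutes {1..N}. of_bool (?R \<tau>) * Y \<tau>)"
    by (rule sum_distrib_left[symmetric])
  also have "(\<Sum>\<tau> | \<tau> permutes {1..N}. of_bool (?R \<tau>) * Y \<tau>) = (\<Sum>\<tau> | \<tau> permutes {1..N}. Y \<tau>) / block_fact s n (a \<circ> lam)"
    using b block_fact_pos[of s n "a \<circ> lam"] by (simp add: field_simps)
  finally show ?thesis by (simp only: times_divide_eq_left times_divide_eq_right)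
qed

lemma finite_nondec_funs: "finite (nondec_funs s n)"
  unfolding nondec_funs_def by (rule finite_subset[OF _ finite_PiE[of "{1..s}" "\<lambda>_. {1..n}"]]) auto

lemma sum_nondec_funs:
  "(\<Sum>f\<in>nondec_funs s n. F f) = (\<Sum>f\<in>{1..s} \<rightarrow>\<^sub>E {1..n}. of_bool (mono_on {1..s} f) * F f :: real)"
proof -
  have "(\<Sum>f\<in>{1..s} \<rightarrow>\<^sub>E {1..n}. of_bool (mono_on {1..s} f) * F f) =
     (\<Sum>f\<in>{1..s} \<rightarrow>\<^sub>E {1..n}. if mono_on {1..s} f then F f else 0)"
    by (intro sum.cong) auto
  then show ?thesis
    unfolding nondec_funs_def by (subst sum.inter_filter) (auto intro: finite_PiE)
qed

lemma sum_sorting_permutations: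
  assumes "\<tau> permutes {1..N}"
  shows "(\<Sum>\<kappa> | \<kappa> permutes {1..N}. of_bool (strict_mono_on {1..N} (key N a \<tau> \<circ> \<kappa>))) = (1 :: real)"
proof (rule sum_of_bool_ex1)
  show "\<exists>!\<kappa>. \<kappa> \<in> {\<kappa>. \<kappa> permutes {1..N}} \<and> strict_mono_on {1..N} (key N a \<tau> \<circ> \<kappa>)"
    using ex1_sorting_permutation[of "{1..N}" id "{1..N}" "key N a \<tau>"] inj_on_key[OF assms]
    by simp
qed (auto intro: finite_permutations)

lemma sum_PiE_permute:
  assumes "\<kappa> permutes {1..s}"
  shows "(\<Sum>a\<in>{1..s} \<rightarrow>\<^sub>E C. F (a \<circ> \<kappa>)) = (\<Sum>a\<in>{1..s} \<rightarrow>\<^sub>E C. F a :: real)"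
proof -
  have *: "a \<circ> \<mu> \<in> {1..s} \<rightarrow>\<^sub>E C" if "a \<in> {1..s} \<rightarrow>\<^sub>E C" "\<mu> permutes {1..s}" for a \<mu>
  proof (rule PiE_I)
    show "(a \<circ> \<mu>) i \<in> C" if "i \<in> {1..s}" for i
      using that \<open>a \<in> _\<close> permutes_in_image[OF \<open>\<mu> permutes _\<close>] by (metis PiE_mem comp_apply)
    show "(a \<circ> \<mu>) i = undefined" if "i \<notin> {1..s}" for i
      using that \<open>a \<in> _\<close> permutes_not_in[OF \<open>\<mu> permutes _\<close>] by (metis PiE_arb comp_apply)
  qed
  show ?thesis
    by (rule sum.reindex_bij_witness[of _ "\<lambda>a. a \<circ> inv \<kappa>" "\<lambda>a. a \<circ> \<kappa>"])
      (simp_all only: * assms permutes_inv permutes_inv_o[OF assms] o_assoc[symmetric] o_id)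
qed

text \<open>The multinomial theorem: \<open>fact s / block_fact s n f\<close> words have the
  non-decreasing rearrangement f. The proof counts triples of a word, a tie-breaking permutation and
  the permutation that sorts by both.\<close>

lemma sum_inverse_block_fact:
  "(\<Sum>f\<in>nondec_funs s n. 1 / block_fact s n f) = real n ^ s / fact s"
proof -
  let ?S = "\<Sum>f\<in>nondec_funs s n. 1 / block_fact s n f"
  have "real n ^ s * fact s = (\<Sum>a\<in>{1..s} \<rightarrow>\<^sub>E {1..n}. \<Sum>\<tau> | \<tau> permutes {1..s}.
      \<Sum>\<kappa> | \<kappa> permutes {1..s}. of_bool (strict_mono_on {1..s} (key s a \<tau> \<circ> \<kappa>)))"
    by (simp add: sum_sorting_permutations card_permutations card_PiE)
  also have "\<dots> = (\<Sum>\<kappa> | \<kappa> permutes {1..s}. \<Sum>a\<in>{1..s} \<rightarrow>\<^sub>E {1..n}. \<Sum>\<tau> | \<tau> permutes {1..s}.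
      of_bool (strict_mono_on {1..s} (key s a \<tau> \<circ> \<kappa>)) * 1)"
    by (subst (2) sum.swap) (subst sum.swap, simp)
  also have "\<dots> = (\<Sum>\<kappa> | \<kappa> permutes {1..s}. \<Sum>a\<in>{1..s} \<rightarrow>\<^sub>E {1..n}.
      of_bool (mono_on {1..s} (a \<circ> \<kappa>)) * (1 / block_fact s n (a \<circ> \<kappa>)) * fact s)"
  proof (intro sum.cong refl)
    fix \<kappa> a assume \<kappa>: "\<kappa> \<in> {\<kappa>. \<kappa> permutes {1..s}}" and a: "a \<in> {1..s} \<rightarrow>\<^sub>E {1..n}"
    have "(\<Sum>\<tau> | \<tau> permutes {1..s}. of_bool (strict_mono_on {1..s} (key s a \<tau> \<circ> \<kappa>)) * 1) =
      of_bool (mono_on {1..s} (a \<circ> \<kappa>)) / block_fact s n (a \<circ> \<kappa>) * (\<Sum>\<tau> | \<tau> permutes {1..s}. 1)"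
      using \<kappa> a permutes_in_image[of \<kappa> "{1..s}"]
      by (intro sum_key_sorted) (auto intro: permutes_inj_on)
    then show "(\<Sum>\<tau> | \<tau> permutes {1..s}. of_bool (strict_mono_on {1..s} (key s a \<tau> \<circ> \<kappa>)) * 1) =
      of_bool (mono_on {1..s} (a \<circ> \<kappa>)) * (1 / block_fact s n (a \<circ> \<kappa>)) * fact s"
      by (simp add: card_permutations)
  qed
  also have "\<dots> = (\<Sum>\<kappa> | \<kappa> permutes {1..s}. \<Sum>a\<in>{1..s} \<rightarrow>\<^sub>E {1..n}.
      of_bool (mono_on {1..s} a) * (1 / block_fact s n a) * fact s)"
    by (intro sum.cong refl sum_PiE_permute[of _ s
      "\<lambda>a. of_bool (mono_on {1..s} a) * (1 / block_fact s n a) * fact s"]) auto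
  also have "\<dots> = fact s * (?S * fact s)"
    by (simp add: card_permutations sum_nondec_funs sum_distrib_right)
  finally show ?thesis by (simp add: field_simps)
qed

section \<open>Sampling from a step permuton\<close>

text \<open>Independence of disjoint sets of coordinates: K sees only the points listed by
  \<open>lam\<close>, Z only the others.\<close>

lemma sum_PiE_marginal:
  fixes w :: "'c \<Rightarrow> real" and lam :: "nat \<Rightarrow> nat"
  assumes I: "finite I" and C: "finite C" and J: "finite J"
    and inj: "inj_on lam J" and lam: "lam ` J \<subseteq> I"
    and w1: "(\<Sum>z\<in>C. w z) = 1"
    and K: "\<And>d d'. (\<And>j. j \<in> J \<Longrightarrow> d j = d' j) \<Longrightarrow> K d = K d'"
    and Z: "\<And>c c'. (\<And>i. i \<notin> lam ` J \<Longrightarrow> c i = c' i) \<Longrightarrow> Z c = Z c'"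
  shows "(\<Sum>c\<in>I \<rightarrow>\<^sub>E C. (\<Prod>i\<in>I. w (c i)) * (K (c \<circ> lam) * Z c)) =
    (\<Sum>d\<in>J \<rightarrow>\<^sub>E C. (\<Prod>j\<in>J. w (d j)) * K d) * (\<Sum>c\<in>I \<rightarrow>\<^sub>E C. (\<Prod>i\<in>I. w (c i)) * Z c)"
proof -
  let ?A = "lam ` J" and ?v = "inv_into J lam"
  let ?Y = "\<Sum>y\<in>(I - ?A) \<rightarrow>\<^sub>E C. (\<Prod>i\<in>I - ?A. w (y i)) * Z y"
  have aux: "(\<Sum>c\<in>I \<rightarrow>\<^sub>E C. (\<Prod>i\<in>I. w (c i)) * (K (c \<circ> lam) * Z c)) =
     (\<Sum>d\<in>J \<rightarrow>\<^sub>E C. (\<Prod>j\<in>J. w (d j)) * K d) * ?Y"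
    if K: "\<And>d d'. (\<And>j. j \<in> J \<Longrightarrow> d j = d' j) \<Longrightarrow> K d = K d'" for K
  proof -
    let ?F = "\<lambda>p. (\<Prod>j\<in>J. w (fst p j)) * K (fst p) * ((\<Prod>i\<in>I - ?A. w (snd p i)) * Z (snd p))"
    let ?f = "\<lambda>c. (restrict (c \<circ> lam) J, restrict c (I - ?A))"
    let ?g = "\<lambda>p i. if i \<in> ?A then fst p (?v i) else snd p i"
    have "(\<Sum>c\<in>I \<rightarrow>\<^sub>E C. (\<Prod>i\<in>I. w (c i)) * (K (c \<circ> lam) * Z c)) =
      (\<Sum>p\<in>(J \<rightarrow>\<^sub>E C) \<times> ((I - ?A) \<rightarrow>\<^sub>E C). ?F p)"
    proof (rule sum.reindex_bij_witness[of _ ?g ?f])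
      fix c assume c: "c \<in> I \<rightarrow>\<^sub>E C"
      show "?g (?f c) = c"
      proof
        fix i
        show "?g (?f c) i = c i"
        proof (cases "i \<in> ?A")
          case True
          then show ?thesis by (simp add: f_inv_into_f inv_into_into)
        next
          case False
          then show ?thesis using PiE_arb[OF c, of i] by (simp add: restrict_def)
        qed
      qed
      show "?f c \<in> (J \<rightarrow>\<^sub>E C) \<times> ((I - ?A) \<rightarrow>\<^sub>E C)"
        using PiE_mem[OF c] lam by (auto simp: image_subset_iff)
      have "Z c = Z (restrict c (I - ?A))"
        using PiE_arb[OF c] by (intro Z) (simp add: restrict_def)
      moreover have "K (c \<circ> lam) = K (restrict (c \<circ> lam) J)" by (intro K) auto
      moreover have "(\<Prod>i\<in>I. w (c i)) = (\<Prod>j\<in>J. w (c (lam j))) * (\<Prod>i\<in>I - ?A. w (c i))"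
        using prod.subset_diff[OF lam I, of "\<lambda>i. w (c i)"] inj
        by (simp add: prod.reindex mult.commute)
      ultimately show "?F (?f c) = (\<Prod>i\<in>I. w (c i)) * (K (c \<circ> lam) * Z c)"
        by simp
    next
      fix p assume p: "p \<in> (J \<rightarrow>\<^sub>E C) \<times> ((I - ?A) \<rightarrow>\<^sub>E C)"
      then have p1: "fst p \<in> J \<rightarrow>\<^sub>E C" and p2: "snd p \<in> (I - ?A) \<rightarrow>\<^sub>E C" by auto
      have "restrict (?g p \<circ> lam) J = fst p"
        using PiE_arb[OF p1] inj by (simp add: fun_eq_iff restrict_def)
      moreover have "restrict (?g p) (I - ?A) = snd p"
        using PiE_arb[OF p2] by (simp add: fun_eq_iff restrict_def)
      ultimately show "?f (?g p) = p" by simp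
      show "?g p \<in> I \<rightarrow>\<^sub>E C"
      proof (rule PiE_I)
        show "?g p i \<in> C" if "i \<in> I" for i
          using that PiE_mem[OF p1 inv_into_into[of i lam J]] PiE_mem[OF p2, of i] by simp
        show "?g p i = undefined" if "i \<notin> I" for i
          using that lam PiE_arb[OF p2, of i] by auto
      qed
    qed
    also have "\<dots> = (\<Sum>d\<in>J \<rightarrow>\<^sub>E C. (\<Prod>j\<in>J. w (d j)) * K d) * ?Y"
      unfolding sum_product sum.cartesian_product by (intro sum.cong) auto
    finally show ?thesis .
  qed
  \<comment> \<open>Total mass 1 on the listed coordinates lets \<open>?Y\<close>, a sum over the
    remaining points, be rewritten as a sum over all points.\<close>
  have "(\<Sum>d\<in>J \<rightarrow>\<^sub>E C. (\<Prod>j\<in>J. w (d j))) = 1"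
    using prod_sum_PiE[OF J, of "\<lambda>_. C" "\<lambda>_. w"] C w1 by simp
  then have "(\<Sum>c\<in>I \<rightarrow>\<^sub>E C. (\<Prod>i\<in>I. w (c i)) * Z c) = ?Y"
    using aux[of "\<lambda>_. 1"] by simp
  then show ?thesis using aux[of K, OF K] by simp
qed

definition cells :: "nat \<Rightarrow> (nat \<times> nat) set" where
  "cells n = {1..n} \<times> {1..n}"

text \<open>
  Expectation over \<open>N\<close> independent points of the step permuton with cell masses \<open>P\<close>: the \<open>i\<close>-th point lies in
  the cell \<open>c i\<close>, and the order inside a column (a row) of cells is given by a uniformly random
  permutation \<open>\<tau>\<close> (\<open>\<rho>\<close>), which has the same law as the order of independent uniform coordinates.
\<close>

definition sample_mean :: "nat \<Rightarrow> nat \<Rightarrow> (nat \<Rightarrow> nat \<Rightarrow> real) \<Rightarrow>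
    ((nat \<Rightarrow> nat \<times> nat) \<Rightarrow> (nat \<Rightarrow> nat) \<Rightarrow> (nat \<Rightarrow> nat) \<Rightarrow> real) \<Rightarrow> real" where
  "sample_mean N n P \<phi> =
     (\<Sum>c\<in>{1..N} \<rightarrow>\<^sub>E cells n. (\<Prod>i=1..N. case_prod P (c i)) *
       (\<Sum>\<tau> | \<tau> permutes {1..N}. \<Sum>\<rho> | \<rho> permutes {1..N}. \<phi> c \<tau> \<rho>)) / (fact N)\<^sup>2"

text \<open>The points \<open>lam 1, \<dots>, lam s\<close> are listed from left to right and form the pattern \<open>\<sigma>\<close>.\<close>

definition sorted_pattern :: "nat \<Rightarrow> nat \<Rightarrow> (nat \<Rightarrow> nat) \<Rightarrow> (nat \<Rightarrow> nat) \<Rightarrow>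
    (nat \<Rightarrow> nat \<times> nat) \<Rightarrow> (nat \<Rightarrow> nat) \<Rightarrow> (nat \<Rightarrow> nat) \<Rightarrow> bool" where
  "sorted_pattern N s \<sigma> lam c \<tau> \<rho> \<longleftrightarrow>
     strict_mono_on {1..s} (key N (fst \<circ> c) \<tau> \<circ> lam) \<and>
     strict_mono_on {1..s} (key N (snd \<circ> c) \<rho> \<circ> (lam \<circ> inv \<sigma>))"

text \<open>For cell masses P, the probability that s sample points, in a prescribed order, stand
  from left to right and form \<sigma>. There are s! orders, so \<open>fact s\<close> times this is
  the density of \<sigma> in the step permuton.\<close>

definition pattern_weight :: "nat \<Rightarrow> (nat \<Rightarrow> nat \<Rightarrow> real) \<Rightarrow> nat \<Rightarrow> (nat \<Rightarrow> nat) \<Rightarrow> real" where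
  "pattern_weight n P s \<sigma> = (\<Sum>f\<in>nondec_funs s n. \<Sum>g\<in>nondec_funs s n.
     (\<Prod>i=1..s. P (f i) (g (\<sigma> i))) / (block_fact s n f * block_fact s n g))"

lemma finite_cells: "finite (cells n)"
  by (simp add: cells_def)

text \<open>Change of variables \<open>d j = (f j, g (\<sigma> j))\<close>: f lists the columns from
  left to right and g the rows from bottom to top.\<close>

lemma sum_cells_pattern_weight:
  assumes \<sigma>: "\<sigma> permutes {1..s}"
  shows "(\<Sum>d\<in>{1..s} \<rightarrow>\<^sub>E cells n. (\<Prod>j=1..s. case_prod P (d j)) *
      (of_bool (mono_on {1..s} (fst \<circ> d)) / block_fact s n (fst \<circ> d) *
       (of_bool (mono_on {1..s} (snd \<circ> d \<circ> inv \<sigma>)) / block_fact s n (snd \<circ> d \<circ> inv \<sigma>)))) =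
    pattern_weight n P s \<sigma>"
proof -
  let ?F = "\<lambda>p. of_bool (mono_on {1..s} (fst p)) * (of_bool (mono_on {1..s} (snd p)) *
    ((\<Prod>i=1..s. P (fst p i) (snd p (\<sigma> i))) / (block_fact s n (fst p) * block_fact s n (snd p))))"
  let ?f = "\<lambda>d. (restrict (fst \<circ> d) {1..s}, restrict (snd \<circ> d \<circ> inv \<sigma>) {1..s})"
  let ?g = "\<lambda>p. restrict (\<lambda>j. (fst p j, snd p (\<sigma> j))) {1..s}"
  have \<sigma>_in: "\<sigma> j \<in> {1..s}" "inv \<sigma> j \<in> {1..s}" if "j \<in> {1..s}" for j
    using that permutes_in_image[OF \<sigma>] permutes_in_image[OF permutes_inv[OF \<sigma>]]
    by (simp_all del: atLeastAtMost_iff)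
  have \<sigma>_inv: "inv \<sigma> (\<sigma> j) = j" "\<sigma> (inv \<sigma> j) = j" for j
    using permutes_inverses[OF \<sigma>] by auto
  have mono_restrict: "mono_on {1..s} (restrict f {1..s}) \<longleftrightarrow> mono_on {1..s} f" for f :: "nat \<Rightarrow> nat"
    by (simp add: mono_on_def)
  have fact_restrict: "block_fact s n (restrict f {1..s}) = block_fact s n f" for f
    by (intro block_fact_cong) simp
  have "(\<Sum>d\<in>{1..s} \<rightarrow>\<^sub>E cells n. (\<Prod>j=1..s. case_prod P (d j)) *
      (of_bool (mono_on {1..s} (fst \<circ> d)) / block_fact s n (fst \<circ> d) *
       (of_bool (mono_on {1..s} (snd \<circ> d \<circ> inv \<sigma>)) / block_fact s n (snd \<circ> d \<circ> inv \<sigma>)))) =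
    (\<Sum>p\<in>({1..s} \<rightarrow>\<^sub>E {1..n}) \<times> ({1..s} \<rightarrow>\<^sub>E {1..n}). ?F p)"
  proof (rule sum.reindex_bij_witness[of _ ?g ?f])
    fix d assume d: "d \<in> {1..s} \<rightarrow>\<^sub>E cells n"
    show "?g (?f d) = d"
    proof
      fix j show "?g (?f d) j = d j"
        using PiE_arb[OF d, of j] \<sigma>_in[of j]
        by (cases "j \<in> {1..s}") (simp_all add: \<sigma>_inv restrict_def del: atLeastAtMost_iff)
    qed
    have mem: "fst (d j) \<in> {1..n}" "snd (d j) \<in> {1..n}" if "j \<in> {1..s}" for j
      using PiE_mem[OF d that] by (auto simp: cells_def)
    show "?f d \<in> ({1..s} \<rightarrow>\<^sub>E {1..n}) \<times> ({1..s} \<rightarrow>\<^sub>E {1..n})"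
      using mem \<sigma>_in by (auto simp del: atLeastAtMost_iff)
    have "(\<Prod>j=1..s. case_prod P (d j)) = (\<Prod>i=1..s. P (fst (?f d) i) (snd (?f d) (\<sigma> i)))"
      using \<sigma>_in by (intro prod.cong) (auto simp: \<sigma>_inv case_prod_beta simp del: atLeastAtMost_iff)
    then show "?F (?f d) = (\<Prod>j=1..s. case_prod P (d j)) *
      (of_bool (mono_on {1..s} (fst \<circ> d)) / block_fact s n (fst \<circ> d) *
       (of_bool (mono_on {1..s} (snd \<circ> d \<circ> inv \<sigma>)) / block_fact s n (snd \<circ> d \<circ> inv \<sigma>)))"
      by (simp only: fst_conv snd_conv mono_restrict fact_restrict) (simp only: times_divide_eq_left times_divide_eq_right mult_ac divide_divide_eq_left)
  next
    fix p assume p: "p \<in> ({1..s} \<rightarrow>\<^sub>E {1..n}) \<times> ({1..s} \<rightarrow>\<^sub>E {1..n})"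
    then have p1: "fst p \<in> {1..s} \<rightarrow>\<^sub>E {1..n}" and p2: "snd p \<in> {1..s} \<rightarrow>\<^sub>E {1..n}" by auto
    have "restrict (fst \<circ> ?g p) {1..s} = fst p"
    proof
      fix j show "restrict (fst \<circ> ?g p) {1..s} j = fst p j"
        using PiE_arb[OF p1, of j]
        by (cases "j \<in> {1..s}") (simp_all add: restrict_def del: atLeastAtMost_iff)
    qed
    moreover have "restrict (snd \<circ> ?g p \<circ> inv \<sigma>) {1..s} = snd p"
    proof
      fix j show "restrict (snd \<circ> ?g p \<circ> inv \<sigma>) {1..s} j = snd p j"
        using PiE_arb[OF p2, of j] \<sigma>_in[of j]
        by (cases "j \<in> {1..s}") (simp_all add: \<sigma>_inv restrict_def del: atLeastAtMost_iff)
    qed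
    ultimately show "?f (?g p) = p" by simp
    show "?g p \<in> {1..s} \<rightarrow>\<^sub>E cells n"
      using PiE_mem[OF p1] PiE_mem[OF p2] \<sigma>_in by (auto simp: cells_def simp del: atLeastAtMost_iff)
  qed
  also have "\<dots> = pattern_weight n P s \<sigma>"
    unfolding pattern_weight_def sum_nondec_funs
    unfolding sum_distrib_left sum.cartesian_product
    by (intro sum.cong) auto
  finally show ?thesis .
qed

text \<open>The conditions on Y say that it ignores the cells of the listed points and the
  distribution of ranks among them; such a Y is independent of the occurrence. Y = 1 gives the mean,
  Y = another occurrence the second moment.\<close>

lemma sample_mean_sorted_pattern:
  assumes \<sigma>: "\<sigma> permutes {1..s}" and P1: "(\<Sum>z\<in>cells n. case_prod P z) = 1"
    and inj: "inj_on lam {1..s}" and lam: "lam ` {1..s} \<subseteq> {1..N}"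
    and Yc: "\<And>c c' \<tau> \<rho>. (\<And>i. i \<notin> lam ` {1..s} \<Longrightarrow> c i = c' i) \<Longrightarrow> Y c \<tau> \<rho> = Y c' \<tau> \<rho>"
    and Y\<tau>: "\<And>c \<tau> \<rho> \<kappa>. \<kappa> permutes lam ` {1..s} \<Longrightarrow> Y c (\<tau> \<circ> \<kappa>) \<rho> = Y c \<tau> \<rho>"
    and Y\<rho>: "\<And>c \<tau> \<rho> \<kappa>. \<kappa> permutes lam ` {1..s} \<Longrightarrow> Y c \<tau> (\<rho> \<circ> \<kappa>) = Y c \<tau> \<rho>"
  shows "sample_mean N n P (\<lambda>c \<tau> \<rho>. of_bool (sorted_pattern N s \<sigma> lam c \<tau> \<rho>) * Y c \<tau> \<rho>) =
    pattern_weight n P s \<sigma> * sample_mean N n P Y"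
proof -
  define K where "K = (\<lambda>d :: nat \<Rightarrow> nat \<times> nat. of_bool (mono_on {1..s} (fst \<circ> d)) / block_fact s n (fst \<circ> d) *
       (of_bool (mono_on {1..s} (snd \<circ> d \<circ> inv \<sigma>)) / block_fact s n (snd \<circ> d \<circ> inv \<sigma>)))"
  define Z where "Z = (\<lambda>c. \<Sum>\<tau> | \<tau> permutes {1..N}. \<Sum>\<rho> | \<rho> permutes {1..N}. Y c \<tau> \<rho>)"
  have \<sigma>_in: "inv \<sigma> j \<in> {1..s}" if "j \<in> {1..s}" for j
    using that permutes_in_image[OF permutes_inv[OF \<sigma>]] by (simp del: atLeastAtMost_iff)
  have inj': "inj_on (lam \<circ> inv \<sigma>) {1..s}"
    using inj permutes_image[OF permutes_inv[OF \<sigma>]]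
    by (intro comp_inj_on permutes_inj_on[OF permutes_inv[OF \<sigma>]]) simp
  have im': "(lam \<circ> inv \<sigma>) ` {1..s} = lam ` {1..s}"
    using permutes_image[OF permutes_inv[OF \<sigma>]] by (simp only: image_comp[symmetric])
  have inner: "(\<Sum>\<tau> | \<tau> permutes {1..N}. \<Sum>\<rho> | \<rho> permutes {1..N}.
      of_bool (sorted_pattern N s \<sigma> lam c \<tau> \<rho>) * Y c \<tau> \<rho>) = K (c \<circ> lam) * Z c"
    if c: "c \<in> {1..N} \<rightarrow>\<^sub>E cells n" for c
  proof -
    have cell: "(fst \<circ> c) (lam j) \<in> {1..n}" "(snd \<circ> c) ((lam \<circ> inv \<sigma>) j) \<in> {1..n}" if "j \<in> {1..s}" for j
    proof -
      have "lam j \<in> {1..N}" "lam (inv \<sigma> j) \<in> {1..N}" using lam that \<sigma>_in by blast+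
      then show "(fst \<circ> c) (lam j) \<in> {1..n}" "(snd \<circ> c) ((lam \<circ> inv \<sigma>) j) \<in> {1..n}"
        using PiE_mem[OF c] unfolding cells_def by (auto simp: mem_Times_iff simp del: atLeastAtMost_iff)
    qed
    let ?X = "\<lambda>\<tau>. of_bool (strict_mono_on {1..s} (key N (fst \<circ> c) \<tau> \<circ> lam)) :: real"
    let ?k2 = "of_bool (mono_on {1..s} ((snd \<circ> c) \<circ> (lam \<circ> inv \<sigma>))) / block_fact s n ((snd \<circ> c) \<circ> (lam \<circ> inv \<sigma>))"
    let ?k1 = "of_bool (mono_on {1..s} ((fst \<circ> c) \<circ> lam)) / block_fact s n ((fst \<circ> c) \<circ> lam)"
    have "(\<Sum>\<tau> | \<tau> permutes {1..N}. \<Sum>\<rho> | \<rho> permutes {1..N}.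
        of_bool (sorted_pattern N s \<sigma> lam c \<tau> \<rho>) * Y c \<tau> \<rho>) =
      (\<Sum>\<tau> | \<tau> permutes {1..N}. ?X \<tau> * (\<Sum>\<rho> | \<rho> permutes {1..N}.
         of_bool (strict_mono_on {1..s} (key N (snd \<circ> c) \<rho> \<circ> (lam \<circ> inv \<sigma>))) * Y c \<tau> \<rho>))"
      unfolding sum_distrib_left sorted_pattern_def of_bool_conj mult.assoc ..
    \<comment> \<open>The ranks \<rho> are averaged first, for fixed c and \<tau>; the remaining
      \<rho>-sum of Y still has the invariance in \<tau> that the second application of
      \<open>sum_key_sorted\<close> asks for.\<close>
    also have "\<dots> = (\<Sum>\<tau> | \<tau> permutes {1..N}. ?X \<tau> * (?k2 * (\<Sum>\<rho> | \<rho> permutes {1..N}. Y c \<tau> \<rho>)))"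
      by (intro sum.cong refl arg_cong2[of _ _ _ _ "(*)"] sum_key_sorted)
        (use inj' im' lam cell Y\<rho> in auto)
    also have "\<dots> = ?k1 * (\<Sum>\<tau> | \<tau> permutes {1..N}. ?k2 * (\<Sum>\<rho> | \<rho> permutes {1..N}. Y c \<tau> \<rho>))"
      by (intro sum_key_sorted) (use inj lam cell Y\<tau> in auto)
    also have "\<dots> = K (c \<circ> lam) * Z c"
      unfolding K_def Z_def sum_distrib_left[symmetric] by (simp only: o_assoc mult.assoc)
    finally show ?thesis .
  qed
  have marg: "(\<Sum>c\<in>{1..N} \<rightarrow>\<^sub>E cells n. (\<Prod>i\<in>{1..N}. case_prod P (c i)) * (K (c \<circ> lam) * Z c)) =
    (\<Sum>d\<in>{1..s} \<rightarrow>\<^sub>E cells n. (\<Prod>j\<in>{1..s}. case_prod P (d j)) * K d) *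
    (\<Sum>c\<in>{1..N} \<rightarrow>\<^sub>E cells n. (\<Prod>i\<in>{1..N}. case_prod P (c i)) * Z c)"
  proof (rule sum_PiE_marginal)
    fix d d' :: "nat \<Rightarrow> nat \<times> nat" assume dd: "\<And>j. j \<in> {1..s} \<Longrightarrow> d j = d' j"
    have "mono_on {1..s} (fst \<circ> d) = mono_on {1..s} (fst \<circ> d')"
      "mono_on {1..s} (snd \<circ> d \<circ> inv \<sigma>) = mono_on {1..s} (snd \<circ> d' \<circ> inv \<sigma>)"
      using dd \<sigma>_in by (auto simp: mono_on_def simp del: atLeastAtMost_iff)
    moreover have "block_fact s n (fst \<circ> d) = block_fact s n (fst \<circ> d')"
      "block_fact s n (snd \<circ> d \<circ> inv \<sigma>) = block_fact s n (snd \<circ> d' \<circ> inv \<sigma>)"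
      using dd \<sigma>_in by (auto intro!: block_fact_cong simp del: atLeastAtMost_iff)
    ultimately show "K d = K d'" by (simp only: K_def)
  next
    fix c c' :: "nat \<Rightarrow> nat \<times> nat" assume "\<And>i. i \<notin> lam ` {1..s} \<Longrightarrow> c i = c' i"
    then show "Z c = Z c'" unfolding Z_def by (intro sum.cong refl Yc) auto
  qed (use inj lam P1 finite_cells in auto)
  have pw: "(\<Sum>d\<in>{1..s} \<rightarrow>\<^sub>E cells n. (\<Prod>j\<in>{1..s}. case_prod P (d j)) * K d) = pattern_weight n P s \<sigma>"
    unfolding K_def by (rule sum_cells_pattern_weight[OF \<sigma>])
  have "sample_mean N n P (\<lambda>c \<tau> \<rho>. of_bool (sorted_pattern N s \<sigma> lam c \<tau> \<rho>) * Y c \<tau> \<rho>) =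
    (\<Sum>c\<in>{1..N} \<rightarrow>\<^sub>E cells n. (\<Prod>i\<in>{1..N}. case_prod P (c i)) * (K (c \<circ> lam) * Z c)) / (fact N)\<^sup>2"
    unfolding sample_mean_def using inner
    by (intro arg_cong2[of _ _ _ _ "(/)"] sum.cong refl arg_cong2[of _ _ _ _ "(*)"])
  also have "\<dots> = pattern_weight n P s \<sigma> * sample_mean N n P Y"
    unfolding marg pw
    unfolding sample_mean_def Z_def by simp
  finally show ?thesis .
qed

lemma sample_mean_one:
  assumes "(\<Sum>z\<in>cells n. case_prod P z) = 1"
  shows "sample_mean N n P (\<lambda>_ _ _. 1) = 1"
proof -
  have "(\<Sum>c\<in>{1..N} \<rightarrow>\<^sub>E cells n. \<Prod>i=1..N. case_prod P (c i)) = 1"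
    using prod_sum_PiE[of "{1..N}" "\<lambda>_. cells n" "\<lambda>_. case_prod P"] assms by (simp add: finite_cells)
  then show ?thesis
    by (simp add: sample_mean_def card_permutations power2_eq_square sum_distrib_right[symmetric])
qed

lemma sample_mean_sum:
  "sample_mean N n P (\<lambda>c \<tau> \<rho>. \<Sum>l\<in>L. \<phi> l c \<tau> \<rho>) = (\<Sum>l\<in>L. sample_mean N n P (\<phi> l))"
proof -
  have "(\<Sum>\<tau> | \<tau> permutes {1..N}. \<Sum>\<rho> | \<rho> permutes {1..N}. \<Sum>l\<in>L. \<phi> l c \<tau> \<rho>) =
      (\<Sum>l\<in>L. \<Sum>\<tau> | \<tau> permutes {1..N}. \<Sum>\<rho> | \<rho> permutes {1..N}. \<phi> l c \<tau> \<rho>)" for c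
    by (simp add: sum.swap[of _ L])
  then show ?thesis
    by (simp add: sample_mean_def sum_distrib_left sum.swap[of _ L] sum_divide_distrib)
qed

lemma sample_mean_cmult:
  "sample_mean N n P (\<lambda>c \<tau> \<rho>. a * \<phi> c \<tau> \<rho>) = a * sample_mean N n P \<phi>"
  by (simp add: sample_mean_def sum_distrib_left[symmetric] mult.left_commute)

lemma sample_mean_add:
  "sample_mean N n P (\<lambda>c \<tau> \<rho>. \<phi> c \<tau> \<rho> + \<psi> c \<tau> \<rho>) = sample_mean N n P \<phi> + sample_mean N n P \<psi>"
  by (simp add: sample_mean_def sum.distrib distrib_left add_divide_distrib)

lemma sample_mean_mono:
  assumes P0: "\<And>z. z \<in> cells n \<Longrightarrow> case_prod P z \<ge> 0"
    and le: "\<And>c \<tau> \<rho>. c \<in> {1..N} \<rightarrow>\<^sub>E cells n \<Longrightarrow> \<tau> permutes {1..N} \<Longrightarrow> \<rho> permutes {1..N} \<Longrightarrow> \<phi> c \<tau> \<rho> \<le> \<psi> c \<tau> \<rho>"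
  shows "sample_mean N n P \<phi> \<le> sample_mean N n P \<psi>"
proof -
  have "(\<Prod>i=1..N. case_prod P (c i)) \<ge> 0" if "c \<in> {1..N} \<rightarrow>\<^sub>E cells n" for c
    by (intro prod_nonneg) (use P0 PiE_mem[OF that] in blast)
  then show ?thesis
    unfolding sample_mean_def
    by (intro divide_right_mono sum_mono mult_left_mono) (auto intro: le)
qed

text \<open>The probabilistic method in finite form: the minimum over the sample space is at most
  the weighted mean.\<close>

lemma sample_mean_attained:
  assumes P0: "\<And>z. z \<in> cells n \<Longrightarrow> case_prod P z \<ge> 0" and P1: "(\<Sum>z\<in>cells n. case_prod P z) = 1"
  shows "\<exists>c \<tau> \<rho>. c \<in> {1..N} \<rightarrow>\<^sub>E cells n \<and> \<tau> permutes {1..N} \<and> \<rho> permutes {1..N} \<and>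
    \<phi> c \<tau> \<rho> \<le> sample_mean N n P \<phi>"
proof -
  let ?T = "({1..N} \<rightarrow>\<^sub>E cells n) \<times> {\<tau>. \<tau> permutes {1..N}} \<times> {\<rho>. \<rho> permutes {1..N}}"
  let ?f = "\<lambda>(c, \<tau>, \<rho>). \<phi> c \<tau> \<rho>"
  have "cells n \<noteq> {}" using P1 by auto
  then have "?T \<noteq> {}" by (auto simp: PiE_eq_empty_iff intro: permutes_id)
  moreover have "finite ?T" by (auto intro!: finite_PiE finite_cells finite_permutations)
  ultimately obtain t where t: "t \<in> ?T" "\<And>t'. t' \<in> ?T \<Longrightarrow> ?f t \<le> ?f t'"
    using arg_min_if_finite[of ?T ?f] by (metis not_le)
  obtain c \<tau> \<rho> where [simp]: "t = (c, \<tau>, \<rho>)" by (cases t)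
  have "\<phi> c \<tau> \<rho> = sample_mean N n P (\<lambda>_ _ _. \<phi> c \<tau> \<rho> * 1)"
    unfolding sample_mean_cmult sample_mean_one[OF P1] by simp
  also have "\<dots> \<le> sample_mean N n P \<phi>"
    by (rule sample_mean_mono[OF P0]) (use t(2) in fastforce)+
  finally show ?thesis using t(1) by auto
qed

section \<open>Concentration of the number of occurrences\<close>

text \<open>Counts lists of points rather than sets. For permutations \<tau> and \<rho> a sorted
  list is injective and determined by its set, so no set is counted twice.\<close>

definition occurrences :: "nat \<Rightarrow> nat \<Rightarrow> (nat \<Rightarrow> nat) \<Rightarrow>
    (nat \<Rightarrow> nat \<times> nat) \<Rightarrow> (nat \<Rightarrow> nat) \<Rightarrow> (nat \<Rightarrow> nat) \<Rightarrow> real" where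
  "occurrences N s \<sigma> c \<tau> \<rho> = (\<Sum>lam\<in>{1..s} \<rightarrow>\<^sub>E {1..N}. of_bool (sorted_pattern N s \<sigma> lam c \<tau> \<rho>))"

lemma sorted_pattern_imp_inj:
  assumes "sorted_pattern N s \<sigma> lam c \<tau> \<rho>"
  shows "inj_on lam {1..s}"
  using assms unfolding sorted_pattern_def
  by (metis inj_on_imageI2 strict_mono_on_imp_inj_on)

lemma sorted_pattern_cong:
  assumes \<sigma>: "\<sigma> permutes {1..s}"
    and eq: "\<And>j. j \<in> {1..s} \<Longrightarrow> c (lam j) = c' (lam j) \<and> \<tau> (lam j) = \<tau>' (lam j) \<and> \<rho> (lam j) = \<rho>' (lam j)"
  shows "sorted_pattern N s \<sigma> lam c \<tau> \<rho> = sorted_pattern N s \<sigma> lam c' \<tau>' \<rho>'"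
proof -
  have "inv \<sigma> j \<in> {1..s}" if "j \<in> {1..s}" for j
    using that permutes_in_image[OF permutes_inv[OF \<sigma>]] by (simp del: atLeastAtMost_iff)
  then have "(key N (fst \<circ> c) \<tau> \<circ> lam) j = (key N (fst \<circ> c') \<tau>' \<circ> lam) j"
    "(key N (snd \<circ> c) \<rho> \<circ> (lam \<circ> inv \<sigma>)) j = (key N (snd \<circ> c') \<rho>' \<circ> (lam \<circ> inv \<sigma>)) j"
    if "j \<in> {1..s}" for j
    using eq that by (simp_all add: key_def del: atLeastAtMost_iff)
  then show ?thesis
    unfolding sorted_pattern_def strict_mono_on_def by simp
qed

lemma sample_mean_occurrence:
  assumes \<sigma>: "\<sigma> permutes {1..s}" and P1: "(\<Sum>z\<in>cells n. case_prod P z) = 1"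
    and lam: "lam \<in> {1..s} \<rightarrow>\<^sub>E {1..N}"
  shows "sample_mean N n P (\<lambda>c \<tau> \<rho>. of_bool (sorted_pattern N s \<sigma> lam c \<tau> \<rho>)) =
    of_bool (inj_on lam {1..s}) * pattern_weight n P s \<sigma>"
proof (cases "inj_on lam {1..s}")
  case True
  have "lam ` {1..s} \<subseteq> {1..N}" using lam by blast
  then show ?thesis
    using sample_mean_sorted_pattern[OF \<sigma> P1 True, of N "\<lambda>_ _ _. 1"] sample_mean_one[OF P1] True by simp
next
  case False
  then have "sorted_pattern N s \<sigma> lam c \<tau> \<rho> = False" for c \<tau> \<rho> using sorted_pattern_imp_inj by blast
  then show ?thesis using False by (simp add: sample_mean_def)
qed

text \<open>Disjoint lists are independent: the indicator of the second list is an admissible Y for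
  the first.\<close>

lemma sample_mean_two_occurrences:
  assumes \<sigma>: "\<sigma> permutes {1..s}" and P1: "(\<Sum>z\<in>cells n. case_prod P z) = 1"
    and lam: "lam \<in> {1..s} \<rightarrow>\<^sub>E {1..N}" "inj_on lam {1..s}"
    and lam': "lam' \<in> {1..s} \<rightarrow>\<^sub>E {1..N}" "inj_on lam' {1..s}"
    and disj: "lam ` {1..s} \<inter> lam' ` {1..s} = {}"
  shows "sample_mean N n P (\<lambda>c \<tau> \<rho>. of_bool (sorted_pattern N s \<sigma> lam c \<tau> \<rho>) *
      of_bool (sorted_pattern N s \<sigma> lam' c \<tau> \<rho>)) = (pattern_weight n P s \<sigma>)\<^sup>2"
proof -
  have im: "lam ` {1..s} \<subseteq> {1..N}" using lam by blast
  have notin: "lam' j \<notin> lam ` {1..s}" if "j \<in> {1..s}" for j using disj that by blast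
  have "sample_mean N n P (\<lambda>c \<tau> \<rho>. of_bool (sorted_pattern N s \<sigma> lam c \<tau> \<rho>) *
      of_bool (sorted_pattern N s \<sigma> lam' c \<tau> \<rho>)) = pattern_weight n P s \<sigma> *
     sample_mean N n P (\<lambda>c \<tau> \<rho>. of_bool (sorted_pattern N s \<sigma> lam' c \<tau> \<rho>))"
  proof (rule sample_mean_sorted_pattern[OF \<sigma> P1 lam(2) im])
    fix c c' :: "nat \<Rightarrow> nat \<times> nat" and \<tau> \<rho> assume "\<And>i. i \<notin> lam ` {1..s} \<Longrightarrow> c i = c' i"
    then show "of_bool (sorted_pattern N s \<sigma> lam' c \<tau> \<rho>) = (of_bool (sorted_pattern N s \<sigma> lam' c' \<tau> \<rho>) :: real)"
      using notin by (intro arg_cong[of _ _ of_bool] sorted_pattern_cong[OF \<sigma>]) simp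
  next
    fix c :: "nat \<Rightarrow> nat \<times> nat" and \<tau> \<rho> \<kappa> assume "\<kappa> permutes lam ` {1..s}"
    then have fixed: "\<kappa> (lam' j) = lam' j" if "j \<in> {1..s}" for j
      using notin[OF that] by (rule permutes_not_in)
    show "of_bool (sorted_pattern N s \<sigma> lam' c (\<tau> \<circ> \<kappa>) \<rho>) = (of_bool (sorted_pattern N s \<sigma> lam' c \<tau> \<rho>) :: real)"
      "of_bool (sorted_pattern N s \<sigma> lam' c \<tau> (\<rho> \<circ> \<kappa>)) = (of_bool (sorted_pattern N s \<sigma> lam' c \<tau> \<rho>) :: real)"
      using fixed by (intro arg_cong[of _ _ of_bool] sorted_pattern_cong[OF \<sigma>]; simp)+
  qed
  then show ?thesis
    using sample_mean_occurrence[OF \<sigma> P1 lam'(1)] lam'(2) by (simp add: power2_eq_square)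
qed

text \<open>The falling factorial m (m - 1) ... (m - s + 1). Truncated subtraction makes it 0 for m
  < s, when there are no injections.\<close>

definition num_inj :: "nat \<Rightarrow> nat \<Rightarrow> real" where
  "num_inj s m = (\<Prod>i\<in>{0..<s}. real (m - i))"

lemma card_inj_PiE:
  assumes "finite V"
  shows "real (card {lam \<in> {1..s} \<rightarrow>\<^sub>E V. inj_on lam {1..s}}) = num_inj s (card V)"
  using card_inj_on_subset_funcset[of "{1..s}" V "{1..s}"] assms by (simp add: num_inj_def)

lemma num_inj_asymptotic: "(\<lambda>N. num_inj s (N - k) / real N ^ s) \<longlonglongrightarrow> 1"
proof -
  have "(\<lambda>N. real (N - (k + i)) / real N) \<longlonglongrightarrow> 1" for i
  proof -
    have "\<forall>\<^sub>F N in sequentially. 1 - real (k + i) / real N = real (N - (k + i)) / real N"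
      using eventually_ge_at_top[of "k + i + 1"]
      by eventually_elim (simp add: of_nat_diff divide_simps)
    moreover have "(\<lambda>N. 1 - real (k + i) / real N) \<longlonglongrightarrow> 1 - 0"
      by (intro tendsto_diff tendsto_const lim_const_over_n)
    ultimately show ?thesis by (simp add: tendsto_cong)
  qed
  then have "(\<lambda>N. \<Prod>i\<in>{0..<s}. real (N - (k + i)) / real N) \<longlonglongrightarrow> (\<Prod>i\<in>{0..<s}. 1)"
    by (intro tendsto_prod)
  then show ?thesis
    by (simp add: num_inj_def prod_dividef)
qed

text \<open>Pairs of disjoint injective lists contribute exactly \<open>q\<^sup>2\<close> to the
  second moment and every other pair at most 1; those other pairs are a vanishing fraction. The last
  term stems from centring at q instead of the exact mean
  \<open>q * num_inj s N / real N ^ s\<close>.\<close>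

lemma sample_mean_variance_le:
  assumes \<sigma>: "\<sigma> permutes {1..s}" and P0: "\<And>z. z \<in> cells n \<Longrightarrow> case_prod P z \<ge> 0"
    and P1: "(\<Sum>z\<in>cells n. case_prod P z) = 1" and N: "N > 0"
  defines "q \<equiv> pattern_weight n P s \<sigma>"
  shows "sample_mean N n P (\<lambda>c \<tau> \<rho>. (occurrences N s \<sigma> c \<tau> \<rho> / real N ^ s - q)\<^sup>2) \<le>
    (1 - num_inj s N / real N ^ s * (num_inj s (N - s) / real N ^ s)) + 2 * q\<^sup>2 * (1 - num_inj s N / real N ^ s)"
proof -
  let ?L = "{1..s} \<rightarrow>\<^sub>E {1..N}" and ?M = "sample_mean N n P"
  let ?S = "\<lambda>lam c \<tau> \<rho>. of_bool (sorted_pattern N s \<sigma> lam c \<tau> \<rho>) :: real"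
  define good where "good = (\<lambda>lam lam'. inj_on lam {1..s} \<and> inj_on lam' {1..s} \<and> lam ` {1..s} \<inter> lam' ` {1..s} = ({} :: nat set))"
  have finL: "finite ?L" by (auto intro: finite_PiE)
  have cardL: "real (card ?L) = real N ^ s" by (simp add: card_PiE)
  have mean: "?M (occurrences N s \<sigma>) = q * num_inj s N"
  proof -
    have "?M (occurrences N s \<sigma>) = (\<Sum>lam\<in>?L. of_bool (inj_on lam {1..s}) * q)"
      unfolding occurrences_def sample_mean_sum q_def
      by (intro sum.cong refl sample_mean_occurrence[OF \<sigma> P1])
    also have "\<dots> = (\<Sum>lam\<in>?L. if inj_on lam {1..s} then q else 0)" by (intro sum.cong) auto
    also have "\<dots> = (\<Sum>lam\<in>{lam \<in> ?L. inj_on lam {1..s}}. q)"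
      using finL by (rule sum.inter_filter[symmetric])
    finally show ?thesis using card_inj_PiE[of "{1..N}" s] by simp
  qed
  have pair: "?M (\<lambda>c \<tau> \<rho>. ?S lam c \<tau> \<rho> * ?S lam' c \<tau> \<rho>) \<le> of_bool (good lam lam') * q\<^sup>2 + (1 - of_bool (good lam lam'))"
    if "lam \<in> ?L" "lam' \<in> ?L" for lam lam'
  proof (cases "good lam lam'")
    case True
    then show ?thesis using sample_mean_two_occurrences[OF \<sigma> P1 that(1) _ that(2)]
      by (simp add: good_def q_def)
  next
    case False
    have "?M (\<lambda>c \<tau> \<rho>. ?S lam c \<tau> \<rho> * ?S lam' c \<tau> \<rho>) \<le> ?M (\<lambda>_ _ _. 1)"
      by (rule sample_mean_mono[OF P0]) auto
    then show ?thesis using False sample_mean_one[OF P1] by simp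
  qed
  define G where "G = num_inj s N * num_inj s (N - s)"
  have G: "(\<Sum>lam\<in>?L. \<Sum>lam'\<in>?L. of_bool (good lam lam')) = G"
  proof -
    have "(\<Sum>lam'\<in>?L. of_bool (good lam lam')) = (if inj_on lam {1..s} then num_inj s (N - s) else 0)"
      if "lam \<in> ?L" for lam
    proof (cases "inj_on lam {1..s}")
      case True
      have im: "lam ` {1..s} \<subseteq> {1..N}" using that by blast
      have "(\<Sum>lam'\<in>?L. of_bool (good lam lam')) = (\<Sum>lam'\<in>?L. if good lam lam' then 1 else (0::real))"
        by (intro sum.cong) auto
      also have "\<dots> = real (card {lam' \<in> ?L. good lam lam'})"
        using sum.inter_filter[OF finL, of "\<lambda>_. 1::real" "good lam"] by simp
      also have "{lam' \<in> ?L. good lam lam'} = {lam' \<in> {1..s} \<rightarrow>\<^sub>E ({1..N} - lam ` {1..s}). inj_on lam' {1..s}}"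
        using True by (auto simp: good_def PiE_iff simp del: atLeastAtMost_iff) (metis image_eqI)
      also have "real (card \<dots>) = num_inj s (card ({1..N} - lam ` {1..s}))"
        by (rule card_inj_PiE) simp
      also have "card ({1..N} - lam ` {1..s}) = N - s"
        using im True by (simp add: card_Diff_subset card_image)
      finally show ?thesis using True by simp
    qed (simp add: good_def)
    then have "(\<Sum>lam\<in>?L. \<Sum>lam'\<in>?L. of_bool (good lam lam')) =
       (\<Sum>lam\<in>?L. if inj_on lam {1..s} then num_inj s (N - s) else 0)" by (intro sum.cong) auto
    also have "\<dots> = (\<Sum>lam\<in>{lam \<in> ?L. inj_on lam {1..s}}. num_inj s (N - s))"
      using finL by (rule sum.inter_filter[symmetric])
    finally show ?thesis using card_inj_PiE[of "{1..N}" s] by (simp add: G_def)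
  qed
  have second: "?M (\<lambda>c \<tau> \<rho>. (occurrences N s \<sigma> c \<tau> \<rho>)\<^sup>2) \<le> G * q\<^sup>2 + (real N ^ s * real N ^ s - G)"
  proof -
    have "?M (\<lambda>c \<tau> \<rho>. (occurrences N s \<sigma> c \<tau> \<rho>)\<^sup>2) =
       (\<Sum>lam\<in>?L. \<Sum>lam'\<in>?L. ?M (\<lambda>c \<tau> \<rho>. ?S lam c \<tau> \<rho> * ?S lam' c \<tau> \<rho>))"
      unfolding occurrences_def power2_eq_square sum_product sample_mean_sum ..
    also have "\<dots> \<le> (\<Sum>lam\<in>?L. \<Sum>lam'\<in>?L. of_bool (good lam lam') * q\<^sup>2 + (1 - of_bool (good lam lam')))"
      by (intro sum_mono pair)
    also have "\<dots> = G * q\<^sup>2 + (real N ^ s * real N ^ s - G)"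
      unfolding sum.distrib sum_subtractf sum_distrib_right[symmetric] G using cardL by simp
    finally show ?thesis .
  qed
  have G_le: "G \<le> real N ^ s * real N ^ s"
  proof -
    have "(\<Sum>lam\<in>?L. \<Sum>lam'\<in>?L. of_bool (good lam lam')) \<le> (\<Sum>lam\<in>?L. \<Sum>lam'\<in>?L. (1::real))"
      by (intro sum_mono) auto
    then show ?thesis unfolding G using cardL by simp
  qed
  define D where "D = real N ^ s"
  have D: "D > 0" using N by (simp add: D_def)
  have "?M (\<lambda>c \<tau> \<rho>. (occurrences N s \<sigma> c \<tau> \<rho> / D - q)\<^sup>2) =
     ?M (\<lambda>c \<tau> \<rho>. (1 / D\<^sup>2 * (occurrences N s \<sigma> c \<tau> \<rho>)\<^sup>2 + (- 2 * q / D) * occurrences N s \<sigma> c \<tau> \<rho>) + q\<^sup>2 * 1)"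
    using D by (intro arg_cong[of _ _ ?M] ext) (simp add: power2_diff power_divide)
  also have "\<dots> = 1 / D\<^sup>2 * ?M (\<lambda>c \<tau> \<rho>. (occurrences N s \<sigma> c \<tau> \<rho>)\<^sup>2) + (- 2 * q / D) * (q * num_inj s N) + q\<^sup>2"
    unfolding sample_mean_add sample_mean_cmult sample_mean_one[OF P1] mean by simp
  also have "\<dots> \<le> 1 / D\<^sup>2 * (G * q\<^sup>2 + (D * D - G)) + (- 2 * q / D) * (q * num_inj s N) + q\<^sup>2"
    using second by (intro add_right_mono mult_left_mono) (auto simp: D_def)
  also have "\<dots> = (G / D\<^sup>2 - 1) * q\<^sup>2 + (1 - G / D\<^sup>2) + 2 * q\<^sup>2 * (1 - num_inj s N / D)"
    using D by (simp add: field_simps power2_eq_square)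
  \<comment> \<open>The first summand is nonpositive, since G counts some of the
    \<open>real N ^ s * real N ^ s\<close> pairs.\<close>
  also have "\<dots> \<le> 0 + (1 - G / D\<^sup>2) + 2 * q\<^sup>2 * (1 - num_inj s N / D)"
    using G_le D by (intro add_right_mono mult_nonpos_nonneg) (auto simp: D_def power2_eq_square)
  finally show ?thesis by (simp add: D_def G_def power2_eq_square)
qed

theorem sampling_exists:
  assumes S: "finite S" "\<And>s \<sigma>. (s, \<sigma>) \<in> S \<Longrightarrow> \<sigma> permutes {1..s}"
    and P0: "\<And>z. z \<in> cells n \<Longrightarrow> case_prod P z \<ge> 0" and P1: "(\<Sum>z\<in>cells n. case_prod P z) = 1"
  shows "\<exists>c \<tau> \<rho>. (\<forall>N. c N \<in> {1..N} \<rightarrow>\<^sub>E cells n \<and> \<tau> N permutes {1..N} \<and> \<rho> N permutes {1..N}) \<and>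
    (\<forall>(s, \<sigma>)\<in>S. (\<lambda>N. occurrences N s \<sigma> (c N) (\<tau> N) (\<rho> N) / real N ^ s) \<longlonglongrightarrow> pattern_weight n P s \<sigma>)"
proof -
  let ?q = "\<lambda>p. pattern_weight n P (fst p) (snd p)"
  \<comment> \<open>Summing the squared deviations over the finite set S yields, for each N, one
    outcome that serves all patterns at once.\<close>
  define \<phi> where "\<phi> = (\<lambda>N c \<tau> \<rho>. \<Sum>p\<in>S. (occurrences N (fst p) (snd p) c \<tau> \<rho> / real N ^ fst p - ?q p)\<^sup>2)"
  define V where "V = (\<lambda>N. \<Sum>p\<in>S. (1 - num_inj (fst p) N / real N ^ fst p * (num_inj (fst p) (N - fst p) / real N ^ fst p))
     + 2 * (?q p)\<^sup>2 * (1 - num_inj (fst p) N / real N ^ fst p))"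
  have "\<exists>c \<tau> \<rho>. c \<in> {1..N} \<rightarrow>\<^sub>E cells n \<and> \<tau> permutes {1..N} \<and> \<rho> permutes {1..N} \<and>
    \<phi> N c \<tau> \<rho> \<le> sample_mean N n P (\<phi> N)" for N
    by (rule sample_mean_attained[OF P0 P1])
  then obtain c \<tau> \<rho> where c: "\<And>N. c N \<in> {1..N} \<rightarrow>\<^sub>E cells n \<and> \<tau> N permutes {1..N} \<and> \<rho> N permutes {1..N}"
    "\<And>N. \<phi> N (c N) (\<tau> N) (\<rho> N) \<le> sample_mean N n P (\<phi> N)"
    by metis
  have le_V: "\<phi> N (c N) (\<tau> N) (\<rho> N) \<le> V N" if "N > 0" for N
  proof -
    have "sample_mean N n P (\<phi> N) \<le> V N"
      unfolding \<phi>_def V_def sample_mean_sum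
      by (intro sum_mono sample_mean_variance_le[OF S(2) P0 P1 that]) auto
    then show ?thesis using c(2)[of N] by simp
  qed
  have "V \<longlonglongrightarrow> (\<Sum>p\<in>S. (1 - 1 * 1) + 2 * (?q p)\<^sup>2 * (1 - 1))"
    unfolding V_def using num_inj_asymptotic[where k = 0]
    by (intro tendsto_intros num_inj_asymptotic) simp_all
  then have V0: "V \<longlonglongrightarrow> 0" by simp
  have "(\<lambda>N. occurrences N s \<sigma> (c N) (\<tau> N) (\<rho> N) / real N ^ s) \<longlonglongrightarrow> pattern_weight n P s \<sigma>"
    if p: "(s, \<sigma>) \<in> S" for s \<sigma>
  proof -
    let ?d = "\<lambda>N. occurrences N s \<sigma> (c N) (\<tau> N) (\<rho> N) / real N ^ s - pattern_weight n P s \<sigma>"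
    have "(?d N)\<^sup>2 \<le> V N" if "N > 0" for N
    proof -
      have "(?d N)\<^sup>2 \<le> \<phi> N (c N) (\<tau> N) (\<rho> N)"
        unfolding \<phi>_def using member_le_sum[OF p, of "\<lambda>p. (occurrences N (fst p) (snd p) (c N) (\<tau> N) (\<rho> N) / real N ^ fst p - ?q p)\<^sup>2"] S(1)
        by simp
      then show ?thesis using le_V[OF that] by simp
    qed
    then have "\<forall>\<^sub>F N in sequentially. (?d N)\<^sup>2 \<le> V N"
      using eventually_gt_at_top[of 0] by (rule eventually_mono[rotated]) simp
    then have "(\<lambda>N. (?d N)\<^sup>2) \<longlonglongrightarrow> 0"
      by (intro tendsto_sandwich[OF _ _ tendsto_const V0]) auto
    then have "?d \<longlonglongrightarrow> 0" by (simp add: power_tendsto_0_iff)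
    then show ?thesis by (rule LIM_zero_cancel)
  qed
  then show ?thesis using c(1) by (intro exI[of _ c] exI[of _ \<tau>] exI[of _ \<rho>]) auto
qed

section \<open>From points with distinct keys to permutations\<close>

text \<open>\<open>inv \<kappa> i\<close> is the rank of the key \<open>X i\<close>.\<close>

lemma ex_sorting_permutation:
  fixes X :: "nat \<Rightarrow> nat"
  assumes "inj_on X {1..N}"
  obtains \<kappa> where "\<kappa> permutes {1..N}"
    "\<And>i j. i \<in> {1..N} \<Longrightarrow> j \<in> {1..N} \<Longrightarrow> X i < X j \<longleftrightarrow> inv \<kappa> i < inv \<kappa> j"
proof -
  obtain \<kappa> where \<kappa>: "\<kappa> permutes {1..N}" "strict_mono_on {1..N} (X \<circ> \<kappa>)"
    using ex1_sorting_permutation[of "{1..N}" id "{1..N}" X] assms by auto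
  have "X i < X j \<longleftrightarrow> inv \<kappa> i < inv \<kappa> j" if "i \<in> {1..N}" "j \<in> {1..N}" for i j
  proof -
    have "inv \<kappa> i \<in> {1..N}" "inv \<kappa> j \<in> {1..N}"
      using that permutes_in_image[OF permutes_inv[OF \<kappa>(1)]] by blast+
    from strict_mono_on_less[OF \<kappa>(2) this] show ?thesis
      using permutes_inverses[OF \<kappa>(1)] by simp
  qed
  with \<kappa>(1) show thesis by (rule that)
qed

text \<open>A set of positions that induces \<sigma> corresponds to the unique list of its points
  from left to right; the same points from bottom to top are
  \<open>lam \<circ> inv \<sigma>\<close>.\<close>

lemma permutation_of_keys:
  fixes X Y :: "nat \<Rightarrow> nat"
  assumes X: "inj_on X {1..N}" and Y: "inj_on Y {1..N}"
  shows "\<exists>p. p permutes {1..N} \<and> (\<forall>s \<sigma>. \<sigma> permutes {1..s} \<longrightarrow>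
    card {A. A \<subseteq> {1..N} \<and> card A = s \<and> induces (N, p) A (s, \<sigma>)} =
    card {lam \<in> {1..s} \<rightarrow>\<^sub>E {1..N}. strict_mono_on {1..s} (X \<circ> lam) \<and> strict_mono_on {1..s} (Y \<circ> (lam \<circ> inv \<sigma>))})"
proof -
  obtain x where x: "x permutes {1..N}"
    and X_less: "\<And>i j. i \<in> {1..N} \<Longrightarrow> j \<in> {1..N} \<Longrightarrow> X i < X j \<longleftrightarrow> inv x i < inv x j"
    using ex_sorting_permutation[OF X] by blast
  obtain y where y: "y permutes {1..N}"
    and Y_less: "\<And>i j. i \<in> {1..N} \<Longrightarrow> j \<in> {1..N} \<Longrightarrow> Y i < Y j \<longleftrightarrow> inv y i < inv y j"
    using ex_sorting_permutation[OF Y] by blast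
  have x_in: "x i \<in> {1..N} \<longleftrightarrow> i \<in> {1..N}" "inv x i \<in> {1..N} \<longleftrightarrow> i \<in> {1..N}" for i
    using permutes_in_image[OF x] permutes_in_image[OF permutes_inv[OF x]] by auto
  have x_inv [simp]: "x (inv x i) = i" "inv x (x i) = i" for i
    using permutes_inverses[OF x] by auto
  \<comment> \<open>x turns a horizontal rank into the point that has it, \<open>inv y\<close> turns
    the point into its vertical rank.\<close>
  define p where "p = inv y \<circ> x"
  have p: "p permutes {1..N}" unfolding p_def by (intro permutes_compose x permutes_inv y)
  have "card {A. A \<subseteq> {1..N} \<and> card A = s \<and> induces (N, p) A (s, \<sigma>)} =
    card {lam \<in> {1..s} \<rightarrow>\<^sub>E {1..N}. strict_mono_on {1..s} (X \<circ> lam) \<and> strict_mono_on {1..s} (Y \<circ> (lam \<circ> inv \<sigma>))}"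
    (is "card ?A = card ?L") if \<sigma>: "\<sigma> permutes {1..s}" for s \<sigma>
  proof -
    have \<sigma>_in: "\<sigma> j \<in> {1..s}" "inv \<sigma> j \<in> {1..s}" if "j \<in> {1..s}" for j
      using that permutes_in_image[OF \<sigma>] permutes_in_image[OF permutes_inv[OF \<sigma>]]
      by (simp_all del: atLeastAtMost_iff)
    have \<sigma>_inv: "inv \<sigma> (\<sigma> j) = j" "\<sigma> (inv \<sigma> j) = j" for j
      using permutes_inverses[OF \<sigma>] by auto
    \<comment> \<open>A list is sent to the set of horizontal ranks of its points, which are
      positions in p. For surjectivity the points \<open>x (a j)\<close> are listed along the
      increasing enumeration a of A.\<close>
    have "bij_betw (\<lambda>lam. (inv x \<circ> lam) ` {1..s}) ?L ?A"
      unfolding bij_betw_def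
    proof (intro conjI equalityI subsetI)
      show "inj_on (\<lambda>lam. (inv x \<circ> lam) ` {1..s}) ?L"
      proof (rule inj_onI)
        fix lam lam' assume L: "lam \<in> ?L" "lam' \<in> ?L" and im: "(inv x \<circ> lam) ` {1..s} = (inv x \<circ> lam') ` {1..s}"
        have "x ` ((inv x \<circ> lam) ` {1..s}) = x ` ((inv x \<circ> lam') ` {1..s})" using im by simp
        then have im': "lam ` {1..s} = lam' ` {1..s}" by (simp add: image_image)
        have imX: "(X \<circ> lam) ` {1..s} = (X \<circ> lam') ` {1..s}"
          by (simp only: image_comp[symmetric] im')
        have "lam j = lam' j" if j: "j \<in> {1..s}" for j
        proof -
          have "(X \<circ> lam) j = (X \<circ> lam') j"
            using L by (intro strict_mono_on_same_image[OF _ _ imX j]) simp_all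
          moreover have "lam j \<in> {1..N}" "lam' j \<in> {1..N}" using L j by blast+
          ultimately show ?thesis using X by (simp add: inj_on_eq_iff)
        qed
        then show "lam = lam'" using L by (intro PiE_ext[of lam "{1..s}" "\<lambda>_. {1..N}"]) auto
      qed
    next
      fix A assume "A \<in> (\<lambda>lam. (inv x \<circ> lam) ` {1..s}) ` ?L"
      then obtain lam where lam: "lam \<in> {1..s} \<rightarrow>\<^sub>E {1..N}" and sx: "strict_mono_on {1..s} (X \<circ> lam)"
        and sy: "strict_mono_on {1..s} (Y \<circ> (lam \<circ> inv \<sigma>))" and A: "A = (inv x \<circ> lam) ` {1..s}" by blast
      have lam_in: "lam j \<in> {1..N}" if "j \<in> {1..s}" for j using lam that by blast
      have sa: "strict_mono_on {1..s} (inv x \<circ> lam)"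
      proof (rule strict_mono_onI)
        fix i j assume ij: "i \<in> {1..s}" "j \<in> {1..s}" "i < j"
        show "(inv x \<circ> lam) i < (inv x \<circ> lam) j"
          using strict_mono_onD[OF sx ij] X_less[OF lam_in[OF ij(1)] lam_in[OF ij(2)]] by simp
      qed
      have "p ((inv x \<circ> lam) i) < p ((inv x \<circ> lam) j) \<longleftrightarrow> \<sigma> i < \<sigma> j"
        if "i \<in> {1..s}" "j \<in> {1..s}" for i j
        using strict_mono_on_less[OF sy \<sigma>_in(1)[OF that(1)] \<sigma>_in(1)[OF that(2)]]
          Y_less[OF lam_in[OF that(1)] lam_in[OF that(2)]] by (simp add: p_def \<sigma>_inv)
      then have "induces (N, p) A (s, \<sigma>)"
        unfolding induces_def using sa A by (intro exI[of _ "inv x \<circ> lam"]) simp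
      moreover have "A \<subseteq> {1..N}" using A lam_in x_in by (auto simp del: atLeastAtMost_iff)
      moreover have "card A = s" using A card_image[OF strict_mono_on_imp_inj_on[OF sa]] by simp
      ultimately show "A \<in> ?A" by blast
    next
      fix A assume "A \<in> ?A"
      then obtain a where AN: "A \<subseteq> {1..N}" and sa: "strict_mono_on {1..s} a" and A: "a ` {1..s} = A"
        and ord: "\<And>i j. i \<in> {1..s} \<Longrightarrow> j \<in> {1..s} \<Longrightarrow> p (a i) < p (a j) \<longleftrightarrow> \<sigma> i < \<sigma> j"
        by (auto simp: induces_def simp del: atLeastAtMost_iff)
      have xa: "x (a j) \<in> {1..N}" if "j \<in> {1..s}" for j using A AN x_in that by blast
      define lam where "lam = restrict (x \<circ> a) {1..s}"
      have lam: "lam j = x (a j)" if "j \<in> {1..s}" for j using that by (simp add: lam_def del: atLeastAtMost_iff)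
      have "lam \<in> {1..s} \<rightarrow>\<^sub>E {1..N}" using xa by (auto simp: lam_def simp del: atLeastAtMost_iff)
      moreover have "strict_mono_on {1..s} (X \<circ> lam)"
      proof (rule strict_mono_onI)
        fix i j assume ij: "i \<in> {1..s}" "j \<in> {1..s}" "i < j"
        show "(X \<circ> lam) i < (X \<circ> lam) j"
          using strict_mono_onD[OF sa ij] X_less[OF xa[OF ij(1)] xa[OF ij(2)]] lam ij by simp
      qed
      moreover have "strict_mono_on {1..s} (Y \<circ> (lam \<circ> inv \<sigma>))"
      proof (rule strict_mono_onI)
        fix i j assume ij: "i \<in> {1..s}" "j \<in> {1..s}" "i < j"
        note ij' = \<sigma>_in(2)[OF ij(1)] \<sigma>_in(2)[OF ij(2)]
        show "(Y \<circ> (lam \<circ> inv \<sigma>)) i < (Y \<circ> (lam \<circ> inv \<sigma>)) j"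
          using ord[OF ij'] ij(3) Y_less[OF xa[OF ij'(1)] xa[OF ij'(2)]] lam[OF ij'(1)] lam[OF ij'(2)]
          by (simp add: p_def \<sigma>_inv)
      qed
      moreover have "(inv x \<circ> lam) ` {1..s} = A"
        unfolding A[symmetric] by (intro image_cong refl) (simp add: lam del: atLeastAtMost_iff)
      ultimately show "A \<in> (\<lambda>lam. (inv x \<circ> lam) ` {1..s}) ` ?L" by blast
    qed
    then show ?thesis by (rule bij_betw_same_card[symmetric])
  qed
  with p show ?thesis by blast
qed

lemma num_inj_eq_choose:
  assumes "s \<le> N"
  shows "num_inj s N = real (N choose s) * fact s"
proof -
  have "real (N choose s) = (\<Prod>i=0..<s. real N - real i) / fact s"
    by (simp add: binomial_gbinomial gbinomial_prod_rev)
  moreover have "(\<Prod>i=0..<s. real N - real i) = num_inj s N"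
    unfolding num_inj_def using assms by (intro prod.cong) (auto simp: of_nat_diff)
  ultimately show ?thesis by simp
qed

theorem permutations_with_densities:
  assumes S: "finite S" "\<And>\<sigma>. \<sigma> \<in> S \<Longrightarrow> is_perm \<sigma>"
    and P0: "\<And>z. z \<in> cells n \<Longrightarrow> case_prod P z \<ge> 0" and P1: "(\<Sum>z\<in>cells n. case_prod P z) = 1"
  shows "\<exists>p. (\<forall>m. is_perm (p m)) \<and> filterlim (\<lambda>m. fst (p m)) at_top sequentially \<and>
    (\<forall>\<sigma>\<in>S. (\<lambda>m. pattern_density \<sigma> (p m)) \<longlonglongrightarrow> fact (fst \<sigma>) * pattern_weight n P (fst \<sigma>) (snd \<sigma>))"
proof -
  obtain c \<tau> \<rho> where valid: "\<And>N. c N \<in> {1..N} \<rightarrow>\<^sub>E cells n \<and> \<tau> N permutes {1..N} \<and> \<rho> N permutes {1..N}"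
    and lim: "\<forall>(s, \<sigma>)\<in>S. (\<lambda>N. occurrences N s \<sigma> (c N) (\<tau> N) (\<rho> N) / real N ^ s) \<longlonglongrightarrow> pattern_weight n P s \<sigma>"
    using sampling_exists[OF S(1) _ P0 P1] S(2) unfolding is_perm_def by fastforce
  let ?X = "\<lambda>N. key N (fst \<circ> c N) (\<tau> N)" and ?Y = "\<lambda>N. key N (snd \<circ> c N) (\<rho> N)"
  have "\<forall>N. \<exists>p. p permutes {1..N} \<and> (\<forall>s \<sigma>. \<sigma> permutes {1..s} \<longrightarrow>
    card {A. A \<subseteq> {1..N} \<and> card A = s \<and> induces (N, p) A (s, \<sigma>)} =
    card {lam \<in> {1..s} \<rightarrow>\<^sub>E {1..N}. strict_mono_on {1..s} (?X N \<circ> lam) \<and> strict_mono_on {1..s} (?Y N \<circ> (lam \<circ> inv \<sigma>))})"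
    using valid by (intro allI permutation_of_keys inj_on_key) auto
  from choice[OF this] obtain p where p: "\<And>N. p N permutes {1..N}"
    and count: "\<And>N s \<sigma>. \<sigma> permutes {1..s} \<Longrightarrow>
      card {A. A \<subseteq> {1..N} \<and> card A = s \<and> induces (N, p N) A (s, \<sigma>)} =
      card {lam \<in> {1..s} \<rightarrow>\<^sub>E {1..N}. strict_mono_on {1..s} (?X N \<circ> lam) \<and> strict_mono_on {1..s} (?Y N \<circ> (lam \<circ> inv \<sigma>))}"
    by blast
  have dens: "pattern_density (s, \<sigma>) (N, p N) = occurrences N s \<sigma> (c N) (\<tau> N) (\<rho> N) / real (N choose s)"
    if "\<sigma> permutes {1..s}" for s \<sigma> N
  proof -
    have fin: "finite ({1..s} \<rightarrow>\<^sub>E {1..N})" by (auto intro: finite_PiE)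
    have "occurrences N s \<sigma> (c N) (\<tau> N) (\<rho> N) =
       (\<Sum>lam\<in>{1..s} \<rightarrow>\<^sub>E {1..N}. if sorted_pattern N s \<sigma> lam (c N) (\<tau> N) (\<rho> N) then 1 else 0)"
      unfolding occurrences_def by (intro sum.cong) auto
    also have "\<dots> = real (card {lam \<in> {1..s} \<rightarrow>\<^sub>E {1..N}. sorted_pattern N s \<sigma> lam (c N) (\<tau> N) (\<rho> N)})"
      using sum.inter_filter[OF fin, of "\<lambda>_. 1::real" "\<lambda>lam. sorted_pattern N s \<sigma> lam (c N) (\<tau> N) (\<rho> N)"] by simp
    finally show ?thesis
      using count[OF that, of N] n_subsets[of "{1..N}" s]
      unfolding pattern_density_def sorted_pattern_def by simp
  qed
  have "(\<lambda>N. pattern_density (s, \<sigma>) (N, p N)) \<longlonglongrightarrow> fact s * pattern_weight n P s \<sigma>" if "(s, \<sigma>) \<in> S" for s \<sigma>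
  proof -
    have \<sigma>: "\<sigma> permutes {1..s}" using S(2)[OF that] by (simp add: is_perm_def)
    have 1: "(\<lambda>N. occurrences N s \<sigma> (c N) (\<tau> N) (\<rho> N) / real N ^ s) \<longlonglongrightarrow> pattern_weight n P s \<sigma>"
      using lim that by auto
    have 2: "(\<lambda>N. num_inj s N / real N ^ s) \<longlonglongrightarrow> 1" using num_inj_asymptotic[where k = 0] by simp
    \<comment> \<open>\<open>num_inj s N\<close> is s! times the binomial coefficient in the
      density; replacing \<open>real N ^ s\<close> by that coefficient produces the factor
      s!.\<close>
    have "(\<lambda>N. fact s * (occurrences N s \<sigma> (c N) (\<tau> N) (\<rho> N) / real N ^ s) / (num_inj s N / real N ^ s))
        \<longlonglongrightarrow> fact s * pattern_weight n P s \<sigma> / 1"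
      by (intro tendsto_divide tendsto_mult tendsto_const 1 2) simp
    moreover have "\<forall>\<^sub>F N in sequentially. fact s * (occurrences N s \<sigma> (c N) (\<tau> N) (\<rho> N) / real N ^ s) / (num_inj s N / real N ^ s)
       = pattern_density (s, \<sigma>) (N, p N)"
      using eventually_ge_at_top[of "s + 1"]
    proof eventually_elim
      case (elim N)
      then have "num_inj s N = real (N choose s) * fact s" by (intro num_inj_eq_choose) simp
      then show ?case using elim by (simp add: dens[OF \<sigma>])
    qed
    ultimately show ?thesis by (simp add: tendsto_cong)
  qed
  then have "\<forall>\<sigma>\<in>S. (\<lambda>m. pattern_density \<sigma> (m, p m)) \<longlonglongrightarrow> fact (fst \<sigma>) * pattern_weight n P (fst \<sigma>) (snd \<sigma>)"
    by auto
  then show ?thesis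
    using p by (intro exI[of _ "\<lambda>m. (m, p m)"]) (simp add: is_perm_def filterlim_ident)
qed

section \<open>Pattern weights determine the uniform permuton\<close>

lemma sample_mean_cong:
  assumes "\<And>c \<tau> \<rho>. c \<in> {1..N} \<rightarrow>\<^sub>E cells n \<Longrightarrow> \<tau> permutes {1..N} \<Longrightarrow> \<rho> permutes {1..N} \<Longrightarrow> \<phi> c \<tau> \<rho> = \<psi> c \<tau> \<rho>"
  shows "sample_mean N n P \<phi> = sample_mean N n P \<psi>"
  unfolding sample_mean_def
  by (intro arg_cong2[of _ _ _ _ "(/)"] sum.cong refl arg_cong2[of _ _ _ _ "(*)"]) (auto simp: assms)

text \<open>Conditioning on the complete order \<kappa> of all N points: \<open>inv \<kappa>\<close>
  gives their ranks, and these decide whether the shorter list u is sorted.\<close>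

lemma of_bool_sorted_sum:
  assumes \<tau>: "\<tau> permutes {1..N}" and u: "u ` {1..p} \<subseteq> {1..N}"
  shows "of_bool (strict_mono_on {1..p} (key N a \<tau> \<circ> u)) =
    (\<Sum>\<kappa> | \<kappa> permutes {1..N}. of_bool (strict_mono_on {1..p} (inv \<kappa> \<circ> u)) *
       of_bool (strict_mono_on {1..N} (key N a \<tau> \<circ> \<kappa>)) :: real)"
proof -
  let ?B = "of_bool (strict_mono_on {1..p} (key N a \<tau> \<circ> u)) :: real"
  have "of_bool (strict_mono_on {1..p} (inv \<kappa> \<circ> u)) * of_bool (strict_mono_on {1..N} (key N a \<tau> \<circ> \<kappa>)) =
     ?B * of_bool (strict_mono_on {1..N} (key N a \<tau> \<circ> \<kappa>))" if \<kappa>: "\<kappa> permutes {1..N}" for \<kappa>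
  proof (cases "strict_mono_on {1..N} (key N a \<tau> \<circ> \<kappa>)")
    case True
    have less: "key N a \<tau> (u i) < key N a \<tau> (u j) \<longleftrightarrow> inv \<kappa> (u i) < inv \<kappa> (u j)"
      if "i \<in> {1..p}" "j \<in> {1..p}" for i j
    proof -
      have "inv \<kappa> (u i) \<in> {1..N}" "inv \<kappa> (u j) \<in> {1..N}"
        using that u permutes_in_image[OF permutes_inv[OF \<kappa>]] by blast+
      from strict_mono_on_less[OF True this] show ?thesis using permutes_inverses[OF \<kappa>] by simp
    qed
    have "strict_mono_on {1..p} (inv \<kappa> \<circ> u) \<longleftrightarrow> strict_mono_on {1..p} (key N a \<tau> \<circ> u)"
      unfolding strict_mono_on_def using less by (auto simp del: atLeastAtMost_iff)
    then show ?thesis by simp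
  qed simp
  then have "(\<Sum>\<kappa> | \<kappa> permutes {1..N}. of_bool (strict_mono_on {1..p} (inv \<kappa> \<circ> u)) *
       of_bool (strict_mono_on {1..N} (key N a \<tau> \<circ> \<kappa>))) =
     (\<Sum>\<kappa> | \<kappa> permutes {1..N}. ?B * of_bool (strict_mono_on {1..N} (key N a \<tau> \<circ> \<kappa>)))"
    by (intro sum.cong) auto
  also have "\<dots> = ?B" unfolding sum_distrib_left[symmetric] sum_sorting_permutations[OF \<tau>] by simp
  finally show ?thesis by simp
qed

text \<open>If \<kappa> lists all points from left to right and \<mu> from bottom to top, they form
  the pattern \<open>inv \<mu> \<circ> \<kappa>\<close>. The joint law of the two orders is thus a
  function of the pattern weights alone.\<close>

lemma sample_mean_chains_from_weights:
  assumes P1: "(\<Sum>z\<in>cells n. case_prod P z) = 1"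
    and u: "u ` {1..p} \<subseteq> {1..N}" and v: "v ` {1..r} \<subseteq> {1..N}"
  shows "sample_mean N n P (\<lambda>c \<tau> \<rho>. of_bool (strict_mono_on {1..p} (key N (fst \<circ> c) \<tau> \<circ> u)) *
      of_bool (strict_mono_on {1..r} (key N (snd \<circ> c) \<rho> \<circ> v))) =
    (\<Sum>\<kappa> | \<kappa> permutes {1..N}. \<Sum>\<mu> | \<mu> permutes {1..N}.
      of_bool (strict_mono_on {1..p} (inv \<kappa> \<circ> u)) * of_bool (strict_mono_on {1..r} (inv \<mu> \<circ> v)) *
      pattern_weight n P N (inv \<mu> \<circ> \<kappa>))" (is "sample_mean N n P ?\<phi> = _")
proof -
  let ?b = "\<lambda>\<kappa> \<mu>. of_bool (strict_mono_on {1..p} (inv \<kappa> \<circ> u)) * of_bool (strict_mono_on {1..r} (inv \<mu> \<circ> v)) :: real"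
  have "sample_mean N n P ?\<phi> = sample_mean N n P (\<lambda>c \<tau> \<rho>. \<Sum>\<kappa> | \<kappa> permutes {1..N}. \<Sum>\<mu> | \<mu> permutes {1..N}.
      ?b \<kappa> \<mu> * of_bool (sorted_pattern N N (inv \<mu> \<circ> \<kappa>) \<kappa> c \<tau> \<rho>))"
  proof (rule sample_mean_cong)
    fix c \<tau> \<rho> assume \<tau>: "\<tau> permutes {1..N}" and \<rho>: "\<rho> permutes {1..N}"
    \<comment> \<open>For \<sigma> = \<open>inv \<mu> \<circ> \<kappa>\<close> the bottom-to-top
      list \<open>\<kappa> \<circ> inv \<sigma>\<close> in \<open>sorted_pattern\<close> is \<mu>
      itself.\<close>
    have "\<kappa> \<circ> inv (inv \<mu> \<circ> \<kappa>) = \<mu>" if "\<kappa> permutes {1..N}" "\<mu> permutes {1..N}" for \<kappa> \<mu>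
    proof -
      have "inv (inv \<mu> \<circ> \<kappa>) = inv \<kappa> \<circ> \<mu>"
        using o_inv_distrib[OF permutes_bij[OF permutes_inv[OF that(2)]] permutes_bij[OF that(1)]]
          permutes_inv_inv[OF that(2)] by simp
      then show ?thesis
        by (simp only: o_assoc permutes_inv_o(1)[OF that(1)] id_o)
    qed
    then show "?\<phi> c \<tau> \<rho> = (\<Sum>\<kappa> | \<kappa> permutes {1..N}. \<Sum>\<mu> | \<mu> permutes {1..N}.
      ?b \<kappa> \<mu> * of_bool (sorted_pattern N N (inv \<mu> \<circ> \<kappa>) \<kappa> c \<tau> \<rho>))"
      unfolding of_bool_sorted_sum[OF \<tau> u] of_bool_sorted_sum[OF \<rho> v] sum_product sorted_pattern_def
      by (intro sum.cong refl) (simp add: of_bool_conj)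
  qed
  also have "\<dots> = (\<Sum>\<kappa> | \<kappa> permutes {1..N}. \<Sum>\<mu> | \<mu> permutes {1..N}. ?b \<kappa> \<mu> * pattern_weight n P N (inv \<mu> \<circ> \<kappa>))"
    unfolding sample_mean_sum sample_mean_cmult
  proof (intro sum.cong refl arg_cong2[of _ _ _ _ "(*)"])
    fix \<kappa> \<mu> assume "\<kappa> \<in> {\<kappa>. \<kappa> permutes {1..N}}" "\<mu> \<in> {\<mu>. \<mu> permutes {1..N}}"
    then have \<kappa>: "\<kappa> permutes {1..N}" and \<mu>: "\<mu> permutes {1..N}" by auto
    have \<sigma>: "inv \<mu> \<circ> \<kappa> permutes {1..N}" using \<kappa> \<mu> by (intro permutes_compose permutes_inv)
    have "sample_mean N n P (\<lambda>c \<tau> \<rho>. of_bool (sorted_pattern N N (inv \<mu> \<circ> \<kappa>) \<kappa> c \<tau> \<rho>) * 1) =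
       pattern_weight n P N (inv \<mu> \<circ> \<kappa>) * sample_mean N n P (\<lambda>_ _ _. 1)"
      using permutes_image[OF \<kappa>] permutes_inj_on[OF \<kappa>]
      by (intro sample_mean_sorted_pattern[OF \<sigma> P1]) auto
    then show "sample_mean N n P (\<lambda>c \<tau> \<rho>. of_bool (sorted_pattern N N (inv \<mu> \<circ> \<kappa>) \<kappa> c \<tau> \<rho>)) =
       pattern_weight n P N (inv \<mu> \<circ> \<kappa>)"
      by (simp add: sample_mean_one[OF P1])
  qed
  finally show ?thesis .
qed

text \<open>At most one non-decreasing f matches h. Summing over f replaces monotonicity by
  conditions on single points, which factorise.\<close>

lemma sum_matching_nondec:
  assumes h: "\<And>j. j \<in> {1..s} \<Longrightarrow> h j \<in> {1..n}"
  shows "(\<Sum>f\<in>nondec_funs s n. of_bool (\<forall>j\<in>{1..s}. h j = f j) / block_fact s n f) =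
    of_bool (mono_on {1..s} h) / block_fact s n h"
proof (cases "mono_on {1..s} h")
  case True
  define f0 where "f0 = restrict h {1..s}"
  have f0_eq: "f0 j = h j" if "j \<in> {1..s}" for j using that by (simp add: f0_def del: atLeastAtMost_iff)
  have "mono_on {1..s} f0" using True by (simp add: mono_on_def f0_eq del: atLeastAtMost_iff)
  then have f0: "f0 \<in> nondec_funs s n"
    using h by (auto simp: nondec_funs_def f0_def simp del: atLeastAtMost_iff)
  have "(\<Sum>f\<in>nondec_funs s n. of_bool (\<forall>j\<in>{1..s}. h j = f j) / block_fact s n f) =
     (\<Sum>f\<in>nondec_funs s n. if f = f0 then 1 / block_fact s n f else 0)"
  proof (intro sum.cong refl)
    fix f assume "f \<in> nondec_funs s n"
    then have f: "f \<in> {1..s} \<rightarrow>\<^sub>E {1..n}" by (simp add: nondec_funs_def)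
    have "(\<forall>j\<in>{1..s}. h j = f j) \<longleftrightarrow> f = f0"
    proof
      assume *: "\<forall>j\<in>{1..s}. h j = f j"
      have "f j = f0 j" for j
        using * f0_eq[of j] PiE_arb[OF f, of j] by (cases "j \<in> {1..s}") (auto simp: f0_def)
      then show "f = f0" by blast
    qed (use f0_eq in auto)
    then show "of_bool (\<forall>j\<in>{1..s}. h j = f j) / block_fact s n f = (if f = f0 then 1 / block_fact s n f else 0)"
      by simp
  qed
  also have "\<dots> = 1 / block_fact s n f0" using f0 finite_nondec_funs by simp
  also have "block_fact s n f0 = block_fact s n h" by (intro block_fact_cong f0_eq)
  finally show ?thesis using True by simp
next
  case False
  have "\<not> (\<forall>j\<in>{1..s}. h j = f j)" if "f \<in> nondec_funs s n" for f
  proof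
    assume *: "\<forall>j\<in>{1..s}. h j = f j"
    have "mono_on {1..s} f" using that by (simp add: nondec_funs_def)
    then have "mono_on {1..s} h" using * by (simp add: mono_on_def del: atLeastAtMost_iff)
    with False show False by simp
  qed
  then show ?thesis using False by (simp add: sum.neutral)
qed

text \<open>
  Up to a factor, the probability that \<open>p + 1\<close> points are sorted from left to right and \<open>r + 1\<close> points from
  bottom to top, where the two lists share exactly their last point.
\<close>

definition chain_sum :: "nat \<Rightarrow> (nat \<Rightarrow> nat \<Rightarrow> real) \<Rightarrow> nat \<Rightarrow> nat \<Rightarrow> real" where
  "chain_sum n P p r = (\<Sum>f\<in>nondec_funs (Suc p) n. \<Sum>g\<in>nondec_funs (Suc r) n.
     P (f (Suc p)) (g (Suc r)) / (block_fact (Suc p) n f * block_fact (Suc r) n g))"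

text \<open>Points up to p are tested only horizontally and points beyond \<open>Suc p\<close> only
  vertically; for fixed f and g the uniform marginals make each contribute 1/n. Only the point
  \<open>Suc p\<close>, last in both lists, sees an individual entry of P.\<close>

lemma sample_mean_chains:
  fixes p r :: nat
  assumes row: "\<And>a. a \<in> {1..n} \<Longrightarrow> (\<Sum>b=1..n. P a b) = 1 / real n"
    and col: "\<And>b. b \<in> {1..n} \<Longrightarrow> (\<Sum>a=1..n. P a b) = 1 / real n"
  defines "N \<equiv> Suc (p + r)"
    and "v \<equiv> \<lambda>j. if j = Suc r then Suc p else Suc p + j"
  shows "sample_mean N n P (\<lambda>c \<tau> \<rho>. of_bool (strict_mono_on {1..Suc p} (key N (fst \<circ> c) \<tau> \<circ> (\<lambda>i. i))) *
      of_bool (strict_mono_on {1..Suc r} (key N (snd \<circ> c) \<rho> \<circ> v))) =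
    (1 / real n) ^ (p + r) * chain_sum n P p r" (is "sample_mean N n P ?\<phi> = _")
proof -
  \<comment> \<open>Inverse of v on \<open>{Suc p..N}\<close>: the place of a point in the vertical
    list.\<close>
  define w where "w = (\<lambda>i. if i = Suc p then Suc r else i - Suc p)"
  have v_in: "v j \<in> {Suc p..N}" if "j \<in> {1..Suc r}" for j using that by (auto simp: v_def N_def)
  have w_in: "w i \<in> {1..Suc r}" if "i \<in> {Suc p..N}" for i using that by (auto simp: w_def N_def)
  have vw: "v (w i) = i" if "i \<in> {Suc p..N}" for i using that by (auto simp: v_def w_def N_def)
  have wv: "w (v j) = j" if "j \<in> {1..Suc r}" for j using that by (auto simp: v_def w_def)
  have v_inj: "inj_on v {1..Suc r}" using wv by (metis inj_on_inverseI)
  have v_im: "v ` {1..Suc r} \<subseteq> {1..N}" using v_in by (force simp: N_def)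
  let ?mx = "\<lambda>c f. \<forall>j\<in>{1..Suc p}. (fst \<circ> c) j = f j"
  let ?my = "\<lambda>c g. \<forall>j\<in>{1..Suc r}. ((snd \<circ> c) \<circ> v) j = g j"
  let ?F = "nondec_funs (Suc p) n" and ?G = "nondec_funs (Suc r) n"
  have inner: "(\<Sum>\<tau> | \<tau> permutes {1..N}. \<Sum>\<rho> | \<rho> permutes {1..N}. ?\<phi> c \<tau> \<rho>) =
     (\<Sum>f\<in>?F. \<Sum>g\<in>?G. of_bool (?mx c f) / block_fact (Suc p) n f * (of_bool (?my c g) / block_fact (Suc r) n g)) * (fact N)\<^sup>2"
    if c: "c \<in> {1..N} \<rightarrow>\<^sub>E cells n" for c
  proof -
    have cell: "(fst \<circ> c) i \<in> {1..n}" "(snd \<circ> c) i \<in> {1..n}" if "i \<in> {1..N}" for i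
      using PiE_mem[OF c that] by (auto simp: cells_def)
    have sx: "(\<Sum>\<tau> | \<tau> permutes {1..N}. of_bool (strict_mono_on {1..Suc p} (key N (fst \<circ> c) \<tau> \<circ> (\<lambda>i. i))) * 1) =
       of_bool (mono_on {1..Suc p} ((fst \<circ> c) \<circ> (\<lambda>i. i))) / block_fact (Suc p) n ((fst \<circ> c) \<circ> (\<lambda>i. i)) * (\<Sum>\<tau> | \<tau> permutes {1..N}. 1)"
    proof (rule sum_key_sorted)
      show "(fst \<circ> c) j \<in> {1..n}" if "j \<in> {1..Suc p}" for j
        by (rule cell) (use that in \<open>auto simp: N_def\<close>)
    qed (auto simp: N_def inj_on_def)
    have sy: "(\<Sum>\<rho> | \<rho> permutes {1..N}. of_bool (strict_mono_on {1..Suc r} (key N (snd \<circ> c) \<rho> \<circ> v)) * 1) =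
       of_bool (mono_on {1..Suc r} ((snd \<circ> c) \<circ> v)) / block_fact (Suc r) n ((snd \<circ> c) \<circ> v) * (\<Sum>\<rho> | \<rho> permutes {1..N}. 1)"
    proof (rule sum_key_sorted[OF v_inj v_im])
      show "(snd \<circ> c) (v j) \<in> {1..n}" if "j \<in> {1..Suc r}" for j
        by (rule cell) (use v_im that in blast)
    qed simp
    have mx: "(\<Sum>f\<in>?F. of_bool (?mx c f) / block_fact (Suc p) n f) =
       of_bool (mono_on {1..Suc p} ((fst \<circ> c) \<circ> (\<lambda>i. i))) / block_fact (Suc p) n ((fst \<circ> c) \<circ> (\<lambda>i. i))"
      using cell by (subst sum_matching_nondec) (auto simp: N_def comp_def)
    have my: "(\<Sum>g\<in>?G. of_bool (?my c g) / block_fact (Suc r) n g) =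
       of_bool (mono_on {1..Suc r} ((snd \<circ> c) \<circ> v)) / block_fact (Suc r) n ((snd \<circ> c) \<circ> v)"
    proof (rule sum_matching_nondec)
      show "((snd \<circ> c) \<circ> v) j \<in> {1..n}" if "j \<in> {1..Suc r}" for j
        unfolding comp_apply[of _ v] by (rule cell) (use v_im that in blast)
    qed
    have card: "(\<Sum>\<tau> | \<tau> permutes {1..N}. 1) = (fact N :: real)" by (simp add: card_permutations)
    have "(\<Sum>\<tau> | \<tau> permutes {1..N}. \<Sum>\<rho> | \<rho> permutes {1..N}. ?\<phi> c \<tau> \<rho>) =
       (\<Sum>\<tau> | \<tau> permutes {1..N}. of_bool (strict_mono_on {1..Suc p} (key N (fst \<circ> c) \<tau> \<circ> (\<lambda>i. i))) * 1) *
       (\<Sum>\<rho> | \<rho> permutes {1..N}. of_bool (strict_mono_on {1..Suc r} (key N (snd \<circ> c) \<rho> \<circ> v)) * 1)"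
      unfolding sum_product mult_1_right ..
    also have "\<dots> = (\<Sum>f\<in>?F. of_bool (?mx c f) / block_fact (Suc p) n f) * fact N * ((\<Sum>g\<in>?G. of_bool (?my c g) / block_fact (Suc r) n g) * fact N)"
      unfolding sx sy mx my card ..
    also have "\<dots> = (\<Sum>f\<in>?F. of_bool (?mx c f) / block_fact (Suc p) n f) * (\<Sum>g\<in>?G. of_bool (?my c g) / block_fact (Suc r) n g) * (fact N)\<^sup>2"
      by (simp only: power2_eq_square mult_ac)
    finally show ?thesis unfolding sum_product .
  qed
  have match: "(\<Sum>c\<in>{1..N} \<rightarrow>\<^sub>E cells n. (\<Prod>i=1..N. case_prod P (c i)) * (of_bool (?mx c f) * of_bool (?my c g))) =
     (1 / real n) ^ (p + r) * P (f (Suc p)) (g (Suc r))" if f: "f \<in> ?F" and g: "g \<in> ?G" for f g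
  proof -
    have f_in: "f j \<in> {1..n}" if "j \<in> {1..Suc p}" for j using f that by (auto simp: nondec_funs_def)
    have g_in: "g j \<in> {1..n}" if "j \<in> {1..Suc r}" for j using g that by (auto simp: nondec_funs_def)
    \<comment> \<open>The cells that f and g leave to point i: a column before \<open>Suc p\<close>,
      a row after it, one cell at \<open>Suc p\<close>. The constrained sum runs over a product set
      and factorises.\<close>
    define C where "C = (\<lambda>i. {z \<in> cells n. (i \<le> Suc p \<longrightarrow> fst z = f i) \<and> (Suc p \<le> i \<longrightarrow> snd z = g (w i))})"
    have mem: "c \<in> Pi\<^sub>E {1..N} C \<longleftrightarrow> ?mx c f \<and> ?my c g" if c: "c \<in> {1..N} \<rightarrow>\<^sub>E cells n" for c
    proof
      assume "c \<in> Pi\<^sub>E {1..N} C"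
      then have cC: "c i \<in> C i" if "i \<in> {1..N}" for i using that by blast
      have "(fst \<circ> c) j = f j" if "j \<in> {1..Suc p}" for j
        using cC[of j] that by (auto simp: C_def N_def)
      moreover have "((snd \<circ> c) \<circ> v) j = g j" if "j \<in> {1..Suc r}" for j
        using cC[of "v j"] v_in[OF that] wv[OF that] by (auto simp: C_def)
      ultimately show "?mx c f \<and> ?my c g" by blast
    next
      assume m: "?mx c f \<and> ?my c g"
      show "c \<in> Pi\<^sub>E {1..N} C"
      proof (rule PiE_I)
        fix i assume i: "i \<in> {1..N}"
        have "snd (c i) = g (w i)" if "Suc p \<le> i"
        proof -
          have "i \<in> {Suc p..N}" using i that by auto
          then show ?thesis using m w_in[of i] vw[of i] by (metis comp_apply)
        qed
        then show "c i \<in> C i" using PiE_mem[OF c i] m i by (auto simp: C_def)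
      qed (rule PiE_arb[OF c])
    qed
    have sub: "Pi\<^sub>E {1..N} C \<subseteq> {1..N} \<rightarrow>\<^sub>E cells n" by (intro PiE_mono) (auto simp: C_def)
    have fin: "finite ({1..N} \<rightarrow>\<^sub>E cells n)" by (auto intro: finite_PiE finite_cells)
    have "(\<Sum>c\<in>{1..N} \<rightarrow>\<^sub>E cells n. (\<Prod>i=1..N. case_prod P (c i)) * (of_bool (?mx c f) * of_bool (?my c g))) =
       (\<Sum>c\<in>{1..N} \<rightarrow>\<^sub>E cells n. if c \<in> Pi\<^sub>E {1..N} C then \<Prod>i=1..N. case_prod P (c i) else 0)"
      using mem by (intro sum.cong refl) (simp add: of_bool_conj[symmetric])
    also have "\<dots> = (\<Sum>c\<in>Pi\<^sub>E {1..N} C. \<Prod>i=1..N. case_prod P (c i))"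
      using sub fin by (simp add: sum.inter_restrict[symmetric] Int_absorb1)
    also have "\<dots> = (\<Prod>i=1..N. \<Sum>z\<in>C i. case_prod P z)"
      by (rule prod_sum_PiE[symmetric]) (auto simp: C_def finite_cells)
    also have "\<dots> = (\<Sum>z\<in>C (Suc p). case_prod P z) * (\<Prod>i\<in>{1..N} - {Suc p}. \<Sum>z\<in>C i. case_prod P z)"
      by (rule prod.remove) (auto simp: N_def)
    also have "(\<Prod>i\<in>{1..N} - {Suc p}. \<Sum>z\<in>C i. case_prod P z) = (\<Prod>i\<in>{1..N} - {Suc p}. 1 / real n)"
    proof (rule prod.cong[OF refl])
      fix i assume i: "i \<in> {1..N} - {Suc p}"
      show "(\<Sum>z\<in>C i. case_prod P z) = 1 / real n"
      proof (cases "i \<le> Suc p")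
        case True
        then have fi: "f i \<in> {1..n}" using i by (intro f_in) auto
        have "C i = {f i} \<times> {1..n}" using True i fi by (auto simp: C_def cells_def)
        then show ?thesis using row[OF fi] by (simp add: sum.cartesian_product[symmetric])
      next
        case False
        then have gi: "g (w i) \<in> {1..n}" using i by (intro g_in w_in) auto
        have "C i = {1..n} \<times> {g (w i)}" using False i gi by (auto simp: C_def cells_def)
        then show ?thesis using col[OF gi] by (simp add: sum.cartesian_product[symmetric])
      qed
    qed
    also have "C (Suc p) = {(f (Suc p), g (Suc r))}"
      using f_in[of "Suc p"] g_in[of "Suc r"] by (auto simp: C_def cells_def w_def)
    finally show ?thesis by (simp add: N_def mult.commute)
  qed
  have "sample_mean N n P ?\<phi> = (\<Sum>c\<in>{1..N} \<rightarrow>\<^sub>E cells n. (\<Prod>i=1..N. case_prod P (c i)) *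
     ((\<Sum>f\<in>?F. \<Sum>g\<in>?G. of_bool (?mx c f) / block_fact (Suc p) n f * (of_bool (?my c g) / block_fact (Suc r) n g)) * (fact N)\<^sup>2)) / (fact N)\<^sup>2"
    unfolding sample_mean_def using inner
    by (intro arg_cong2[of _ _ _ _ "(/)"] sum.cong refl arg_cong2[of _ _ _ _ "(*)"])
  also have "\<dots> = (\<Sum>c\<in>{1..N} \<rightarrow>\<^sub>E cells n. (\<Prod>i=1..N. case_prod P (c i)) *
     (\<Sum>f\<in>?F. \<Sum>g\<in>?G. of_bool (?mx c f) / block_fact (Suc p) n f * (of_bool (?my c g) / block_fact (Suc r) n g)))"
    unfolding mult.assoc[symmetric] sum_distrib_right[symmetric] by simp
  also have "\<dots> = (\<Sum>c\<in>{1..N} \<rightarrow>\<^sub>E cells n. \<Sum>f\<in>?F. \<Sum>g\<in>?G.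
     (\<Prod>i=1..N. case_prod P (c i)) * (of_bool (?mx c f) * of_bool (?my c g)) / (block_fact (Suc p) n f * block_fact (Suc r) n g))"
    unfolding sum_distrib_left by (intro sum.cong refl) simp
  also have "\<dots> = (\<Sum>f\<in>?F. \<Sum>c\<in>{1..N} \<rightarrow>\<^sub>E cells n. \<Sum>g\<in>?G.
     (\<Prod>i=1..N. case_prod P (c i)) * (of_bool (?mx c f) * of_bool (?my c g)) / (block_fact (Suc p) n f * block_fact (Suc r) n g))"
    by (rule sum.swap)
  also have "\<dots> = (\<Sum>f\<in>?F. \<Sum>g\<in>?G. \<Sum>c\<in>{1..N} \<rightarrow>\<^sub>E cells n.
     (\<Prod>i=1..N. case_prod P (c i)) * (of_bool (?mx c f) * of_bool (?my c g)) / (block_fact (Suc p) n f * block_fact (Suc r) n g))"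
    by (intro sum.cong refl sum.swap)
  also have "\<dots> = (\<Sum>f\<in>?F. \<Sum>g\<in>?G. (1 / real n) ^ (p + r) * P (f (Suc p)) (g (Suc r)) / (block_fact (Suc p) n f * block_fact (Suc r) n g))"
    unfolding sum_divide_distrib[symmetric] using match
    by (intro sum.cong refl arg_cong2[of _ _ _ _ "(/)"])
  also have "\<dots> = (1 / real n) ^ (p + r) * chain_sum n P p r"
    unfolding chain_sum_def sum_distrib_left by simp
  finally show ?thesis .
qed

section \<open>Moments of step permutons\<close>

lemma pattern_weight_uniform:
  assumes "n > 0"
  shows "pattern_weight n (\<lambda>_ _. 1 / (real n)\<^sup>2) s \<sigma> = 1 / (fact s)\<^sup>2"
proof -
  have "pattern_weight n (\<lambda>_ _. 1 / (real n)\<^sup>2) s \<sigma> =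
      (1 / (real n)\<^sup>2) ^ s * ((\<Sum>f\<in>nondec_funs s n. 1 / block_fact s n f) * (\<Sum>f\<in>nondec_funs s n. 1 / block_fact s n f))"
    unfolding sum_product unfolding pattern_weight_def sum_distrib_left by simp
  then show ?thesis
    unfolding sum_inverse_block_fact using assms
    by (simp add: power2_eq_square power_mult_distrib power_divide)
qed

text \<open>Functions with last value at most a are those into {1..a}, of total weight
  \<open>real a ^ Suc p / fact (Suc p)\<close>; subtract the same for a - 1. The difference of
  powers is p + 1 times the integral of x^p over the column [a - 1, a].\<close>

lemma last_value_weight:
  assumes a: "a \<in> {1..n}"
  shows "(\<Sum>f\<in>{f \<in> nondec_funs (Suc p) n. f (Suc p) = a}. 1 / block_fact (Suc p) n f) =
    (real a ^ Suc p - real (a - 1) ^ Suc p) / fact (Suc p)"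
proof -
  let ?S = "{1..Suc p}"
  have below: "nondec_funs (Suc p) b = {f \<in> nondec_funs (Suc p) n. f (Suc p) \<le> b}" if "b \<le> n" for b
  proof (intro equalityI subsetI)
    fix f assume "f \<in> nondec_funs (Suc p) b"
    then have f: "f \<in> ?S \<rightarrow>\<^sub>E {1..b}" "mono_on ?S f" by (auto simp: nondec_funs_def)
    have "f \<in> ?S \<rightarrow>\<^sub>E {1..n}" using f(1) that by (intro PiE_mono[THEN subsetD, OF _ f(1)]) auto
    moreover have "f (Suc p) \<in> {1..b}" by (rule PiE_mem[OF f(1)]) simp
    ultimately show "f \<in> {f \<in> nondec_funs (Suc p) n. f (Suc p) \<le> b}"
      using f(2) by (simp add: nondec_funs_def)
  next
    fix f assume "f \<in> {f \<in> nondec_funs (Suc p) n. f (Suc p) \<le> b}"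
    then have f: "f \<in> ?S \<rightarrow>\<^sub>E {1..n}" "mono_on ?S f" "f (Suc p) \<le> b" by (auto simp: nondec_funs_def)
    have "f \<in> ?S \<rightarrow>\<^sub>E {1..b}"
    proof (rule PiE_I)
      fix j assume j: "j \<in> ?S"
      have "f j \<le> f (Suc p)" using mono_onD[OF f(2) j, of "Suc p"] j by simp
      then show "f j \<in> {1..b}" using PiE_mem[OF f(1) j] f(3) by simp
    qed (rule PiE_arb[OF f(1)])
    then show "f \<in> nondec_funs (Suc p) b" using f(2) by (simp add: nondec_funs_def)
  qed
  \<comment> \<open>Enlarging the range from b to n adds only factors 0! = 1, for values that f does
    not take.\<close>
  have bf: "block_fact (Suc p) n f = block_fact (Suc p) b f" if "b \<le> n" "f \<in> nondec_funs (Suc p) b" for b f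
  proof -
    have f: "f \<in> ?S \<rightarrow>\<^sub>E {1..b}" using that(2) by (simp add: nondec_funs_def)
    have one: "fact (card {j \<in> ?S. f j = i}) = (1 :: real)" if "i \<notin> {1..b}" for i
    proof -
      have "{j \<in> ?S. f j = i} = {}" using PiE_mem[OF f] that by blast
      then show ?thesis by (simp only: card.empty fact_0)
    qed
    show ?thesis
      unfolding block_fact_def
    proof (rule prod.mono_neutral_right)
      show "\<forall>i\<in>{1..n} - {1..b}. fact (card {j \<in> ?S. f j = i}) = (1 :: real)" using one by blast
    qed (use that(1) in auto)
  qed
  have total: "(\<Sum>f\<in>nondec_funs (Suc p) b. 1 / block_fact (Suc p) n f) = real b ^ Suc p / fact (Suc p)" if "b \<le> n" for b
    unfolding sum_inverse_block_fact[symmetric] using bf[OF that] by (intro sum.cong) auto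
  have le: "a \<le> n" "a - 1 \<le> n" using a by auto
  have "{f \<in> nondec_funs (Suc p) n. f (Suc p) = a} = nondec_funs (Suc p) a - nondec_funs (Suc p) (a - 1)"
    using a by (subst (1 2) below) auto
  moreover have "nondec_funs (Suc p) (a - 1) \<subseteq> nondec_funs (Suc p) a"
    using a by (subst (1 2) below) auto
  ultimately have "(\<Sum>f\<in>{f \<in> nondec_funs (Suc p) n. f (Suc p) = a}. 1 / block_fact (Suc p) n f) =
     real a ^ Suc p / fact (Suc p) - real (a - 1) ^ Suc p / fact (Suc p)"
    using total[OF le(1)] total[OF le(2)] finite_nondec_funs by (simp only: sum_diff)
  then show ?thesis by (simp add: diff_divide_distrib)
qed

text \<open>A step function with vanishing moments is zero: by linearity the powers may be replaced
  by any polynomial, in particular by one adapted to the largest index with a nonzero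
  coefficient.\<close>

lemma power_differences_separate:
  fixes v :: "nat \<Rightarrow> real"
  assumes v: "\<And>p. (\<Sum>a=1..n. v a * (real a ^ Suc p - real (a - 1) ^ Suc p)) = 0"
    and a: "a \<in> {1..n}"
  shows "v a = 0"
proof (rule ccontr)
  assume "v a \<noteq> 0"
  define A where "A = {a \<in> {1..n}. v a \<noteq> 0}"
  have A: "finite A" "A \<noteq> {}" using a \<open>v a \<noteq> 0\<close> by (auto simp: A_def)
  define m where "m = Max A"
  have m: "m \<in> {1..n}" "v m \<noteq> 0" using Max_in[OF A] by (auto simp: A_def m_def)
  have above: "v b = 0" if "b \<in> {1..n}" "m < b" for b
  proof (rule ccontr)
    assume "v b \<noteq> 0"
    then have "b \<le> m" unfolding m_def using that A by (intro Max_ge) (auto simp: A_def)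
    with that show False by simp
  qed
  \<comment> \<open>A polynomial vanishing at the nodes below \<open>m\<close> isolates the coefficient of \<open>m\<close>.\<close>
  define R where "R = (\<Prod>j\<in>{0..<m}. [:- real j, 1:])"
  have R: "poly R x = (\<Prod>j\<in>{0..<m}. x - real j)" for x by (simp add: R_def poly_prod)
  have R0: "poly R (real b) = 0" if "b < m" for b
    unfolding R using that by (intro prod_zero) auto
  have Rm: "poly R (real m) \<noteq> 0" unfolding R by auto
  \<comment> \<open>Exponent 0 is not covered by the hypothesis, but constants cancel in the
    differences, so R may have a constant coefficient.\<close>
  have "v b * (real b ^ i - real (b - 1) ^ i) = 0" if "i = 0" for b i using that by simp
  then have mom: "(\<Sum>b=1..n. v b * (real b ^ i - real (b - 1) ^ i)) = 0" for i
    using v by (cases i) (auto intro: sum.neutral)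
  have "(\<Sum>b=1..n. v b * (poly R (real b) - poly R (real (b - 1)))) =
     (\<Sum>b=1..n. \<Sum>i\<le>degree R. coeff R i * (v b * (real b ^ i - real (b - 1) ^ i)))"
    unfolding poly_altdef sum_subtractf[symmetric] sum_distrib_left
    by (intro sum.cong refl) (simp add: algebra_simps)
  also have "\<dots> = (\<Sum>i\<le>degree R. coeff R i * (\<Sum>b=1..n. v b * (real b ^ i - real (b - 1) ^ i)))"
    unfolding sum_distrib_left by (rule sum.swap)
  also have "\<dots> = 0" unfolding mom by simp
  finally have "(\<Sum>b=1..n. v b * (poly R (real b) - poly R (real (b - 1)))) = 0" .
  moreover have "(\<Sum>b=1..n. v b * (poly R (real b) - poly R (real (b - 1)))) = (\<Sum>b=1..n. if b = m then v m * poly R (real m) else 0)"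
  proof (intro sum.cong refl)
    fix b assume b: "b \<in> {1..n}"
    show "v b * (poly R (real b) - poly R (real (b - 1))) = (if b = m then v m * poly R (real m) else 0)"
    proof (cases b m rule: linorder_cases)
      case less
      then show ?thesis using R0[of b] R0[of "b - 1"] by simp
    next
      case equal
      then show ?thesis using R0[of "b - 1"] b by simp
    next
      case greater
      then show ?thesis using above[OF b] by simp
    qed
  qed
  ultimately show False using m Rm by simp
qed

text \<open>Grouping by last values exhibits a mixed moment: up to the factor 1/(p! r!) this is the
  sum of P a b times the integral of x^p y^r over the cell [a - 1, a] \<times> [b - 1, b].\<close>

lemma chain_sum_eq:
  "chain_sum n P p r = (\<Sum>a=1..n. \<Sum>b=1..n. P a b *
     ((real a ^ Suc p - real (a - 1) ^ Suc p) / fact (Suc p)) * ((real b ^ Suc r - real (b - 1) ^ Suc r) / fact (Suc r)))"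
proof -
  have group: "(\<Sum>f\<in>nondec_funs (Suc p) n. \<psi> (f (Suc p)) / block_fact (Suc p) n f) =
     (\<Sum>a=1..n. \<psi> a * ((real a ^ Suc p - real (a - 1) ^ Suc p) / fact (Suc p)))" for p and \<psi> :: "nat \<Rightarrow> real"
  proof -
    have "(\<Sum>f\<in>nondec_funs (Suc p) n. \<psi> (f (Suc p)) / block_fact (Suc p) n f) =
       (\<Sum>a=1..n. \<Sum>f\<in>{f \<in> nondec_funs (Suc p) n. f (Suc p) = a}. \<psi> (f (Suc p)) / block_fact (Suc p) n f)"
    proof (rule sum.group[symmetric])
      show "(\<lambda>f. f (Suc p)) ` nondec_funs (Suc p) n \<subseteq> {1..n}"
      proof (rule image_subsetI)
        fix f assume "f \<in> nondec_funs (Suc p) n"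
        then have "f \<in> {1..Suc p} \<rightarrow>\<^sub>E {1..n}" by (simp add: nondec_funs_def)
        then show "f (Suc p) \<in> {1..n}" by (rule PiE_mem) simp
      qed
    qed (simp_all add: finite_nondec_funs)
    also have "\<dots> = (\<Sum>a=1..n. \<psi> a * (\<Sum>f\<in>{f \<in> nondec_funs (Suc p) n. f (Suc p) = a}. 1 / block_fact (Suc p) n f))"
      unfolding sum_distrib_left by (intro sum.cong refl) auto
    finally show ?thesis using last_value_weight[of _ n p] by simp
  qed
  have "chain_sum n P p r = (\<Sum>f\<in>nondec_funs (Suc p) n. (\<Sum>g\<in>nondec_funs (Suc r) n.
     P (f (Suc p)) (g (Suc r)) / block_fact (Suc r) n g) / block_fact (Suc p) n f)"
    unfolding chain_sum_def sum_divide_distrib by (intro sum.cong refl) (simp add: mult.commute)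
  also have "\<dots> = (\<Sum>a=1..n. (\<Sum>b=1..n. P a b * ((real b ^ Suc r - real (b - 1) ^ Suc r) / fact (Suc r))) *
     ((real a ^ Suc p - real (a - 1) ^ Suc p) / fact (Suc p)))"
    unfolding group group[of "\<lambda>a. \<Sum>b=1..n. P a b * ((real b ^ Suc r - real (b - 1) ^ Suc r) / fact (Suc r))"] ..
  also have "\<dots> = (\<Sum>a=1..n. \<Sum>b=1..n. P a b *
     ((real a ^ Suc p - real (a - 1) ^ Suc p) / fact (Suc p)) * ((real b ^ Suc r - real (b - 1) ^ Suc r) / fact (Suc r)))"
    unfolding sum_distrib_right by (intro sum.cong refl) (simp only: mult_ac)
  finally show ?thesis .
qed

theorem pattern_weights_determine_uniform:
  assumes n: "n > 0"
    and row: "\<And>a. a \<in> {1..n} \<Longrightarrow> (\<Sum>b=1..n. P a b) = 1 / real n"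
    and col: "\<And>b. b \<in> {1..n} \<Longrightarrow> (\<Sum>a=1..n. P a b) = 1 / real n"
    and P1: "(\<Sum>z\<in>cells n. case_prod P z) = 1"
    and weights: "\<And>s \<sigma>. \<sigma> permutes {1..s} \<Longrightarrow> pattern_weight n P s \<sigma> = 1 / (fact s)\<^sup>2"
    and ab: "a \<in> {1..n}" "b \<in> {1..n}"
  shows "P a b = 1 / (real n)\<^sup>2"
proof -
  let ?U = "\<lambda>_ _. 1 / (real n)\<^sup>2"
  have rowU: "(\<Sum>b=1..n. ?U a b) = 1 / real n" for a using n by (simp add: power2_eq_square)
  have colU: "(\<Sum>a=1..n. ?U a b) = 1 / real n" for b using n by (simp add: power2_eq_square)
  have U1: "(\<Sum>z\<in>cells n. case_prod ?U z) = 1" using n by (simp add: cells_def power2_eq_square case_prod_beta)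
  have chain: "chain_sum n P p r = chain_sum n ?U p r" for p r
  proof -
    define N where "N = Suc (p + r)"
    define v where "v = (\<lambda>j. if j = Suc r then Suc p else Suc p + j)"
    have u_im: "(\<lambda>i. i) ` {1..Suc p} \<subseteq> {1..N}" by (auto simp: N_def)
    have v_im: "v ` {1..Suc r} \<subseteq> {1..N}" by (auto simp: N_def v_def)
    let ?\<phi> = "\<lambda>c \<tau> \<rho>. of_bool (strict_mono_on {1..Suc p} (key N (fst \<circ> c) \<tau> \<circ> (\<lambda>i. i))) *
      of_bool (strict_mono_on {1..Suc r} (key N (snd \<circ> c) \<rho> \<circ> v)) :: real"
    have "(1 / real n) ^ (p + r) * chain_sum n P p r = sample_mean N n P ?\<phi>"
      unfolding N_def v_def by (rule sample_mean_chains[symmetric]) (fact row, fact col)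
    also have "\<dots> = sample_mean N n ?U ?\<phi>"
      unfolding sample_mean_chains_from_weights[OF P1 u_im v_im] sample_mean_chains_from_weights[OF U1 u_im v_im]
    proof (intro sum.cong refl arg_cong2[of _ _ _ _ "(*)"])
      fix \<kappa> \<mu> assume "\<kappa> \<in> {\<kappa>. \<kappa> permutes {1..N}}" "\<mu> \<in> {\<mu>. \<mu> permutes {1..N}}"
      then have "inv \<mu> \<circ> \<kappa> permutes {1..N}" by (auto intro: permutes_compose permutes_inv)
      then show "pattern_weight n P N (inv \<mu> \<circ> \<kappa>) = pattern_weight n ?U N (inv \<mu> \<circ> \<kappa>)"
        by (simp add: weights pattern_weight_uniform[OF n])
    qed
    also have "\<dots> = (1 / real n) ^ (p + r) * chain_sum n ?U p r"
      unfolding N_def v_def by (rule sample_mean_chains) (rule rowU)+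
    finally show ?thesis using n by simp
  qed
  let ?D = "\<lambda>p a. real a ^ Suc p - real (a - 1) ^ Suc p"
  let ?Z = "\<lambda>a b. P a b - 1 / (real n)\<^sup>2"
  have zero: "(\<Sum>a=1..n. (\<Sum>b=1..n. ?Z a b * ?D r b) * ?D p a) = 0" for p r
  proof -
    have "(\<Sum>a=1..n. \<Sum>b=1..n. P a b * (?D p a / fact (Suc p)) * (?D r b / fact (Suc r))) =
        (\<Sum>a=1..n. \<Sum>b=1..n. 1 / (real n)\<^sup>2 * (?D p a / fact (Suc p)) * (?D r b / fact (Suc r)))"
      using chain[of p r] unfolding chain_sum_eq .
    then have "0 = (\<Sum>a=1..n. \<Sum>b=1..n. ?Z a b * (?D p a / fact (Suc p)) * (?D r b / fact (Suc r)))"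
      by (simp only: left_diff_distrib sum_subtractf)
    also have "\<dots> = (\<Sum>a=1..n. (\<Sum>b=1..n. ?Z a b * ?D r b) * ?D p a) / (fact (Suc p) * fact (Suc r))"
      unfolding sum_divide_distrib sum_distrib_right by (intro sum.cong refl) simp
    finally show ?thesis by simp
  qed
  \<comment> \<open>Separation in the first index for each fixed r; the identities obtained for all
    r then permit separation in the second.\<close>
  have "(\<Sum>b=1..n. ?Z a b * ?D r b) = 0" for r
    by (rule power_differences_separate[OF zero ab(1)])
  then have "?Z a b = 0" by (rule power_differences_separate[OF _ ab(2)])
  then show ?thesis by simp
qed

section \<open>The matrices and polynomials of the theorem\<close>

text \<open>Rank one: the outer product of two difference vectors reduces row, column and rectangle
  sums to sums in one index.\<close>

lemma Z_mat_eq: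
  "Z_mat j j' a b = (of_bool (a = j) - of_bool (a = j + 1)) * (of_bool (b = j') - of_bool (b = j' + 1))"
  by (auto simp: Z_mat_def)

lemma sum_step_zero: "j \<in> {1..n - 1} \<Longrightarrow> (\<Sum>a=1..n. of_bool (a = j) - of_bool (a = j + 1)) = (0 :: real)"
  for j n :: nat
  by (simp add: sum_subtractf of_bool_def) arith

lemma sum_step_initial:
  "j \<ge> 1 \<Longrightarrow> (\<Sum>a=1..i. of_bool (a = j) - of_bool (a = j + 1)) = (of_bool (i = j) :: real)" for j i :: nat
  by (simp add: sum_subtractf of_bool_def)

lemma coord_index:
  fixes n j j' :: nat
  assumes "j \<in> {1..n - 1}" "j' \<in> {1..n - 1}"
  shows "(j - 1) * (n - 1) + j' \<in> {1..(n - 1)\<^sup>2}"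
proof -
  have "(j - 1) * (n - 1) + j' \<le> (j - 1) * (n - 1) + (n - 1)" using assms by (intro add_left_mono) simp
  also have "\<dots> = j * (n - 1)" using assms by (cases j) auto
  also have "\<dots> \<le> (n - 1) * (n - 1)" using assms by (intro mult_le_mono1) simp
  finally show ?thesis using assms by (simp add: power2_eq_square)
qed

lemma coord_index_surj:
  fixes n i :: nat
  assumes "i \<in> {1..(n - 1)\<^sup>2}"
  shows "\<exists>j\<in>{1..n - 1}. \<exists>j'\<in>{1..n - 1}. i = (j - 1) * (n - 1) + j'"
proof -
  let ?m = "n - 1"
  have m: "?m > 0" using assms by (cases "?m = 0") auto
  have "i - 1 < ?m * ?m" using assms by (auto simp: power2_eq_square)
  then have "(i - 1) div ?m < ?m" by (rule less_mult_imp_div_less)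
  then have 1: "(i - 1) div ?m + 1 \<in> {1..?m}" unfolding atLeastAtMost_iff by linarith
  have "(i - 1) mod ?m < ?m" using m by (rule mod_less_divisor)
  then have 2: "(i - 1) mod ?m + 1 \<in> {1..?m}" unfolding atLeastAtMost_iff by linarith
  have "i = ((i - 1) div ?m + 1 - 1) * ?m + ((i - 1) mod ?m + 1)"
    using assms div_mult_mod_eq[of "i - 1" ?m] unfolding atLeastAtMost_iff add_diff_cancel_right'
    by linarith
  with 1 2 show ?thesis by blast
qed

lemma B_mat_row_sum: "(\<Sum>b=1..n. B_mat n x a b) = real n"
proof -
  have "(\<Sum>b=1..n. \<Sum>j=1..n - 1. \<Sum>j'=1..n - 1. x ((j - 1) * (n - 1) + j') * Z_mat j j' a b) =
     (\<Sum>j=1..n - 1. \<Sum>j'=1..n - 1. \<Sum>b=1..n. x ((j - 1) * (n - 1) + j') * Z_mat j j' a b)"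
    by (subst sum.swap) (intro sum.cong refl sum.swap)
  also have "\<dots> = 0"
    unfolding Z_mat_eq mult.assoc[symmetric] sum_distrib_left[symmetric]
    by (intro sum.neutral ballI) (simp only: sum_step_zero mult_zero_right)
  finally show ?thesis by (simp add: B_mat_def sum.distrib)
qed

lemma B_mat_col_sum: "(\<Sum>a=1..n. B_mat n x a b) = real n"
proof -
  have "(\<Sum>a=1..n. \<Sum>j=1..n - 1. \<Sum>j'=1..n - 1. x ((j - 1) * (n - 1) + j') * Z_mat j j' a b) =
     (\<Sum>j=1..n - 1. \<Sum>j'=1..n - 1. \<Sum>a=1..n. x ((j - 1) * (n - 1) + j') * Z_mat j j' a b)"
    by (subst sum.swap) (intro sum.cong refl sum.swap)
  also have "\<dots> = 0"
    unfolding Z_mat_eq mult.left_commute[of "x _"] sum_distrib_right[symmetric]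
    by (intro sum.neutral ballI) (simp only: sum_step_zero mult_zero_left)
  finally show ?thesis by (simp add: B_mat_def sum.distrib)
qed

text \<open>The difference vector at j sums to 0 over {1..i} unless i = j. So the coordinates of x
  are recovered from B, and B = J forces them to vanish.\<close>

lemma B_mat_partial_sum:
  assumes i: "i \<in> {1..n - 1}" "i' \<in> {1..n - 1}"
  shows "(\<Sum>a=1..i. \<Sum>b=1..i'. B_mat n x a b - 1) = x ((i - 1) * (n - 1) + i')"
proof -
  let ?x = "\<lambda>j j'. x ((j - 1) * (n - 1) + j')"
  let ?s = "\<lambda>j a. of_bool (a = j) - of_bool (a = j + 1) :: real"
  have "(\<Sum>a=1..i. \<Sum>b=1..i'. B_mat n x a b - 1) =
     (\<Sum>a=1..i. \<Sum>b=1..i'. \<Sum>j=1..n - 1. \<Sum>j'=1..n - 1. ?x j j' * (?s j a * ?s j' b))"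
    unfolding B_mat_def Z_mat_eq by simp
  also have "\<dots> = (\<Sum>a=1..i. \<Sum>j=1..n - 1. \<Sum>j'=1..n - 1. \<Sum>b=1..i'. ?x j j' * (?s j a * ?s j' b))"
  proof (rule sum.cong[OF refl])
    fix a
    show "(\<Sum>b=1..i'. \<Sum>j=1..n - 1. \<Sum>j'=1..n - 1. ?x j j' * (?s j a * ?s j' b)) =
      (\<Sum>j=1..n - 1. \<Sum>j'=1..n - 1. \<Sum>b=1..i'. ?x j j' * (?s j a * ?s j' b))"
      by (subst sum.swap) (intro sum.cong refl sum.swap)
  qed
  also have "\<dots> = (\<Sum>j=1..n - 1. \<Sum>j'=1..n - 1. \<Sum>a=1..i. \<Sum>b=1..i'. ?x j j' * (?s j a * ?s j' b))"
    by (subst sum.swap) (intro sum.cong refl sum.swap)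
  also have "\<dots> = (\<Sum>j=1..n - 1. \<Sum>j'=1..n - 1. ?x j j' * ((\<Sum>a=1..i. ?s j a) * (\<Sum>b=1..i'. ?s j' b)))"
    unfolding sum_product unfolding sum_distrib_left ..
  also have "\<dots> = (\<Sum>j=1..n - 1. \<Sum>j'=1..n - 1. if j' = i' then (if j = i then ?x i i' else 0) else 0)"
    by (intro sum.cong refl) (auto simp: sum_step_initial)
  also have "\<dots> = ?x i i'" using i by simp
  finally show ?thesis .
qed

lemma abs_B_mat_diff_le:
  assumes x: "\<And>j. j \<in> {1..(n - 1)\<^sup>2} \<Longrightarrow> \<bar>x j\<bar> \<le> \<delta>" and "\<delta> \<ge> 0"
  shows "\<bar>B_mat n x a b - 1\<bar> \<le> real ((n - 1)\<^sup>2) * \<delta>"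
proof -
  have "\<bar>B_mat n x a b - 1\<bar> \<le> (\<Sum>j=1..n - 1. \<Sum>j'=1..n - 1. \<bar>x ((j - 1) * (n - 1) + j') * Z_mat j j' a b\<bar>)"
    unfolding B_mat_def add_diff_cancel_left' by (intro order_trans[OF sum_abs] sum_mono sum_abs)
  also have "\<dots> \<le> (\<Sum>j=1..n - 1. \<Sum>j'=1..n - 1. \<delta> * 1)"
    using x coord_index by (intro sum_mono abs_mult_le_mult) (auto simp: Z_mat_def simp del: atLeastAtMost_iff)
  also have "\<dots> = real ((n - 1)\<^sup>2) * \<delta>" by (simp add: power2_eq_square)
  finally show ?thesis .
qed

lemma polyfun_h_poly: "polyfun ((n - 1)\<^sup>2) (h_poly n \<sigma>)"
proof -
  have B: "polyfun ((n - 1)\<^sup>2) (\<lambda>x. B_mat n x a b)" for a b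
    unfolding B_mat_def
    by (intro polyfun_add polyfun_const polyfun_sum polyfun_mult polyfun_coord coord_index)
  show ?thesis
    unfolding h_poly_def Let_def
    by (intro polyfun_add polyfun_const polyfun_sum polyfun_mult polyfun_divide polyfun_prod B)
qed

text \<open>Ties the polynomial to the sampling model: for nonnegative B, up to a positive factor,
  \<open>h_poly\<close> is the density of \<sigma> in the step permuton minus 1/s!.\<close>

lemma h_poly_eq_pattern_weight:
  assumes "n > 0"
  shows "h_poly n (s, \<sigma>) x =
    real n ^ (2 * s) * (fact s * pattern_weight n (\<lambda>a b. B_mat n x a b / (real n)\<^sup>2) s \<sigma> - 1 / fact s)"
proof -
  have "pattern_weight n (\<lambda>a b. B_mat n x a b / (real n)\<^sup>2) s \<sigma> =
     (\<Sum>f\<in>nondec_funs s n. \<Sum>g\<in>nondec_funs s n. (\<Prod>i=1..s. B_mat n x (f i) (g (\<sigma> i))) /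
        (\<Prod>i=1..n. fact (card {j \<in> {1..s}. f j = i}) * fact (card {j \<in> {1..s}. g j = i}))) / real n ^ (2 * s)"
    unfolding pattern_weight_def block_fact_def prod.distrib prod_dividef sum_divide_distrib
    by (intro sum.cong refl) (simp add: power_mult[symmetric])
  then show ?thesis
    unfolding h_poly_def Let_def fst_conv snd_conv using assms by (simp add: algebra_simps)
qed

theorem theorem10:
  fixes k n :: nat
    and \<pi> :: "nat \<Rightarrow> sized_perm"
    and \<alpha> :: "nat \<Rightarrow> real"
    and w_pos w_neg :: "nat \<Rightarrow> real"
  assumes perms: "\<forall>i\<in>{1..k}. is_perm (\<pi> i)"
    and n: "n \<ge> 2"
    and dim: "(n - 1)\<^sup>2 \<ge> k + 2"
    and indep: "lin_indep_family ((n - 1)\<^sup>2) (k - 1) (\<lambda>i. gradient (h_poly n (\<pi> i)) (\<lambda>_. 0))"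
    and nonzero: "\<exists>i\<in>{1..k}. \<alpha> i \<noteq> 0"
    and dep: "\<forall>j\<in>{1..(n - 1)\<^sup>2}. (\<Sum>i = 1..k. \<alpha> i * gradient (h_poly n (\<pi> i)) (\<lambda>_. 0) j) = 0"
    and orth_pos: "\<forall>i\<in>{1..k - 1}.
      inner_prod ((n - 1)\<^sup>2) w_pos (gradient (h_poly n (\<pi> i)) (\<lambda>_. 0)) = 0"
    and orth_neg: "\<forall>i\<in>{1..k - 1}.
      inner_prod ((n - 1)\<^sup>2) w_neg (gradient (h_poly n (\<pi> i)) (\<lambda>_. 0)) = 0"
    and pos: "quad_form ((n - 1)\<^sup>2)
      (\<lambda>a b. \<Sum>i = 1..k. \<alpha> i * hessian (h_poly n (\<pi> i)) (\<lambda>_. 0) a b) w_pos > 0"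
    and neg: "quad_form ((n - 1)\<^sup>2)
      (\<lambda>a b. \<Sum>i = 1..k. \<alpha> i * hessian (h_poly n (\<pi> i)) (\<lambda>_. 0) a b) w_neg < 0"
  shows "\<not> quasirandom_forcing (\<pi> ` {1..k})"
proof
  assume forcing: "quasirandom_forcing (\<pi> ` {1..k})"
  let ?N = "(n - 1)\<^sup>2"
  have n0: "n > 0" and N0: "real ?N > 0" using n by auto
  have h0: "h_poly n (\<pi> i) (\<lambda>_. 0) = 0" for i
  proof (cases "\<pi> i")
    case (Pair s \<sigma>)
    show ?thesis
      using pattern_weight_uniform[OF n0, of s \<sigma>]
      unfolding Pair h_poly_eq_pattern_weight[OF n0]
      by (simp add: B_mat_def power2_eq_square)
  qed
  \<comment> \<open>With coordinates of this size the (n - 1)^2 terms of an entry of B add up to at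
    most 1 in absolute value, so B stays nonnegative.\<close>
  have \<delta>: "1 / real ?N > 0" using N0 by simp
  have "\<exists>x. (\<forall>i\<in>{1..k}. h_poly n (\<pi> i) x = 0) \<and> (\<exists>j\<in>{1..?N}. x j \<noteq> 0) \<and> (\<forall>j\<in>{1..?N}. \<bar>x j\<bar> \<le> 1 / real ?N)"
    by (rule polyfun_common_zero[where h = "\<lambda>i. h_poly n (\<pi> i)", OF polyfun_h_poly h0
          indep nonzero dep orth_pos orth_neg pos neg \<delta>])
  then obtain x where hx: "\<forall>i\<in>{1..k}. h_poly n (\<pi> i) x = 0" and x_nz: "\<exists>j\<in>{1..?N}. x j \<noteq> 0"
    and x_small: "\<And>j. j \<in> {1..?N} \<Longrightarrow> \<bar>x j\<bar> \<le> 1 / real ?N" by blast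
  define P where "P = (\<lambda>a b. B_mat n x a b / (real n)\<^sup>2)"
  have row: "(\<Sum>b=1..n. P a b) = 1 / real n" for a
    unfolding P_def sum_divide_distrib[symmetric] B_mat_row_sum by (simp add: power2_eq_square)
  have col: "(\<Sum>a=1..n. P a b) = 1 / real n" for b
    unfolding P_def sum_divide_distrib[symmetric] B_mat_col_sum by (simp add: power2_eq_square)
  have P1: "(\<Sum>z\<in>cells n. case_prod P z) = 1"
    unfolding cells_def sum.cartesian_product[symmetric] row using n0 by simp
  have "\<bar>B_mat n x a b - 1\<bar> \<le> 1" for a b
    using abs_B_mat_diff_le[of n x "1 / real ?N" a b] x_small N0 by simp
  then have B0: "B_mat n x a b \<ge> 0" for a b by (smt (verit))
  have P0: "case_prod P z \<ge> 0" if "z \<in> cells n" for z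
    using B0 by (simp add: P_def case_prod_beta)
  have "\<exists>s \<sigma>. \<sigma> permutes {1..s} \<and> pattern_weight n P s \<sigma> \<noteq> 1 / (fact s)\<^sup>2"
  proof (rule ccontr)
    assume "\<not> ?thesis"
    then have "P a b = 1 / (real n)\<^sup>2" if "a \<in> {1..n}" "b \<in> {1..n}" for a b
      using pattern_weights_determine_uniform[OF n0 row col P1 _ that] by blast
    then have B1: "B_mat n x a b = 1" if "a \<in> {1..n}" "b \<in> {1..n}" for a b
      using that n0 by (simp add: P_def)
    obtain j where j: "j \<in> {1..?N}" "x j \<noteq> 0" using x_nz by blast
    obtain i i' where i: "i \<in> {1..n - 1}" "i' \<in> {1..n - 1}" "j = (i - 1) * (n - 1) + i'"
      using coord_index_surj[OF j(1)] by blast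
    have "(\<Sum>a=1..i. \<Sum>b=1..i'. B_mat n x a b - 1) = 0"
      using i B1 by (intro sum.neutral ballI) auto
    then show False using B_mat_partial_sum[OF i(1,2), of x] i(3) j(2) by simp
  qed
  then obtain s \<sigma> where \<sigma>: "\<sigma> permutes {1..s}" and w: "pattern_weight n P s \<sigma> \<noteq> 1 / (fact s)\<^sup>2" by blast
  \<comment> \<open>The deviating pattern joins the given ones, so that one and the same sequence
    has the right limits for these and a wrong limit for it.\<close>
  define S where "S = insert (s, \<sigma>) (\<pi> ` {1..k})"
  have "finite S" and S: "is_perm \<upsilon>" if "\<upsilon> \<in> S" for \<upsilon>
    using that perms \<sigma> by (auto simp: S_def is_perm_def)
  then obtain p where p: "\<forall>m. is_perm (p m)" "filterlim (\<lambda>m. fst (p m)) at_top sequentially"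
    and lim: "\<forall>\<upsilon>\<in>S.
      (\<lambda>m. pattern_density \<upsilon> (p m)) \<longlonglongrightarrow> fact (fst \<upsilon>) * pattern_weight n P (fst \<upsilon>) (snd \<upsilon>)"
    using permutations_with_densities[OF _ S P0 P1, of S] by (auto simp: S_def)
  have "(\<lambda>m. pattern_density \<upsilon> (p m)) \<longlonglongrightarrow> 1 / fact (fst \<upsilon>)" if "\<upsilon> \<in> \<pi> ` {1..k}" for \<upsilon>
  proof -
    have "h_poly n (fst \<upsilon>, snd \<upsilon>) x = 0" using that hx by auto
    then have "fact (fst \<upsilon>) * pattern_weight n P (fst \<upsilon>) (snd \<upsilon>) = 1 / fact (fst \<upsilon>)"
      unfolding h_poly_eq_pattern_weight[OF n0] P_def using n0 by simp
    then show ?thesis using lim that by (auto simp: S_def)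
  qed
  then have "(\<lambda>m. pattern_density (s, \<sigma>) (p m)) \<longlonglongrightarrow> 1 / fact (fst (s, \<sigma>))"
    using forcing p \<sigma> unfolding quasirandom_forcing_def by (auto simp: is_perm_def)
  moreover have "(\<lambda>m. pattern_density (s, \<sigma>) (p m)) \<longlonglongrightarrow> fact s * pattern_weight n P s \<sigma>"
    using lim by (auto simp: S_def)
  ultimately have "fact s * pattern_weight n P s \<sigma> = 1 / fact s"
    using LIMSEQ_unique by fastforce
  then have "pattern_weight n P s \<sigma> = 1 / (fact s)\<^sup>2"
    by (simp add: field_simps power2_eq_square)
  with w show False by contradiction
qed

end
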